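(* Let $n\geq m\geq 0$, and suppose that $\delta$ is invertible in $R$ or that $m<n$. Then the maps \[ \iota_\ast\colon\mathrm{Tor}_\ast^{R\mathfrak S_n}(\mathbb 1,R\mathfrak S_n\otimes_{R\mathfrak S_m}\mathbb 1)\longrightarrow\mathrm{Tor}_\ast^{\mathcal P_n}(\mathbb 1,\mathcal P_n\otimes_{\mathcal P_m}\mathbb 1) \] and \[ \pi_\ast\colon\mathrm{Tor}_\ast^{\mathcal P_n}(\mathbb 1,\mathcal P_n\otimes_{\mathcal P_m}\mathbb 1)\longrightarrow\mathrm{Tor}_\ast^{R\mathfrak S_n}(\mathbb 1,R\mathfrak S_n\otimes_{R\mathfrak S_m}\mathbb 1) \] induced by the inclusion $\iota$ and projection $\pi$ are mutually inverse isomorphisms.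
   Context: $R$ is a commutative ring, $\delta\in R$, and $\mathcal P_n=\mathcal P_n(R,\delta)$ is the partition algebra: the free $R$-module on set partitions ("diagrams") of $\{-n,\dots,-1,1,\dots,n\}$, with product by stacking (identifying right nodes of the first diagram with left nodes of the second), taking the induced partition on outer nodes, and multiplying by $\delta$ for each component consisting only of middle nodes. Permutation diagrams (all blocks of the form $\{-i,j\}$) give an algebra inclusion $\iota\colon R\mathfrak S_n\to\mathcal P_n$; $\pi\colon\mathcal P_n\to R\mathfrak S_n$ sends permutation diagrams to the corresponding permutations and other diagrams to $0$. The trivial module $\mathbb 1$ of $\mathcal P_n$ is $R$ with permutation diagrams acting as identity and other diagrams as $0$ (both sides); the trivial $R\mathfrak S_n$-module $\mathbb 1$ is $R$ with trivial action. For $m\leq n$, $\mathcal P_m\subseteq\mathcal P_n$ via relabelling $\pm i\mapsto\pm(n-m+i)$ and adjoining the blocks $\{-i,i\}$ for $1\leq i\leq n-m$; this restricts to $\mathfrak S_m\subseteq\mathfrak S_n$, and $\iota,\pi$ are compatible with these inclusions and with the trivial modules, hence induce the displayed maps. *)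

theory Defs
  imports Main "HOL-Library.Disjoint_Sets" "HOL-Combinatorics.Permutations"
begin

section \<open>Partition diagrams\<close>

text \<open>Nodes of a diagram of size n: left nodes -n..-1, right nodes 1..n.\<close>
definition nodes :: "nat \<Rightarrow> int set" where
  "nodes n = {- int n .. -1} \<union> {1 .. int n}"

definition diagrams :: "nat \<Rightarrow> int set set set" where
  "diagrams n = {P. partition_on (nodes n) P}"

text \<open>Stacking: the first diagram occupies layers 0 (left) and 1 (right), the second
  layers 1 (left) and 2 (right); its right nodes are identified with the left nodes
  of the second diagram (layer 1 = middle).\<close>
definition lift1 :: "int \<Rightarrow> nat \<times> nat" where
  "lift1 x = (if x < 0 then (0, nat (- x)) else (1, nat x))"

definition lift2 :: "int \<Rightarrow> nat \<times> nat" where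
  "lift2 x = (if x < 0 then (1, nat (- x)) else (2, nat x))"

definition unlift :: "nat \<times> nat \<Rightarrow> int" where
  "unlift u = (if fst u = 0 then - int (snd u) else int (snd u))"

definition stack_rel :: "int set set \<Rightarrow> int set set \<Rightarrow> ((nat \<times> nat) \<times> (nat \<times> nat)) set" where
  "stack_rel d1 d2 =
     {(u, v). \<exists>B\<in>d1. u \<in> lift1 ` B \<and> v \<in> lift1 ` B} \<union>
     {(u, v). \<exists>B\<in>d2. u \<in> lift2 ` B \<and> v \<in> lift2 ` B}"

definition stack_nodes :: "nat \<Rightarrow> (nat \<times> nat) set" where
  "stack_nodes n = {0, 1, 2} \<times> {1 .. n}"

text \<open>Connected components of the stacked picture.\<close>
definition components :: "nat \<Rightarrow> int set set \<Rightarrow> int set set \<Rightarrow> (nat \<times> nat) set set" where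
  "components n d1 d2 = stack_nodes n // ((stack_rel d1 d2)\<^sup>*)"

definition diag_prod :: "nat \<Rightarrow> int set set \<Rightarrow> int set set \<Rightarrow> int set set" where
  "diag_prod n d1 d2 =
     {unlift ` (C \<inter> {u. fst u \<noteq> 1}) | C. C \<in> components n d1 d2 \<and> C \<inter> {u. fst u \<noteq> 1} \<noteq> {}}"

text \<open>Number of components consisting only of middle nodes.\<close>
definition loops :: "nat \<Rightarrow> int set set \<Rightarrow> int set set \<Rightarrow> nat" where
  "loops n d1 d2 = card {C \<in> components n d1 d2. C \<subseteq> {u. fst u = 1}}"

definition is_perm_diag :: "int set set \<Rightarrow> bool" where
  "is_perm_diag d \<longleftrightarrow> (\<forall>B\<in>d. \<exists>i j :: int. i > 0 \<and> j > 0 \<and> B = {- i, j})"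

text \<open>Permutation diagram of sigma: blocks {-sigma i, i}; then
  perm_diag (sigma o tau) = perm_diag sigma * perm_diag tau.\<close>
definition perm_diag :: "nat \<Rightarrow> (nat \<Rightarrow> nat) \<Rightarrow> int set set" where
  "perm_diag n \<sigma> = (\<lambda>i. {- int (\<sigma> i), int i}) ` {1 .. n}"

definition perm_of :: "nat \<Rightarrow> int set set \<Rightarrow> (nat \<Rightarrow> nat)" where
  "perm_of n d = (THE \<sigma>. \<sigma> permutes {1 .. n} \<and> perm_diag n \<sigma> = d)"

text \<open>Inclusion P_m in P_n: relabel +-i to +-(n-m+i) and add blocks {-i,i}, i <= n-m.\<close>
definition shift_node :: "nat \<Rightarrow> int \<Rightarrow> int" where
  "shift_node k x = (if x < 0 then x - int k else x + int k)"

definition diag_emb :: "nat \<Rightarrow> nat \<Rightarrow> int set set \<Rightarrow> int set set" where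
  "diag_emb n m d = (\<lambda>B. shift_node (n - m) ` B) ` d \<union> (\<lambda>i. {- int i, int i}) ` {1 .. n - m}"

definition perm_emb :: "nat \<Rightarrow> nat \<Rightarrow> (nat \<Rightarrow> nat) \<Rightarrow> (nat \<Rightarrow> nat)" where
  "perm_emb n m \<sigma> = (\<lambda>i. if n - m < i \<and> i \<le> n then \<sigma> (i - (n - m)) + (n - m) else i)"

section \<open>Algebras with a multiplicative basis, and the bar complex\<close>

text \<open>An R-algebra free on the basis bas, with product of basis elements
  b1 * b2 = coef b1 b2 \<cdot> mul b1 b2, augmentation aug (the trivial module 1),
  and the basis subb of a subalgebra (image of the smaller algebra's basis).\<close>
record ('a, 'b) malg =
  bas :: "'b set"
  mul :: "'b \<Rightarrow> 'b \<Rightarrow> 'b"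
  coef :: "'b \<Rightarrow> 'b \<Rightarrow> 'a"
  aug :: "'b \<Rightarrow> 'a"
  subb :: "'b set"

definition tuples :: "'b set \<Rightarrow> nat \<Rightarrow> 'b list set" where
  "tuples B j = {l. length l = j \<and> set l \<subseteq> B}"

definition bvec :: "'b list \<Rightarrow> 'b list \<Rightarrow> 'a::comm_ring_1" where
  "bvec l = (\<lambda>l'. if l' = l then 1 else 0)"

definition merge :: "('b \<Rightarrow> 'b \<Rightarrow> 'b) \<Rightarrow> nat \<Rightarrow> 'b list \<Rightarrow> 'b list" where
  "merge p i l = take i l @ [p (l ! i) (l ! Suc i)] @ drop (Suc (Suc i)) l"

text \<open>Differential of 1 (x) A^k (x) N on the basis tensor a_1 (x) .. (x) a_k (x) x
  (represented by the list [a_1,..,a_k,x], x a representative in A of an element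
  of N = A (x)_{A'} 1).\<close>
definition bar_db :: "('a::comm_ring_1, 'b) malg \<Rightarrow> 'b list \<Rightarrow> 'b list \<Rightarrow> 'a" where
  "bar_db A l = (\<lambda>l'. if 2 \<le> length l then
      aug A (hd l) * bvec (tl l) l'
      + (\<Sum>i < length l - 1. (-1) ^ (Suc i) * coef A (l ! i) (l ! Suc i) * bvec (merge (mul A) i l) l')
    else 0)"

definition bar_d :: "('a::comm_ring_1, 'b) malg \<Rightarrow> nat \<Rightarrow> ('b list \<Rightarrow> 'a) \<Rightarrow> 'b list \<Rightarrow> 'a" where
  "bar_d A k c = (\<lambda>l'. \<Sum>l \<in> tuples (bas A) (Suc k). c l * bar_db A l l')"

definition chains :: "('a::comm_ring_1, 'b) malg \<Rightarrow> nat \<Rightarrow> ('b list \<Rightarrow> 'a) set" where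
  "chains A k = {c. \<forall>l. l \<notin> tuples (bas A) (Suc k) \<longrightarrow> c l = 0}"

definition rspan :: "('c \<Rightarrow> 'a::comm_ring_1) set \<Rightarrow> ('c \<Rightarrow> 'a) set" where
  "rspan G = {c. \<exists>f. c = (\<lambda>l. \<Sum>g\<in>G. f g * g l)}"

text \<open>Generators of A^k (x) K where K = span {x e - aug(e) x} so that A/K = A (x)_{A'} 1.\<close>
definition rel_gens :: "('a::comm_ring_1, 'b) malg \<Rightarrow> nat \<Rightarrow> ('b list \<Rightarrow> 'a) set" where
  "rel_gens A k = {(\<lambda>l'. coef A x e * bvec (as @ [mul A x e]) l' - aug A e * bvec (as @ [x]) l')
     | as x e. as \<in> tuples (bas A) k \<and> x \<in> bas A \<and> e \<in> subb A}"

definition relsub :: "('a::comm_ring_1, 'b) malg \<Rightarrow> nat \<Rightarrow> ('b list \<Rightarrow> 'a) set" where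
  "relsub A k = rspan (rel_gens A k)"

definition cycles :: "('a::comm_ring_1, 'b) malg \<Rightarrow> nat \<Rightarrow> ('b list \<Rightarrow> 'a) set" where
  "cycles A k = {z \<in> chains A k. bar_d A k z \<in> relsub A (k - 1)}"

definition boundaries :: "('a::comm_ring_1, 'b) malg \<Rightarrow> nat \<Rightarrow> ('b list \<Rightarrow> 'a) set" where
  "boundaries A k = {c. \<exists>w \<in> chains A (Suc k). \<exists>s \<in> relsub A k. c = (\<lambda>l. bar_d A (Suc k) w l + s l)}"

text \<open>Chain map induced by a map of bases f, where basis elements not satisfying P go to 0.\<close>
definition chmap :: "('a::comm_ring_1, 'b) malg \<Rightarrow> ('b \<Rightarrow> bool) \<Rightarrow> ('b \<Rightarrow> 'c) \<Rightarrow> nat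
    \<Rightarrow> ('b list \<Rightarrow> 'a) \<Rightarrow> 'c list \<Rightarrow> 'a" where
  "chmap A P f k c = (\<lambda>l'. \<Sum>l \<in> {l \<in> tuples (bas A) (Suc k). list_all P l \<and> map f l = l'}. c l)"

section \<open>The two algebras\<close>

definition Palg :: "nat \<Rightarrow> nat \<Rightarrow> 'a::comm_ring_1 \<Rightarrow> ('a, int set set) malg" where
  "Palg n m \<delta> = \<lparr> bas = diagrams n, mul = diag_prod n,
      coef = (\<lambda>d1 d2. \<delta> ^ loops n d1 d2),
      aug = (\<lambda>d. if is_perm_diag d then 1 else 0),
      subb = diag_emb n m ` diagrams m \<rparr>"

definition Salg :: "nat \<Rightarrow> nat \<Rightarrow> ('a::comm_ring_1, nat \<Rightarrow> nat) malg" where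
  "Salg n m = \<lparr> bas = {\<sigma>. \<sigma> permutes {1 .. n}}, mul = (\<circ>),
      coef = (\<lambda>_ _. 1), aug = (\<lambda>_. 1),
      subb = perm_emb n m ` {\<sigma>. \<sigma> permutes {1 .. m}} \<rparr>"

definition iota_ch :: "nat \<Rightarrow> nat \<Rightarrow> nat \<Rightarrow> ((nat \<Rightarrow> nat) list \<Rightarrow> 'a::comm_ring_1) \<Rightarrow> int set set list \<Rightarrow> 'a" where
  "iota_ch n m k = chmap (Salg n m) (\<lambda>_. True) (perm_diag n) k"

definition pi_ch :: "nat \<Rightarrow> nat \<Rightarrow> 'a::comm_ring_1 \<Rightarrow> nat \<Rightarrow> (int set set list \<Rightarrow> 'a) \<Rightarrow> (nat \<Rightarrow> nat) list \<Rightarrow> 'a" where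
  "pi_ch n m \<delta> k = chmap (Palg n m \<delta>) is_perm_diag (perm_of n) k"

end

theory Submission
  imports Defs
begin

text \<open>
  Write A = P_n, G = S_m and let J be the left ideal of A generated by the non-permutation diagrams of
  P_m. It is spanned by the diagrams in which, among the right nodes above n - m, some node is
  a singleton block or two nodes lie in one block. Prescribing which nodes are singletons and which pairs are
  joined covers this basis of J by strata that are closed under intersection. When delta is invertible or
  m < n, each nonempty stratum spans a left ideal A e on which e acts from the right as a unit, so
  appending e contracts the bar complex with coefficients in A e; by Mayer-Vietoris the bar complex with
  coefficients in J is acyclic. Hence, modulo J, the tuples that are not made of permutations only form
  an acyclic complex. It is a complex of free right G-modules, so it has a G-equivariant contracting
  homotopy and stays acyclic after passing to coinvariants. As A tensored over P_m with the trivial module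
  is the module of G-coinvariants of A / J, the result is the kernel of the chain map pi, of which iota
  is a section.
\<close>

section \<open>Coinvariants of acyclic complexes with a free group action\<close>

text \<open>Freeness takes its place. A tuple whose last diagram lies outside J has trivial
  stabiliser, whereas in J two joined or two isolated right nodes can be exchanged without effect;
  this is why J is divided out before G is. Tuples with a non-permutation entry can be treated on
  their own because the non-permutation diagrams span an ideal on which the augmentation vanishes.
  The condition on delta and m enters through e: a diagram that isolates a right node together with
  its left copy closes a loop against an isolated node, and the resulting factor delta has to be a
  unit. When m < n the left copy can instead be attached to the right node 1, which lies below the
  nodes of P_m, and then no loop arises.\<close>

locale free_equivariant_complex =
  fixes Y :: "nat \<Rightarrow> 'y set" and D :: "'y \<Rightarrow> 'y \<Rightarrow> 'a::comm_ring_1"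
    and G :: "'g set" and act :: "'g \<Rightarrow> 'y \<Rightarrow> 'y"
  assumes Y_0: "Y 0 = {}"
    and finite_Y: "finite (Y k)"
    and finite_G: "finite G"
    and D_D: "l \<in> Y (Suc (Suc k)) \<Longrightarrow> l'' \<in> Y k \<Longrightarrow> (\<Sum>w\<in>Y (Suc k). D l w * D w l'') = 0"
    \<comment> \<open>Degree shift: \<open>Y (Suc k)\<close> is the basis in degree k. As
      \<open>Y 0\<close> is empty, the case k = 0 has a vacuous premise and says that the boundary
      into degree 0 is surjective.\<close>
    and exact: "(\<And>l'. l' \<in> Y k \<Longrightarrow> (\<Sum>l\<in>Y (Suc k). z l * D l l') = 0) \<Longrightarrow>
      \<exists>w. \<forall>l'\<in>Y (Suc k). z l' = (\<Sum>l\<in>Y (Suc (Suc k)). w l * D l l')"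
    and bij_act: "g \<in> G \<Longrightarrow> bij_betw (act g) (Y k) (Y k)"
    and unit_act: "\<exists>g\<in>G. \<forall>k. \<forall>l\<in>Y k. act g l = l"
    and mult_act: "g \<in> G \<Longrightarrow> h \<in> G \<Longrightarrow> \<exists>i\<in>G. \<forall>k. \<forall>l\<in>Y k. act i l = act g (act h l)"
    and inv_act: "g \<in> G \<Longrightarrow> \<exists>h\<in>G. \<forall>k. \<forall>l\<in>Y k. act h (act g l) = l"
    and free_act: "g \<in> G \<Longrightarrow> h \<in> G \<Longrightarrow> l \<in> Y k \<Longrightarrow> act g l = act h l \<Longrightarrow> l' \<in> Y k' \<Longrightarrow> act g l' = act h l'"
    and D_act: "g \<in> G \<Longrightarrow> l \<in> Y (Suc k) \<Longrightarrow> l' \<in> Y k \<Longrightarrow> D (act g l) (act g l') = D l l'"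
begin

lemma act_closed: "g \<in> G \<Longrightarrow> l \<in> Y k \<Longrightarrow> act g l \<in> Y k"
  using bij_act bij_betwE by blast

lemma act_eq_iff: "g \<in> G \<Longrightarrow> l \<in> Y k \<Longrightarrow> l' \<in> Y k \<Longrightarrow> act g l = act g l' \<longleftrightarrow> l = l'"
  using bij_act[of g k] by (auto simp: bij_betw_def inj_on_def)

lemma sum_act: "g \<in> G \<Longrightarrow> (\<Sum>l\<in>Y k. f (act g l)) = (\<Sum>l\<in>Y k. f l)"
  by (rule sum.reindex_bij_betw[OF bij_act])

text \<open>\<open>h\<close> is read as the matrix of a linear map from chains on \<open>Y k\<close>
  to chains on \<open>Y (Suc k)\<close>, row \<open>l\<close> being the image of \<open>l\<close>.
  As G permutes both bases, invariance of the entries says that this map commutes with G.\<close>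

definition equivariant :: "nat \<Rightarrow> ('y \<Rightarrow> 'y \<Rightarrow> 'a) \<Rightarrow> bool" where
  "equivariant k h \<longleftrightarrow> (\<forall>g\<in>G. \<forall>l\<in>Y k. \<forall>l'\<in>Y (Suc k). h (act g l) (act g l') = h l l')"

text \<open>\<open>rep\<close> picks a point of the orbit viewed as a set, so it is automatically
  constant on orbits, and \<open>gg l\<close> leads from the chosen point back to \<open>l\<close>.
  With these choices a map can be prescribed at one point of each orbit and moved along it.\<close>

lemma ex_representatives:
  "\<exists>rep gg. \<forall>l\<in>Y k. rep l \<in> Y k \<and> gg l \<in> G \<and> act (gg l) (rep l) = l \<and>
     (\<forall>g\<in>G. rep (act g l) = rep l)"
proof -
  define orbit where "orbit l = (\<lambda>g. act g l) ` G" for l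
  have in_orbit: "l \<in> orbit l" if "l \<in> Y k" for l
    using unit_act that unfolding orbit_def by (metis image_eqI)
  have orbit_act: "orbit (act g l) = orbit l" if g: "g \<in> G" and l: "l \<in> Y k" for g l
  proof
    show "orbit (act g l) \<subseteq> orbit l"
      unfolding orbit_def using mult_act[OF _ g] l by (auto simp: image_iff) metis
    obtain h where h: "h \<in> G" "act h (act g l) = l" using inv_act[OF g] l by blast
    show "orbit l \<subseteq> orbit (act g l)"
    proof
      fix y assume "y \<in> orbit l"
      then obtain i where i: "i \<in> G" "y = act i l" unfolding orbit_def by auto
      obtain j where "j \<in> G" "act j (act g l) = act i (act h (act g l))"
        using mult_act[OF i(1) h(1)] act_closed[OF g l] by blast
      then show "y \<in> orbit (act g l)" unfolding orbit_def using h(2) i(2) by (metis image_eqI)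
    qed
  qed
  define rep where "rep l = (SOME r. r \<in> orbit l)" for l
  have rep: "rep l \<in> orbit l" if "l \<in> Y k" for l
    unfolding rep_def using in_orbit[OF that] by (rule someI)
  have "\<exists>g\<in>G. act g (rep l) = l" if l: "l \<in> Y k" for l
  proof -
    obtain h where "h \<in> G" "rep l = act h l" using rep[OF l] by (auto simp: orbit_def)
    then show ?thesis using inv_act[of h] l by metis
  qed
  then obtain gg where gg: "\<And>l. l \<in> Y k \<Longrightarrow> gg l \<in> G \<and> act (gg l) (rep l) = l" by metis
  moreover have "rep l \<in> Y k" if "l \<in> Y k" for l
    using rep[OF that] act_closed that by (auto simp: orbit_def)
  moreover have "rep (act g l) = rep l" if "g \<in> G" "l \<in> Y k" for g l
    using orbit_act[OF that] by (simp add: rep_def)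
  ultimately show ?thesis by blast
qed

text \<open>One step in building a contracting homotopy. The hypothesis \<open>DhD\<close> makes
  every chain r - h(D r) a cycle, so exactness provides a filling. Fillings are taken at orbit
  representatives only and translated along the orbits; freeness makes the translate independent of
  the group element used, hence the result equivariant.\<close>

lemma extend_homotopy:
  assumes h: "equivariant k h"
    and DhD: "\<And>r l''. r \<in> Y (Suc k) \<Longrightarrow> l'' \<in> Y k \<Longrightarrow>
      (\<Sum>w\<in>Y k. D r w * (\<Sum>l'\<in>Y (Suc k). h w l' * D l' l'')) = D r l''"
  shows "\<exists>h'. equivariant (Suc k) h' \<and> (\<forall>l\<in>Y (Suc k). \<forall>l'\<in>Y (Suc k).
      (\<Sum>w\<in>Y (Suc (Suc k)). h' l w * D w l') + (\<Sum>w\<in>Y k. D l w * h w l') = (if l' = l then 1 else 0))"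
proof -
  define e where "e r l' = (if l' = r then 1 else 0) - (\<Sum>w\<in>Y k. D r w * h w l')" for r l'
  have "\<exists>w. \<forall>l'\<in>Y (Suc k). e r l' = (\<Sum>l\<in>Y (Suc (Suc k)). w l * D l l')" if r: "r \<in> Y (Suc k)" for r
  proof (rule exact)
    fix l'' assume l'': "l'' \<in> Y k"
    have "(\<Sum>l\<in>Y (Suc k). e r l * D l l'') =
        (\<Sum>l\<in>Y (Suc k). (if l = r then D l l'' else 0)) -
        (\<Sum>l\<in>Y (Suc k). (\<Sum>w\<in>Y k. D r w * h w l * D l l''))"
      by (simp add: e_def left_diff_distrib sum_subtractf sum_distrib_right if_distrib[of "\<lambda>x. x * _"] cong: if_cong)
    also have "(\<Sum>l\<in>Y (Suc k). (if l = r then D l l'' else 0)) = D r l''"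
      using r finite_Y by simp
    also have "(\<Sum>l\<in>Y (Suc k). (\<Sum>w\<in>Y k. D r w * h w l * D l l'')) =
        (\<Sum>w\<in>Y k. D r w * (\<Sum>l\<in>Y (Suc k). h w l * D l l''))"
      by (subst sum.swap) (simp add: sum_distrib_left mult.assoc)
    also have "\<dots> = D r l''" by (rule DhD[OF r l''])
    finally show "(\<Sum>l\<in>Y (Suc k). e r l * D l l'') = 0" by simp
  qed
  then obtain W where W: "\<And>r l'. r \<in> Y (Suc k) \<Longrightarrow> l' \<in> Y (Suc k) \<Longrightarrow>
      e r l' = (\<Sum>l\<in>Y (Suc (Suc k)). W r l * D l l')" by metis
  obtain rep gg where rg: "\<And>l. l \<in> Y (Suc k) \<Longrightarrow> rep l \<in> Y (Suc k) \<and> gg l \<in> G \<and> act (gg l) (rep l) = l \<and>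
     (\<forall>g\<in>G. rep (act g l) = rep l)"
    using ex_representatives[of "Suc k"] by metis
  \<comment> \<open>Row \<open>l\<close> of \<open>h'\<close> is the filling
    \<open>W (rep l)\<close> moved by \<open>gg l\<close>, so its entry at \<open>l'\<close> is read
    off at the preimage of \<open>l'\<close>.\<close>
  define h' where "h' l l' = W (rep l) (inv_into (Y (Suc (Suc k))) (act (gg l)) l')" for l l'
  have h'_act: "h' l (act (gg l) w) = W (rep l) w" if "l \<in> Y (Suc k)" "w \<in> Y (Suc (Suc k))" for l w
    unfolding h'_def using bij_betw_inv_into_left[OF bij_act that(2)] rg[OF that(1)] by simp
  have ex_act: "\<exists>w\<in>Y j. l' = act g w" if "g \<in> G" "l' \<in> Y j" for g l' j
    using bij_act[OF that(1), of j] that(2) by (auto simp: bij_betw_def)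
  have equ: "equivariant (Suc k) h'"
    unfolding equivariant_def
  proof (intro ballI)
    fix g l l' assume g: "g \<in> G" and l: "l \<in> Y (Suc k)" and l': "l' \<in> Y (Suc (Suc k))"
    note gl = act_closed[OF g l]
    obtain w where w: "w \<in> Y (Suc (Suc k))" "l' = act (gg l) w" using ex_act rg[OF l] l' by blast
    obtain i where i: "i \<in> G" "\<And>j y. y \<in> Y j \<Longrightarrow> act i y = act g (act (gg l) y)"
      using mult_act[OF g, of "gg l"] rg[OF l] by metis
    \<comment> \<open>The composite of \<open>g\<close> with \<open>gg l\<close> and the choice
      \<open>gg (act g l)\<close> both carry \<open>rep l\<close> to \<open>act g l\<close>; by
      freeness they act alike on every basis element, even if they differ as elements of G.\<close>
    have "act i (rep l) = act (gg (act g l)) (rep l)"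
      using i(2)[of "rep l" "Suc k"] rg[OF l] rg[OF gl] g by metis
    then have "act i w = act (gg (act g l)) w"
      using free_act[OF i(1)] rg[OF l] rg[OF gl] w(1) by blast
    then have "act g l' = act (gg (act g l)) w" using i(2)[OF w(1)] w(2) by simp
    then show "h' (act g l) (act g l') = h' l l'"
      using h'_act[OF gl w(1)] h'_act[OF l w(1)] w(2) rg[OF l] g by simp
  qed
  have e_act: "e (act g r) (act g l') = e r l'" if g: "g \<in> G"
      and r: "r \<in> Y (Suc k)" and l': "l' \<in> Y (Suc k)" for g r l'
  proof -
    have "(\<Sum>w\<in>Y k. D (act g r) w * h w (act g l')) = (\<Sum>w\<in>Y k. D (act g r) (act g w) * h (act g w) (act g l'))"
      by (rule sum_act[OF g, symmetric])
    also have "\<dots> = (\<Sum>w\<in>Y k. D r w * h w l')"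
      using D_act[OF g r] h g l' by (intro sum.cong) (auto simp: equivariant_def)
    finally show ?thesis unfolding e_def using act_eq_iff[OF g l' r] by simp
  qed
  have "(\<Sum>w\<in>Y (Suc (Suc k)). h' l w * D w l') = e l l'" if l: "l \<in> Y (Suc k)" and l': "l' \<in> Y (Suc k)" for l l'
  proof -
    have g: "gg l \<in> G" and r: "rep l \<in> Y (Suc k)" "act (gg l) (rep l) = l" using rg[OF l] by auto
    obtain v where v: "v \<in> Y (Suc k)" "l' = act (gg l) v" using ex_act[OF g l'] by blast
    have "(\<Sum>w\<in>Y (Suc (Suc k)). h' l w * D w l') =
      (\<Sum>w\<in>Y (Suc (Suc k)). h' l (act (gg l) w) * D (act (gg l) w) (act (gg l) v))"
      unfolding v(2) by (rule sum_act[OF g, symmetric])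
    also have "\<dots> = (\<Sum>w\<in>Y (Suc (Suc k)). W (rep l) w * D w v)"
      using h'_act[OF l] D_act[OF g _ v(1)] by (intro sum.cong) auto
    also have "\<dots> = e (rep l) v" using W[OF r(1) v(1)] by simp
    also have "\<dots> = e l l'" using e_act[OF g r(1) v(1)] r(2) v(2) by simp
    finally show ?thesis .
  qed
  then show ?thesis using equ by (intro exI[of _ h']) (auto simp: e_def)
qed

text \<open>Dependent choice over the degrees: \<open>Pr\<close> is the invariant from which the
  next homotopy is built, \<open>Rl\<close> the identity it satisfies. The recursion starts for free
  since \<open>Y 0\<close> is empty, and \<open>Rl\<close> together with D D = 0 restores the
  invariant one degree higher.\<close>

lemma ex_equivariant_homotopy:
  "\<exists>h. \<forall>k. equivariant k (h k) \<and> (\<forall>l\<in>Y (Suc k). \<forall>l'\<in>Y (Suc k).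
      (\<Sum>w\<in>Y (Suc (Suc k)). h (Suc k) l w * D w l') + (\<Sum>w\<in>Y k. D l w * h k w l') = (if l' = l then 1 else 0))"
proof -
  define Pr where "Pr k h \<longleftrightarrow> equivariant k h \<and> (\<forall>r\<in>Y (Suc k). \<forall>l''\<in>Y k.
      (\<Sum>w\<in>Y k. D r w * (\<Sum>l'\<in>Y (Suc k). h w l' * D l' l'')) = D r l'')" for k h
  define Rl where "Rl k h h' \<longleftrightarrow> (\<forall>l\<in>Y (Suc k). \<forall>l'\<in>Y (Suc k).
      (\<Sum>w\<in>Y (Suc (Suc k)). h' l w * D w l') + (\<Sum>w\<in>Y k. D l w * h w l') = (if l' = l then 1 else 0))"
    for k and h h' :: "'y \<Rightarrow> 'y \<Rightarrow> 'a"
  have "\<exists>h. \<forall>k. Pr k (h k) \<and> Rl k (h k) (h (Suc k))"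
  proof (rule dependent_nat_choice)
    show "\<exists>h. Pr 0 h" by (auto simp: Pr_def Y_0 equivariant_def)
  next
    fix h k assume "Pr k h"
    then obtain h' where h': "equivariant (Suc k) h'" and rl: "Rl k h h'"
      using extend_homotopy[of k h] unfolding Pr_def Rl_def by blast
    have "(\<Sum>w\<in>Y (Suc k). D r w * (\<Sum>l'\<in>Y (Suc (Suc k)). h' w l' * D l' l'')) = D r l''"
      if r: "r \<in> Y (Suc (Suc k))" and l'': "l'' \<in> Y (Suc k)" for r l''
    proof -
      have "(\<Sum>w\<in>Y (Suc k). D r w * (\<Sum>l'\<in>Y (Suc (Suc k)). h' w l' * D l' l'')) =
        (\<Sum>w\<in>Y (Suc k). D r w * ((if l'' = w then 1 else 0) - (\<Sum>v\<in>Y k. D w v * h v l'')))"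
        using rl l'' unfolding Rl_def by (intro sum.cong refl arg_cong[where f="(*) _"]) (simp add: eq_diff_eq)
      also have "\<dots> = (\<Sum>w\<in>Y (Suc k). (if l'' = w then D r w else 0)) -
          (\<Sum>w\<in>Y (Suc k). \<Sum>v\<in>Y k. D r w * D w v * h v l'')"
        by (simp add: right_diff_distrib sum_subtractf sum_distrib_left mult.assoc if_distrib[of "\<lambda>x. _ * x"] cong: if_cong)
      also have "(\<Sum>w\<in>Y (Suc k). (if l'' = w then D r w else 0)) = D r l''"
        using l'' finite_Y by simp
      also have "(\<Sum>w\<in>Y (Suc k). \<Sum>v\<in>Y k. D r w * D w v * h v l'') =
          (\<Sum>v\<in>Y k. (\<Sum>w\<in>Y (Suc k). D r w * D w v) * h v l'')"
        by (subst sum.swap) (simp add: sum_distrib_right)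
      also have "\<dots> = 0" using D_D[OF r] by simp
      finally show ?thesis by simp
    qed
    then show "\<exists>h'. Pr (Suc k) h' \<and> Rl k h h'" using h' rl unfolding Pr_def by blast
  qed
  then show ?thesis unfolding Pr_def Rl_def by blast
qed

text \<open>The kernel of the projection to coinvariants, spanned by the differences g l - l. Only
  the values on \<open>Y k\<close> are constrained, so functions need not be cut off outside
  \<open>Y k\<close>.\<close>

definition coinvariant_rels :: "nat \<Rightarrow> ('y \<Rightarrow> 'a) set" where
  "coinvariant_rels k = {c. \<exists>f. \<forall>l'\<in>Y k. c l' =
     (\<Sum>l\<in>Y k. \<Sum>g\<in>G. f l g * ((if l' = act g l then 1 else 0) - (if l' = l then 1 else 0)))}"

text \<open>An equivariant homotopy sends differences g l - l to combinations of differences, so it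
  descends to coinvariants: in z = D(h z) + h(D z) the last summand is a relation whenever D z is
  one.\<close>

lemma exact_coinvariants:
  assumes "(\<lambda>l'. \<Sum>l\<in>Y (Suc k). z l * D l l') \<in> coinvariant_rels k"
  shows "\<exists>w. (\<lambda>l'. z l' - (\<Sum>l\<in>Y (Suc (Suc k)). w l * D l l')) \<in> coinvariant_rels (Suc k)"
proof -
  obtain h where equ: "\<And>k. equivariant k (h k)"
    and h: "\<And>k l l'. l \<in> Y (Suc k) \<Longrightarrow> l' \<in> Y (Suc k) \<Longrightarrow>
      (\<Sum>w\<in>Y (Suc (Suc k)). h (Suc k) l w * D w l') + (\<Sum>w\<in>Y k. D l w * h k w l') = (if l' = l then 1 else 0)"
    using ex_equivariant_homotopy by metis
  obtain f where f: "\<And>l'. l' \<in> Y k \<Longrightarrow> (\<Sum>l\<in>Y (Suc k). z l * D l l') =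
     (\<Sum>l\<in>Y k. \<Sum>g\<in>G. f l g * ((if l' = act g l then 1 else 0) - (if l' = l then 1 else 0)))"
    using assms unfolding coinvariant_rels_def by blast
  define w where "w v = (\<Sum>l\<in>Y (Suc k). z l * h (Suc k) l v)" for v
  define f' where "f' v g = (\<Sum>l\<in>Y k. f l g * h k l v)" for v g
  have "z l' - (\<Sum>v\<in>Y (Suc (Suc k)). w v * D v l') =
     (\<Sum>v\<in>Y (Suc k). \<Sum>g\<in>G. f' v g * ((if l' = act g v then 1 else 0) - (if l' = v then 1 else 0)))"
    if l': "l' \<in> Y (Suc k)" for l'
  proof -
    have "(\<Sum>v\<in>Y (Suc (Suc k)). w v * D v l') =
        (\<Sum>l\<in>Y (Suc k). z l * (\<Sum>v\<in>Y (Suc (Suc k)). h (Suc k) l v * D v l'))"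
      unfolding w_def sum_distrib_right sum_distrib_left by (subst sum.swap) (simp add: mult.assoc)
    also have "\<dots> = (\<Sum>l\<in>Y (Suc k). z l * ((if l' = l then 1 else 0) - (\<Sum>v\<in>Y k. D l v * h k v l')))"
      using h[OF _ l'] by (intro sum.cong refl arg_cong[where f="(*) _"]) (simp add: eq_diff_eq)
    also have "\<dots> = (\<Sum>l\<in>Y (Suc k). (if l' = l then z l else 0)) -
        (\<Sum>l\<in>Y (Suc k). \<Sum>v\<in>Y k. z l * D l v * h k v l')"
      by (simp add: right_diff_distrib sum_subtractf sum_distrib_left mult.assoc if_distrib[of "\<lambda>x. _ * x"] cong: if_cong)
    also have "(\<Sum>l\<in>Y (Suc k). (if l' = l then z l else 0)) = z l'"
      using l' finite_Y by simp
    also have "(\<Sum>l\<in>Y (Suc k). \<Sum>v\<in>Y k. z l * D l v * h k v l') =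
        (\<Sum>v\<in>Y k. (\<Sum>l\<in>Y (Suc k). z l * D l v) * h k v l')"
      by (subst sum.swap) (simp add: sum_distrib_right)
    also have "\<dots> = (\<Sum>v\<in>Y k. (\<Sum>l\<in>Y k. \<Sum>g\<in>G. f l g * ((if v = act g l then 1 else 0) - (if v = l then 1 else 0))) * h k v l')"
      using f by (intro sum.cong) auto
    also have "\<dots> = (\<Sum>v\<in>Y k. \<Sum>l\<in>Y k. \<Sum>g\<in>G. f l g * ((if v = act g l then 1 else 0) - (if v = l then 1 else 0)) * h k v l')"
      by (simp add: sum_distrib_right)
    also have "\<dots> = (\<Sum>l\<in>Y k. \<Sum>g\<in>G. \<Sum>v\<in>Y k. f l g * ((if v = act g l then 1 else 0) - (if v = l then 1 else 0)) * h k v l')"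
      by (subst sum.swap, intro sum.cong refl, subst sum.swap) (rule refl)
    also have "\<dots> = (\<Sum>l\<in>Y k. \<Sum>g\<in>G. f l g * (h k (act g l) l' - h k l l'))"
    proof (intro sum.cong refl)
      fix l g assume l: "l \<in> Y k" and g: "g \<in> G"
      have "(\<Sum>v\<in>Y k. f l g * ((if v = act g l then 1 else 0) - (if v = l then 1 else 0)) * h k v l') =
        (\<Sum>v\<in>Y k. (if v = act g l then f l g * h k v l' else 0)) -
            (\<Sum>v\<in>Y k. (if v = l then f l g * h k v l' else 0))"
        unfolding sum_subtractf[symmetric] by (intro sum.cong) (auto simp: algebra_simps)
      also have "\<dots> = f l g * (h k (act g l) l' - h k l l')"
        using l act_closed[OF g l] finite_Y by (simp add: right_diff_distrib)
      finally show "(\<Sum>v\<in>Y k. f l g * ((if v = act g l then 1 else 0) - (if v = l then 1 else 0)) * h k v l') =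
        f l g * (h k (act g l) l' - h k l l')" .
    qed
    \<comment> \<open>Equivariance in the form h(g l) - h(l) = sum over v of \<open>h k l v\<close>
      times (g v - v): the entry of row \<open>act g l\<close> at \<open>l'\<close> is that of row
      \<open>l\<close> at the preimage of \<open>l'\<close>.\<close>
    also have "\<dots> = (\<Sum>l\<in>Y k. \<Sum>g\<in>G. \<Sum>v\<in>Y (Suc k). f l g * h k l v * ((if l' = act g v then 1 else 0) - (if l' = v then 1 else 0)))"
    proof (intro sum.cong refl)
      fix l g assume l: "l \<in> Y k" and g: "g \<in> G"
      obtain v' where v': "v' \<in> Y (Suc k)" "l' = act g v'"
        using bij_act[OF g, of "Suc k"] l' by (auto simp: bij_betw_def)
      have "(\<Sum>v\<in>Y (Suc k). f l g * h k l v * ((if l' = act g v then 1 else 0) - (if l' = v then 1 else 0))) =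
        (\<Sum>v\<in>Y (Suc k). (if v = v' then f l g * h k l v else 0)) -
            (\<Sum>v\<in>Y (Suc k). (if v = l' then f l g * h k l v else 0))"
        unfolding sum_subtractf[symmetric] using act_eq_iff[OF g v'(1)] v'(2)
        by (intro sum.cong) (auto simp: algebra_simps)
      also have "\<dots> = f l g * (h k l v' - h k l l')"
        using l' v'(1) finite_Y by (simp add: right_diff_distrib)
      also have "h k l v' = h k (act g l) l'"
        using equ[of k] g l v' unfolding equivariant_def by simp
      finally show "f l g * (h k (act g l) l' - h k l l') =
          (\<Sum>v\<in>Y (Suc k). f l g * h k l v * ((if l' = act g v then 1 else 0) - (if l' = v then 1 else 0)))"
        by simp
    qed
    also have "\<dots> = (\<Sum>l\<in>Y k. \<Sum>v\<in>Y (Suc k). \<Sum>g\<in>G. f l g * h k l v * ((if l' = act g v then 1 else 0) - (if l' = v then 1 else 0)))"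
      by (intro sum.cong refl sum.swap)
    also have "\<dots> = (\<Sum>v\<in>Y (Suc k). \<Sum>l\<in>Y k. \<Sum>g\<in>G. f l g * h k l v * ((if l' = act g v then 1 else 0) - (if l' = v then 1 else 0)))"
      by (rule sum.swap)
    also have "\<dots> = (\<Sum>v\<in>Y (Suc k). \<Sum>g\<in>G. \<Sum>l\<in>Y k. f l g * h k l v * ((if l' = act g v then 1 else 0) - (if l' = v then 1 else 0)))"
      by (intro sum.cong refl sum.swap)
    finally show ?thesis unfolding f'_def by (simp add: sum_distrib_right)
  qed
  then show ?thesis unfolding coinvariant_rels_def by blast
qed

end

section \<open>Bar complexes of algebras with a multiplicative basis\<close>

lemma merge_Cons_0: "merge p 0 (a # b # l) = p a b # l"
  by (simp add: merge_def)

lemma merge_Cons_Suc: "merge p (Suc i) (a # l) = a # merge p i l"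
  by (simp add: merge_def)

lemma finite_tuples: "finite B \<Longrightarrow> finite (tuples B k)"
  unfolding tuples_def using finite_lists_length_eq[of B k] by (simp add: conj_commute)

text \<open>The bar differential as an alternating sum of weighted faces: face 0 removes the leading
  factor by the augmentation, face \<open>Suc j\<close> multiplies positions \<open>j\<close> and
  \<open>Suc j\<close>. The highest face is the action on the module factor.\<close>

definition face_coef :: "('a::comm_ring_1, 'b) malg \<Rightarrow> nat \<Rightarrow> 'b list \<Rightarrow> 'a" where
  "face_coef A i l = (case i of 0 \<Rightarrow> aug A (hd l) | Suc j \<Rightarrow> coef A (l ! j) (l ! Suc j))"

definition face :: "('a::comm_ring_1, 'b) malg \<Rightarrow> nat \<Rightarrow> 'b list \<Rightarrow> 'b list" where
  "face A i l = (case i of 0 \<Rightarrow> tl l | Suc j \<Rightarrow> merge (mul A) j l)"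

lemma bar_db_faces:
  assumes "2 \<le> length l"
  shows "bar_db A l l' = (\<Sum>i<length l. (-1) ^ i * face_coef A i l * bvec (face A i l) l')"
proof -
  obtain k where "length l = Suc k" using assms by (cases "length l") auto
  then show ?thesis using assms
    by (simp add: bar_db_def sum.lessThan_Suc_shift face_coef_def face_def del: sum.lessThan_Suc)
qed

text \<open>The usual cancellation behind d d = 0. \<open>F j i\<close> stands for face j followed
  by face i; the pair (j, i) with i < j cancels against (i, j - 1).\<close>

lemma alternating_face_sum:
  fixes F :: "nat \<Rightarrow> nat \<Rightarrow> 'a::comm_ring_1"
  assumes "\<And>i j. i < j \<Longrightarrow> j \<le> Suc n \<Longrightarrow> F j i = F i (j - 1)"
  shows "(\<Sum>j<Suc (Suc n). \<Sum>i<Suc n. (-1) ^ (j + i) * F j i) = 0"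
proof -
  let ?A = "{(j, i). j < Suc (Suc n) \<and> i < Suc n}"
  let ?f = "\<lambda>(j, i). (-1) ^ (j + i) * F j i"
  let ?S = "{(j, i). j < Suc (Suc n) \<and> i < Suc n \<and> i < j}"
  let ?T = "{(j, i). j < Suc (Suc n) \<and> i < Suc n \<and> j \<le> i}"
  have fin: "finite ?A"
    by (rule finite_subset[of _ "{..<Suc (Suc n)} \<times> {..<Suc n}"]) auto
  have fS: "finite ?S" "finite ?T" by (rule finite_subset[OF _ fin]; auto)+
  have "(\<Sum>j<Suc (Suc n). \<Sum>i<Suc n. (-1) ^ (j + i) * F j i) = sum ?f ({..<Suc (Suc n)} \<times> {..<Suc n})"
    by (simp add: sum.cartesian_product del: sum.lessThan_Suc)
  also have "{..<Suc (Suc n)} \<times> {..<Suc n} = ?S \<union> ?T" by auto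
  also have "sum ?f (?S \<union> ?T) = sum ?f ?S + sum ?f ?T"
    by (rule sum.union_disjoint[OF fS]) auto
  \<comment> \<open>The bijection sends (j, i) to (i, j - 1). It lowers the sum of the indices by
    one, which flips the sign.\<close>
  also have "sum ?f ?S = (\<Sum>x\<in>?T. - ?f x)"
  proof (rule sum.reindex_bij_witness[of _ "\<lambda>(j, i). (Suc i, j)" "\<lambda>(j, i). (i, j - 1)"])
    fix x assume "x \<in> ?S"
    then obtain j i where x: "x = (Suc j, i)" "j < Suc n" "i < Suc n" "i \<le> j"
      by (cases x; cases "fst x") auto
    then show "- ?f (case x of (j, i) \<Rightarrow> (i, j - 1)) = ?f x"
      using assms[of i "Suc j"] by (simp add: add.commute)
  qed auto
  also have "\<dots> + sum ?f ?T = 0" by (simp add: sum_negf)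
  finally show ?thesis .
qed

locale based_algebra =
  fixes A :: "('a::comm_ring_1, 'b) malg"
  assumes finite_bas: "finite (bas A)"
    and mul_closed: "a \<in> bas A \<Longrightarrow> b \<in> bas A \<Longrightarrow> mul A a b \<in> bas A"
    and mul_assoc: "a \<in> bas A \<Longrightarrow> b \<in> bas A \<Longrightarrow> c \<in> bas A \<Longrightarrow>
      mul A (mul A a b) c = mul A a (mul A b c)"
    and coef_assoc: "a \<in> bas A \<Longrightarrow> b \<in> bas A \<Longrightarrow> c \<in> bas A \<Longrightarrow>
      coef A a b * coef A (mul A a b) c = coef A b c * coef A a (mul A b c)"
    and aug_mul: "a \<in> bas A \<Longrightarrow> b \<in> bas A \<Longrightarrow> coef A a b * aug A (mul A a b) = aug A a * aug A b"
    and subb_subset: "subb A \<subseteq> bas A"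
begin

abbreviation tups :: "nat \<Rightarrow> 'b list set" where "tups \<equiv> tuples (bas A)"

lemma finite_tups [simp]: "finite (tups k)"
  by (rule finite_tuples[OF finite_bas])

lemma merge_closed:
  "Suc i < length l \<Longrightarrow> set l \<subseteq> bas A \<Longrightarrow>
    length (merge (mul A) i l) = length l - 1 \<and> set (merge (mul A) i l) \<subseteq> bas A"
proof (induction i arbitrary: l)
  case 0
  then obtain a b l2 where "l = a # b # l2" by (cases l; cases "tl l") auto
  then show ?case using 0 by (auto simp: merge_Cons_0 mul_closed)
next
  case (Suc i)
  then obtain a l2 where l: "l = a # l2" by (cases l) auto
  then show ?case using Suc.IH[of l2] Suc.prems by (auto simp: merge_Cons_Suc)
qed

lemma face_closed: "l \<in> tups (Suc (Suc k)) \<Longrightarrow> i < Suc (Suc k) \<Longrightarrow> face A i l \<in> tups (Suc k)"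
proof (cases i)
  case 0
  assume "l \<in> tups (Suc (Suc k))"
  then show ?thesis using 0 by (cases l) (auto simp: tuples_def face_def)
next
  case (Suc j)
  assume "l \<in> tups (Suc (Suc k))" "i < Suc (Suc k)"
  then show ?thesis using Suc merge_closed[of j l] by (auto simp: tuples_def face_def)
qed

text \<open>The boundary of a basis tuple paired with an arbitrary function on tuples. In this form
  the differential is composed with itself and compared with chain maps without handling
  \<open>bvec\<close>.\<close>

lemma bar_db_pairing:
  assumes "l \<in> tups (Suc (Suc k))"
  shows "(\<Sum>w\<in>tups (Suc k). bar_db A l w * \<phi> w) = (\<Sum>i<Suc (Suc k). (-1) ^ i * face_coef A i l * \<phi> (face A i l))"
proof -
  have len: "length l = Suc (Suc k)" using assms by (simp add: tuples_def)
  have "(\<Sum>w\<in>tups (Suc k). bar_db A l w * \<phi> w) =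
     (\<Sum>w\<in>tups (Suc k). \<Sum>i<Suc (Suc k). (-1) ^ i * face_coef A i l * bvec (face A i l) w * \<phi> w)"
    by (simp add: bar_db_faces len sum_distrib_right del: sum.lessThan_Suc)
  also have "\<dots> = (\<Sum>i<Suc (Suc k). \<Sum>w\<in>tups (Suc k). (-1) ^ i * face_coef A i l * bvec (face A i l) w * \<phi> w)"
    by (rule sum.swap)
  also have "\<dots> = (\<Sum>i<Suc (Suc k). \<Sum>w\<in>tups (Suc k). if w =
      face A i l then (-1) ^ i * face_coef A i l * \<phi> w else 0)"
    by (intro sum.cong refl) (auto simp: bvec_def)
  also have "\<dots> = (\<Sum>i<Suc (Suc k). (-1) ^ i * face_coef A i l * \<phi> (face A i l))"
    using face_closed[OF assms] by (intro sum.cong refl) simp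
  finally show ?thesis .
qed

text \<open>Overlapping products (i = j) are associativity, for basis elements and coefficients
  alike; products at disjoint positions commute. Induction on \<open>i\<close> strips the common
  prefix.\<close>

lemma merge_merge:
  "i \<le> j \<Longrightarrow> Suc (Suc j) < length l \<Longrightarrow> set l \<subseteq> bas A \<Longrightarrow>
    merge (mul A) i (merge (mul A) (Suc j) l) = merge (mul A) j (merge (mul A) i l) \<and>
    coef A (l ! Suc j) (l ! Suc (Suc j)) * coef A (merge (mul A) (Suc j) l ! i)
        (merge (mul A) (Suc j) l ! Suc i) =
    coef A (l ! i) (l ! Suc i) * coef A (merge (mul A) i l ! j) (merge (mul A) i l ! Suc j)"
proof (induction i arbitrary: j l)
  case 0
  then obtain a b c l2 where l: "l = a # b # c # l2"
    by (cases l; cases "tl l"; cases "tl (tl l)") auto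
  show ?case
  proof (cases j)
    case 0
    then show ?thesis using l \<open>set l \<subseteq> bas A\<close> mul_assoc coef_assoc
      by (auto simp: merge_Cons_0 merge_Cons_Suc)
  next
    case (Suc j')
    then show ?thesis using l by (auto simp: merge_Cons_0 merge_Cons_Suc mult.commute)
  qed
next
  case (Suc i)
  then obtain a l2 j' where l: "l = a # l2" "j = Suc j'" by (cases l; cases j) auto
  then show ?case using Suc.IH[of j' l2] Suc.prems by (auto simp: merge_Cons_Suc)
qed

text \<open>The pair i = 0, j = 1 rests on multiplicativity of the augmentation: multiplying two
  factors and augmenting agrees with augmenting both. The other pairs come from
  \<open>merge_merge\<close> or act on separate positions.\<close>

lemma face_face:
  assumes l: "l \<in> tups (Suc (Suc (Suc k)))" and ij: "i < j" "j < Suc (Suc (Suc k))"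
  shows "face A i (face A j l) = face A (j - 1) (face A i l)"
    and "face_coef A j l * face_coef A i (face A j l) = face_coef A i l * face_coef A (j - 1) (face A i l)"
proof -
  obtain a b c l2 where l2: "l = a # b # c # l2"
    using l by (cases l; cases "tl l"; cases "tl (tl l)") (auto simp: tuples_def)
  obtain j' where j: "j = Suc j'" using ij by (cases j) auto
  have B: "a \<in> bas A" "b \<in> bas A" "set l \<subseteq> bas A" "length l = Suc (Suc (Suc k))"
    using l l2 by (auto simp: tuples_def)
  have "face A i (face A j l) = face A (j - 1) (face A i l) \<and>
    face_coef A j l * face_coef A i (face A j l) = face_coef A i l * face_coef A (j - 1) (face A i l)"
  proof (cases i)
    case i: 0
    show ?thesis
    proof (cases j')
      case 0
      then show ?thesis using i j l2 B aug_mul[of a b]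
        by (simp add: face_def face_coef_def merge_Cons_0)
    next
      case (Suc j'')
      then show ?thesis using i j l2
        by (simp add: face_def face_coef_def merge_Cons_Suc mult.commute)
    qed
  next
    case i: (Suc i')
    obtain j'' where "j' = Suc j''" using i ij j by (cases j') auto
    then show ?thesis using i j ij B merge_merge[of i' j'' l]
      by (simp add: face_def face_coef_def)
  qed
  then show "face A i (face A j l) = face A (j - 1) (face A i l)"
    "face_coef A j l * face_coef A i (face A j l) = face_coef A i l * face_coef A (j - 1) (face A i l)" by auto
qed

lemma bar_db_bar_db:
  assumes l: "l \<in> tups (Suc (Suc k))"
  shows "(\<Sum>w\<in>tups (Suc k). bar_db A l w * bar_db A w l'') = 0"
proof (cases k)
  case 0
  have "bar_db A w l'' = 0" if "w \<in> tups (Suc k)" for w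
    using that 0 by (simp add: bar_db_def tuples_def)
  then show ?thesis by simp
next
  case (Suc k')
  have *: "bar_db A (face A j l) l'' = (\<Sum>i<Suc (Suc k'). (-1) ^ i * face_coef A i (face A j l) * bvec (face A i (face A j l)) l'')"
    if "j < Suc (Suc (Suc k'))" for j
    using face_closed[OF l, of j] that Suc by (subst bar_db_faces) (auto simp: tuples_def)
  have "(\<Sum>w\<in>tups (Suc k). bar_db A l w * bar_db A w l'') =
      (\<Sum>j<Suc (Suc (Suc k')). (-1) ^ j * face_coef A j l * bar_db A (face A j l) l'')"
    using bar_db_pairing[OF l] Suc by simp
  also have "\<dots> = (\<Sum>j<Suc (Suc (Suc k')). \<Sum>i<Suc (Suc k'). (-1) ^ (j + i) *
      (face_coef A j l * face_coef A i (face A j l) * bvec (face A i (face A j l)) l''))"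
    by (intro sum.cong refl) (simp only: * lessThan_iff sum_distrib_left power_add mult_ac)
  also have "\<dots> = 0"
  proof (rule alternating_face_sum)
    fix i j assume "i < j" "j \<le> Suc (Suc k')"
    then show "face_coef A j l * face_coef A i (face A j l) * bvec (face A i (face A j l)) l'' =
      face_coef A i l * face_coef A (j - 1) (face A i l) * bvec (face A (j - 1) (face A i l)) l''"
      using face_face[of l k' i j] l Suc by simp
  qed
  finally show ?thesis .
qed

text \<open>Tuples of length one form degree 0 and have no boundary; \<open>k = 0\<close> is listed
  separately because \<open>tups 0\<close> contains the empty tuple.\<close>

lemma bar_db_eq_0: "l \<in> tups (Suc k) \<Longrightarrow> l' \<notin> tups k \<or> k = 0 \<Longrightarrow> bar_db A l l' = 0"
proof (cases k)
  case 0
  assume "l \<in> tups (Suc k)"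
  then show ?thesis using 0 by (simp add: bar_db_def tuples_def)
next
  case (Suc k')
  assume l: "l \<in> tups (Suc k)" and l': "l' \<notin> tups k \<or> k = 0"
  then have "bvec (face A i l) l' = (0::'a)" if "i < Suc (Suc k')" for i
    using face_closed[of l k' i] that Suc by (auto simp: bvec_def)
  then show ?thesis using l Suc by (subst bar_db_faces) (auto simp: tuples_def)
qed

lemma bar_d_0 [simp]: "bar_d A 0 c = (\<lambda>_. 0)"
  unfolding bar_d_def using bar_db_eq_0[of _ 0] by simp

lemma bar_d_add: "bar_d A k (\<lambda>l. c l + c' l) = (\<lambda>l. bar_d A k c l + bar_d A k c' l)"
  by (simp add: bar_d_def distrib_right sum.distrib)

lemma bar_d_diff: "bar_d A k (\<lambda>l. c l - c' l) = (\<lambda>l. bar_d A k c l - bar_d A k c' l)"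
  by (simp add: bar_d_def left_diff_distrib sum_subtractf)

lemma bar_d_bar_d: "bar_d A k (bar_d A (Suc k) c) = (\<lambda>_. 0)"
proof
  fix l''
  have "bar_d A k (bar_d A (Suc k) c) l'' =
     (\<Sum>w\<in>tups (Suc k). \<Sum>l\<in>tups (Suc (Suc k)). c l * (bar_db A l w * bar_db A w l''))"
    unfolding bar_d_def sum_distrib_right mult.assoc ..
  also have "\<dots> = (\<Sum>l\<in>tups (Suc (Suc k)). \<Sum>w\<in>tups (Suc k). c l * (bar_db A l w * bar_db A w l''))"
    by (rule sum.swap)
  also have "\<dots> = (\<Sum>l\<in>tups (Suc (Suc k)). c l * (\<Sum>w\<in>tups (Suc k). bar_db A l w * bar_db A w l''))"
    unfolding sum_distrib_left ..
  also have "\<dots> = 0"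
    using bar_db_bar_db by (intro sum.neutral ballI) simp
  finally show "bar_d A k (bar_d A (Suc k) c) l'' = 0" .
qed

text \<open>A set V of tuples stands for the submodule of the bar complex that it spans.\<close>
definition csupp :: "'b list set \<Rightarrow> nat \<Rightarrow> ('b list \<Rightarrow> 'a) set" where
  "csupp V k = {c. \<forall>l. l \<notin> tups (Suc k) \<inter> V \<longrightarrow> c l = 0}"

definition subcomplex :: "'b list set \<Rightarrow> bool" where
  "subcomplex V \<longleftrightarrow> (\<forall>k l l'. l \<in> tups (Suc k) \<inter> V \<longrightarrow> l' \<notin> V \<longrightarrow> bar_db A l l' = 0)"

text \<open>Degree 0 is included: \<open>bar_d A 0\<close> is zero, so every 0-chain carried by V
  has to be a boundary, and no homology is left in any degree.\<close>

definition acyclic :: "'b list set \<Rightarrow> bool" where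
  "acyclic V \<longleftrightarrow> (\<forall>k. \<forall>z\<in>csupp V k. bar_d A k z = (\<lambda>_. 0) \<longrightarrow>
      (\<exists>w\<in>csupp V (Suc k). bar_d A (Suc k) w = z))"

text \<open>Faces with coefficient 0 may leave V. This is what happens when the augmentation kills a
  leading entry.\<close>

lemma subcomplexI:
  assumes "\<And>k l i. l \<in> tups (Suc (Suc k)) \<Longrightarrow> l \<in> V \<Longrightarrow> i < Suc (Suc k) \<Longrightarrow>
    face_coef A i l = 0 \<or> face A i l \<in> V"
  shows "subcomplex V"
  unfolding subcomplex_def
proof (intro allI impI)
  fix k l l' assume l: "l \<in> tups (Suc k) \<inter> V" and l': "l' \<notin> V"
  show "bar_db A l l' = 0"
  proof (cases k)
    case 0
    then show ?thesis using bar_db_eq_0 l by blast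
  next
    case (Suc k')
    then have len: "length l = Suc (Suc k')" using l by (simp add: tuples_def)
    have "face_coef A i l * bvec (face A i l) l' = 0" if "i < Suc (Suc k')" for i
      using assms[of l k' i] that Suc l l' by (auto simp: bvec_def)
    then show ?thesis
      by (subst bar_db_faces) (auto simp: len mult.assoc simp del: sum.lessThan_Suc intro!: sum.neutral)
  qed
qed

lemma subcomplex_bar_d:
  assumes "subcomplex V" "c \<in> csupp V (Suc k)"
  shows "bar_d A (Suc k) c \<in> csupp V k"
proof -
  have "c l * bar_db A l l' = 0" if l: "l \<in> tups (Suc (Suc k))" and l': "l' \<notin> tups (Suc k) \<inter> V" for l l'
  proof (cases "l \<in> V")
    case True
    then have "l' \<in> V \<or> bar_db A l l' = 0" using assms(1) l unfolding subcomplex_def by blast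
    then have "bar_db A l l' = 0" using bar_db_eq_0[OF l, of l'] l' by blast
    then show ?thesis by simp
  next
    case False
    then show ?thesis using assms(2) by (simp add: csupp_def)
  qed
  then have "bar_d A (Suc k) c l' = 0" if "l' \<notin> tups (Suc k) \<inter> V" for l'
    unfolding bar_d_def using that by (intro sum.neutral ballI) blast
  then show ?thesis unfolding csupp_def by blast
qed

lemma acyclic_empty: "acyclic {}"
  unfolding acyclic_def
proof (intro allI ballI impI)
  fix k z assume "z \<in> csupp {} k"
  then have "z = (\<lambda>_. 0)" by (simp add: csupp_def fun_eq_iff)
  moreover have "bar_d A (Suc k) (\<lambda>_. 0) = (\<lambda>_. 0)" by (simp add: bar_d_def)
  moreover have "(\<lambda>_. 0) \<in> csupp {} (Suc k)" by (simp add: csupp_def)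
  ultimately show "\<exists>w\<in>csupp {} (Suc k). bar_d A (Suc k) w = z" by metis
qed

text \<open>Mayer-Vietoris on chains. When a cycle is split into a part on V and a part on W, the
  two boundaries are opposite and hence carried by both sets; filling the common boundary in the
  intersection corrects both parts to cycles.\<close>

lemma acyclic_Un:
  assumes V: "subcomplex V" "acyclic V" and W: "subcomplex W" "acyclic W" and VW: "acyclic (V \<inter> W)"
  shows "acyclic (V \<union> W)"
  unfolding acyclic_def
proof (intro allI ballI impI)
  fix k z assume z: "z \<in> csupp (V \<union> W) k" and dz: "bar_d A k z = (\<lambda>_. 0)"
  define z1 where "z1 l = (if l \<in> V then z l else 0)" for l
  define z2 where "z2 l = z l - z1 l" for l
  have z1: "z1 \<in> csupp V k" and z2: "z2 \<in> csupp W k"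
    using z by (auto simp: csupp_def z1_def z2_def)
  have d2: "bar_d A k z2 = (\<lambda>l. - bar_d A k z1 l)"
    unfolding z2_def bar_d_diff dz by simp
  have "\<exists>w\<in>csupp (V \<inter> W) k. bar_d A k w = bar_d A k z1"
  proof (cases k)
    case 0
    then show ?thesis by (intro bexI[of _ "\<lambda>_. 0"]) (auto simp: csupp_def)
  next
    case (Suc k')
    have "bar_d A k z1 \<in> csupp V k'" using subcomplex_bar_d[OF V(1)] z1 Suc by simp
    moreover have "bar_d A k z2 \<in> csupp W k'" using subcomplex_bar_d[OF W(1)] z2 Suc by simp
    then have "bar_d A k z1 \<in> csupp W k'" unfolding d2 csupp_def by simp
    ultimately have "bar_d A k z1 \<in> csupp (V \<inter> W) k'" unfolding csupp_def by blast
    then show ?thesis using VW bar_d_bar_d[of k' z1] Suc unfolding acyclic_def by blast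
  qed
  then obtain w where w: "w \<in> csupp (V \<inter> W) k" and dw: "bar_d A k w = bar_d A k z1" by blast
  have "(\<lambda>l. z1 l - w l) \<in> csupp V k" using w z1 by (auto simp: csupp_def)
  moreover have "bar_d A k (\<lambda>l. z1 l - w l) = (\<lambda>_. 0)" by (simp add: bar_d_diff dw)
  ultimately obtain w1 where w1: "w1 \<in> csupp V (Suc k)" "bar_d A (Suc k) w1 = (\<lambda>l. z1 l - w l)"
    using V(2) unfolding acyclic_def by blast
  have "(\<lambda>l. z2 l + w l) \<in> csupp W k" using w z2 by (auto simp: csupp_def)
  moreover have "bar_d A k (\<lambda>l. z2 l + w l) = (\<lambda>_. 0)" by (simp add: bar_d_add d2 dw)
  ultimately obtain w2 where w2: "w2 \<in> csupp W (Suc k)" "bar_d A (Suc k) w2 = (\<lambda>l. z2 l + w l)"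
    using W(2) unfolding acyclic_def by blast
  have "(\<lambda>l. w1 l + w2 l) \<in> csupp (V \<union> W) (Suc k)" using w1 w2 by (auto simp: csupp_def)
  moreover have "bar_d A (Suc k) (\<lambda>l. w1 l + w2 l) = z"
    by (simp add: bar_d_add w1 w2 z2_def)
  ultimately show "\<exists>w\<in>csupp (V \<union> W) (Suc k). bar_d A (Suc k) w = z" by blast
qed

lemma subcomplex_Union: "(\<And>V. V \<in> F \<Longrightarrow> subcomplex V) \<Longrightarrow> subcomplex (\<Union>F)"
  unfolding subcomplex_def by blast

text \<open>Induction on the number of members, for all families at once: removing V and
  intersecting the others with V gives a smaller family that still lies in C, possibly smaller still
  if some intersections coincide.\<close>

lemma acyclic_Union:
  assumes C: "\<And>V. V \<in> C \<Longrightarrow> subcomplex V" "\<And>V. V \<in> C \<Longrightarrow> acyclic V"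
      "\<And>V W. V \<in> C \<Longrightarrow> W \<in> C \<Longrightarrow> V \<inter> W \<in> C"
    and "finite F" "F \<subseteq> C"
  shows "acyclic (\<Union>F)"
  using assms(4,5)
proof (induction "card F" arbitrary: F rule: less_induct)
  case less
  show ?case
  proof (cases "F = {}")
    case True
    then show ?thesis using acyclic_empty by simp
  next
    case False
    then obtain V where V: "V \<in> F" by blast
    define F' where "F' = F - {V}"
    have F: "\<Union>F = V \<union> \<Union>F'" using V by (auto simp: F'_def)
    have c: "card F' < card F" unfolding F'_def by (rule card_Diff1_less[OF less.prems(1) V])
    have F': "finite F'" "F' \<subseteq> C" using less.prems by (auto simp: F'_def)
    have "acyclic (\<Union>((\<lambda>W. V \<inter> W) ` F'))"
      using C(3)[of V] V F' less.prems c
      by (intro less.hyps) (auto intro: le_less_trans[OF card_image_le])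
    moreover have "\<Union>((\<lambda>W. V \<inter> W) ` F') = V \<inter> \<Union>F'" by auto
    ultimately show ?thesis unfolding F
      using C(1,2) V less.prems less.hyps[OF c F'] F'
      by (intro acyclic_Un subcomplex_Union) auto
  qed
qed

section \<open>Appending a factor, and the contraction it gives\<close>

lemma face_snoc:
  assumes "length l = Suc (Suc k)" "i < Suc (Suc k)"
  shows "face A i (l @ [e]) = face A i l @ [e]" "face_coef A i (l @ [e]) = face_coef A i l"
proof -
  have "face A i (l @ [e]) = face A i l @ [e] \<and> face_coef A i (l @ [e]) = face_coef A i l"
  proof (cases i)
    case 0
    obtain a l2 where "l = a # l2" using assms(1) by (cases l) auto
    then show ?thesis using 0 by (simp add: face_def face_coef_def)
  next
    case (Suc j)
    then have "Suc j < length l" using assms by simp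
    then show ?thesis by (simp add: Suc face_def face_coef_def merge_def nth_append)
  qed
  then show "face A i (l @ [e]) = face A i l @ [e]" "face_coef A i (l @ [e]) = face_coef A i l" by auto
qed

lemma face_last:
  assumes "l \<noteq> []"
  shows "face A (length l) (l @ [e]) = butlast l @ [mul A (last l) e]"
    "face_coef A (length l) (l @ [e]) = coef A (last l) e"
proof -
  obtain b x where l: "l = b @ [x]" using assms by (cases l rule: rev_cases) auto
  show "face A (length l) (l @ [e]) = butlast l @ [mul A (last l) e]"
    "face_coef A (length l) (l @ [e]) = coef A (last l) e"
    by (simp_all add: l face_def face_coef_def merge_def nth_append)
qed

text \<open>All faces but the last leave \<open>e\<close> alone. The middle term concerns length one
  only: \<open>bar_db\<close> vanishes on a one-element tuple, whereas in the longer tuple that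
  entry can be augmented away.\<close>

lemma bar_db_snoc:
  assumes "l \<noteq> []"
  shows "bar_db A (l @ [e]) l' =
    (if l' \<noteq> [] \<and> last l' = e then bar_db A l (butlast l') else 0)
    + (if length l = 1 then aug A (hd l) * bvec [e] l' else 0)
    + (-1) ^ length l * coef A (last l) e * bvec (butlast l @ [mul A (last l) e]) l'"
proof -
  have *: "bar_db A (l @ [e]) l' = (\<Sum>i<length l. (-1) ^ i * face_coef A i (l @ [e]) * bvec (face A i (l @ [e])) l')
    + (-1) ^ length l * coef A (last l) e * bvec (butlast l @ [mul A (last l) e]) l'"
    using assms face_last[OF assms] by (subst bar_db_faces) (auto simp: Suc_le_eq)
  show ?thesis
  proof (cases "length l = 1")
    case True
    then obtain x where "l = [x]" by (auto simp: length_Suc_conv)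
    then show ?thesis unfolding * by (auto simp: face_coef_def face_def bar_db_def)
  next
    case False
    then obtain k where k: "length l = Suc (Suc k)"
      using assms by (cases l; cases "tl l") auto
    have "bvec (face A i l @ [e]) l' = (if l' \<noteq> [] \<and> last l' =
        e then bvec (face A i l) (butlast l') else (0::'a))" for i
      by (cases l' rule: rev_cases) (auto simp: bvec_def)
    then have "(\<Sum>i<length l. (-1) ^ i * face_coef A i (l @ [e]) * bvec (face A i (l @ [e])) l') =
      (if l' \<noteq> [] \<and> last l' = e then bar_db A l (butlast l') else 0)"
      using face_snoc[OF k] k by (simp add: bar_db_faces del: sum.lessThan_Suc)
    then show ?thesis unfolding * using k by simp
  qed
qed

text \<open>If \<open>e\<close> acts from the right on all final entries as the unit
  \<open>c\<close>, appending \<open>e\<close> and rescaling is a contracting homotopy: the boundary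
  of z (x) e is (d z) (x) e plus a sign times c z. The condition on one-element tuples removes the
  extra term in degree 0.\<close>

lemma contraction:
  assumes e: "e \<in> bas A" and c: "c * u = 1"
    and V: "\<And>l. l \<in> V \<Longrightarrow> l \<noteq> [] \<Longrightarrow> set l \<subseteq> bas A \<Longrightarrow>
      l @ [e] \<in> V \<and> mul A (last l) e = last l \<and> coef A (last l) e = c"
    and aug: "\<And>x. [x] \<in> V \<Longrightarrow> x \<in> bas A \<Longrightarrow> aug A x = 0"
  shows "acyclic V"
  unfolding acyclic_def
proof (intro allI ballI impI)
  fix k z assume z: "z \<in> csupp V k" and dz: "bar_d A k z = (\<lambda>_. 0)"
  \<comment> \<open>Inverse of the factor contributed by the last face: the sign belongs to tuples
    of length \<open>Suc k\<close>, and \<open>u\<close> is inverse to \<open>c\<close>.\<close>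
  define s where "s = (-1) ^ Suc k * u"
  have "(-1) ^ Suc k * (-1) ^ Suc k = (1::'a)"
    by (simp only: power_mult_distrib[symmetric]) simp
  then have s: "(-1) ^ Suc k * c * s = 1"
    unfolding s_def using c
    by (simp only: mult.assoc mult.left_commute[of c]) (simp only: mult.assoc[symmetric] mult_1_left)
  define w where "w l = (if l \<noteq> [] \<and> last l = e then s * z (butlast l) else 0)" for l
  have z0: "z l = 0" if "l \<notin> tups (Suc k) \<inter> V" for l using z that by (auto simp: csupp_def)
  have "w \<in> csupp V (Suc k)"
    unfolding csupp_def
  proof (intro CollectI allI impI)
    fix l assume l: "l \<notin> tups (Suc (Suc k)) \<inter> V"
    show "w l = 0"
    proof (rule ccontr)
      assume "w l \<noteq> 0"
      then have *: "l \<noteq> []" "last l = e" "z (butlast l) \<noteq> 0" by (auto simp: w_def split: if_splits)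
      then have "butlast l \<in> tups (Suc k) \<inter> V" using z0 by blast
      moreover have "l = butlast l @ [e]" using *(1,2) append_butlast_last_id by metis
      moreover have "b @ [e] \<in> tups (Suc (Suc k)) \<inter> V" if "b \<in> tups (Suc k) \<inter> V" for b
        using V[of b] that e by (cases b) (auto simp: tuples_def)
      ultimately show False using l by metis
    qed
  qed
  moreover have "bar_d A (Suc k) w = z"
  proof
    fix l'
    have inj: "inj_on (\<lambda>l. l @ [e]) (tups (Suc k))" by (auto simp: inj_on_def)
    have "bar_d A (Suc k) w l' = (\<Sum>l\<in>(\<lambda>l. l @ [e]) ` tups (Suc k). w l * bar_db A l l')"
      unfolding bar_d_def
    proof (rule sum.mono_neutral_right)
      show "(\<lambda>l. l @ [e]) ` tups (Suc k) \<subseteq> tups (Suc (Suc k))" using e by (auto simp: tuples_def)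
      show "\<forall>i\<in>tups (Suc (Suc k)) - (\<lambda>l. l @ [e]) ` tups (Suc k). w i * bar_db A i l' = 0"
      proof
        fix i assume i: "i \<in> tups (Suc (Suc k)) - (\<lambda>l. l @ [e]) ` tups (Suc k)"
        have "z (butlast i) = 0" if "i \<noteq> []" "last i = e"
        proof -
          have "butlast i \<notin> tups (Suc k)" using i that by (metis DiffD2 append_butlast_last_id imageI)
          then show ?thesis using z0 by blast
        qed
        then show "w i * bar_db A i l' = 0" by (auto simp: w_def)
      qed
    qed simp
    also have "\<dots> = (\<Sum>l\<in>tups (Suc k). s * (z l * bar_db A (l @ [e]) l'))"
      by (subst sum.reindex[OF inj]) (simp add: w_def mult_ac)
    also have "\<dots> = s * (\<Sum>l\<in>tups (Suc k). z l * bar_db A (l @ [e]) l')"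
      by (simp add: sum_distrib_left)
    also have "(\<Sum>l\<in>tups (Suc k). z l * bar_db A (l @ [e]) l') =
       (\<Sum>l\<in>tups (Suc k). (if l' \<noteq> [] \<and> last l' = e then z l * bar_db A l (butlast l') else 0)
         + (if l = l' then (-1) ^ Suc k * c * z l' else 0))"
    proof (intro sum.cong refl)
      fix l assume l: "l \<in> tups (Suc k)"
      then have ne: "l \<noteq> []" and len: "length l = Suc k" by (auto simp: tuples_def)
      show "z l * bar_db A (l @ [e]) l' = (if l' \<noteq> [] \<and> last l' = e then z l * bar_db A l (butlast l') else 0)
         + (if l = l' then (-1) ^ Suc k * c * z l' else 0)"
      proof (cases "l \<in> V")
        case False
        then show ?thesis using z0 by auto
      next
        case True
        have "aug A (hd l) = 0" if l1: "length l = 1"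
        proof -
          obtain x where "l = [x]" using l1 by (cases l) auto
          then show ?thesis using aug[of x] True l by (auto simp: tuples_def)
        qed
        moreover have "mul A (last l) e = last l" "coef A (last l) e = c"
          using V[OF True ne] l by (auto simp: tuples_def)
        ultimately have "bar_db A (l @ [e]) l' = (if l' \<noteq> [] \<and> last l' = e then bar_db A l (butlast l') else 0)
            + (-1) ^ Suc k * c * (if l = l' then 1 else 0)"
          unfolding bar_db_snoc[OF ne] len using ne by (simp add: bvec_def)
        then show ?thesis
          by (cases "l = l'") (simp_all add: distrib_left mult.commute del: power_Suc)
      qed
    qed
    also have "\<dots> = (if l' \<noteq> [] \<and> last l' = e then bar_d A k z (butlast l') else 0) +
        (-1) ^ Suc k * c * z l'"
      using z0[of l'] by (auto simp: sum.distrib bar_d_def)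
    also have "\<dots> = (-1) ^ Suc k * c * z l'" using dz by simp
    also have "s * \<dots> = (-1) ^ Suc k * c * s * z l'" by (simp only: mult_ac)
    also have "\<dots> = z l'" by (simp only: s mult_1_left)
    finally show "bar_d A (Suc k) w l' = z l'" .
  qed
  ultimately show "\<exists>w\<in>csupp V (Suc k). bar_d A (Suc k) w = z" by blast
qed

lemma tups_ne: "l \<in> tups (Suc k) \<Longrightarrow> l \<noteq> []" by (auto simp: tuples_def)

lemma last_face:
  assumes l: "l \<in> tups (Suc (Suc k))" and i: "i < Suc (Suc k)"
  shows "last (face A i l) = last l \<or> (\<exists>a\<in>bas A. last (face A i l) = mul A a (last l))"
proof -
  obtain b x where bx: "l = b @ [x]" using tups_ne[OF l] by (cases l rule: rev_cases) auto
  have b: "length b = Suc k" "set b \<subseteq> bas A" using l by (auto simp: bx tuples_def)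
  have ne: "b \<noteq> []" using b by auto
  then have bl: "last b \<in> bas A" using b by auto
  show ?thesis
  proof (cases "i = Suc k")
    case True
    then show ?thesis using face_last(1)[OF ne, of x] b(1) bl by (auto simp: bx)
  next
    case False
    show ?thesis
    proof (cases k)
      case 0
      then obtain a where "b = [a]" using b(1) by (auto simp: length_Suc_conv)
      moreover have "i = 0" using i False 0 by simp
      ultimately show ?thesis unfolding bx by (simp add: face_def)
    next
      case (Suc k')
      then show ?thesis unfolding bx using face_snoc(1)[of b k' i x] b(1) i False by simp
    qed
  qed
qed

text \<open>A face changes the final entry at most by a left multiplication. So a set of basis
  elements stable under left multiplication yields the bar complex with coefficients in the left
  ideal that it spans.\<close>

lemma subcomplex_last:
  assumes "\<And>a x. a \<in> bas A \<Longrightarrow> x \<in> U \<Longrightarrow> mul A a x \<in> U"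
  shows "subcomplex {l. l \<noteq> [] \<and> last l \<in> U}"
proof (rule subcomplexI)
  fix k l i assume l: "l \<in> tups (Suc (Suc k))" "l \<in> {l. l \<noteq> [] \<and> last l \<in> U}" and i: "i < Suc (Suc k)"
  have "last (face A i l) \<in> U" using last_face[OF l(1) i] l(2) assms by auto
  then show "face_coef A i l = 0 \<or> face A i l \<in> {l. l \<noteq> [] \<and> last l \<in> U}"
    using tups_ne[OF face_closed[OF l(1) i]] by simp
qed

end

section \<open>Spans of relations, and functoriality of the bar complex\<close>

lemma rspan_add: "c \<in> rspan G \<Longrightarrow> c' \<in> rspan G \<Longrightarrow> (\<lambda>l. c l + c' l) \<in> rspan G"
  unfolding rspan_def
proof (clarify)
  fix f f' show "\<exists>f''. (\<lambda>l. (\<Sum>g\<in>G. f g * g l) + (\<Sum>g\<in>G. f' g * g l)) = (\<lambda>l. \<Sum>g\<in>G. f'' g * g l)"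
    by (rule exI[of _ "\<lambda>g. f g + f' g"]) (simp add: distrib_right sum.distrib)
qed

lemma rspan_scale: "c \<in> rspan G \<Longrightarrow> (\<lambda>l. a * c l) \<in> rspan G"
  unfolding rspan_def
proof (clarify)
  fix f show "\<exists>f''. (\<lambda>l. a * (\<Sum>g\<in>G. f g * g l)) = (\<lambda>l. \<Sum>g\<in>G. f'' g * g l)"
    by (rule exI[of _ "\<lambda>g. a * f g"]) (simp add: mult.assoc sum_distrib_left)
qed

lemma rspan_diff: "c \<in> rspan G \<Longrightarrow> c' \<in> rspan G \<Longrightarrow> (\<lambda>l. c l - c' l) \<in> rspan G"
  using rspan_add[OF _ rspan_scale[of c' G "-1"]] by fastforce

lemma rspan_0: "(\<lambda>_. 0) \<in> rspan G"
  unfolding rspan_def by (auto intro: exI[of _ "\<lambda>_. 0"])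

lemma rspan_base: "finite G \<Longrightarrow> g \<in> G \<Longrightarrow> g \<in> rspan G"
  unfolding rspan_def
  by (auto intro!: exI[of _ "\<lambda>h. if h = g then 1 else 0"] ext simp: if_distrib[of "\<lambda>x. x * _"] cong: if_cong)

lemma rspan_sum: "(\<And>i. i \<in> I \<Longrightarrow> c i \<in> rspan G) \<Longrightarrow> (\<lambda>l. \<Sum>i\<in>I. c i l) \<in> rspan G"
  by (induction I rule: infinite_finite_induct) (auto simp: rspan_0 intro: rspan_add)

lemma rspan_image:
  assumes "c \<in> rspan G"
    and "\<And>f. L (\<lambda>l. \<Sum>g\<in>G. f g * g l) = (\<lambda>l'. \<Sum>g\<in>G. f g * L g l')"
    and "\<And>g. g \<in> G \<Longrightarrow> L g \<in> rspan G'"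
  shows "L c \<in> rspan G'"
proof -
  obtain f where "c = (\<lambda>l. \<Sum>g\<in>G. f g * g l)" using assms(1) unfolding rspan_def by blast
  then have "L c = (\<lambda>l'. \<Sum>g\<in>G. f g * L g l')" using assms(2) by simp
  then show ?thesis using assms(3) by (simp add: rspan_sum rspan_scale)
qed

text \<open>A sum over an infinite set is 0 by convention, so \<open>rspan\<close> is the intended
  span only for a finite set of generators; this lemma makes \<open>rspan_base\<close> applicable to
  the relations.\<close>

lemma finite_rel_gens:
  assumes "finite (bas A)" "finite (subb A)"
  shows "finite (rel_gens A k)"
proof -
  have "rel_gens A k \<subseteq> (\<lambda>(as, x, e) l'. coef A x e * bvec (as @ [mul A x e]) l' - aug A e * bvec (as @ [x]) l')
      ` (tuples (bas A) k \<times> bas A \<times> subb A)"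
    unfolding rel_gens_def by (auto simp: image_iff) blast
  then show ?thesis by (rule finite_subset) (simp add: assms finite_tuples)
qed

text \<open>An algebra map sending each basis element to a basis element or to zero:
  \<open>a\<close> goes to \<open>f a\<close> if \<open>P a\<close>, otherwise to 0. By
  \<open>P_mul\<close> the elements sent to 0 span an ideal, and no product of the others falls into
  it. Inclusion and projection are both of this kind, so naturality is proved once.\<close>

locale based_algebra_map = S: based_algebra A + T: based_algebra A'
  for A :: "('a::comm_ring_1, 'b) malg" and A' :: "('a, 'c) malg" +
  fixes P :: "'b \<Rightarrow> bool" and f :: "'b \<Rightarrow> 'c"
  assumes map_closed: "a \<in> bas A \<Longrightarrow> P a \<Longrightarrow> f a \<in> bas A'"
    and P_mul: "a \<in> bas A \<Longrightarrow> b \<in> bas A \<Longrightarrow> P (mul A a b) \<longleftrightarrow> P a \<and> P b"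
    and map_mul: "a \<in> bas A \<Longrightarrow> b \<in> bas A \<Longrightarrow> P a \<Longrightarrow> P b \<Longrightarrow> f (mul A a b) = mul A' (f a) (f b)"
    and map_coef: "a \<in> bas A \<Longrightarrow> b \<in> bas A \<Longrightarrow> P a \<Longrightarrow> P b \<Longrightarrow> coef A a b = coef A' (f a) (f b)"
    and map_aug: "a \<in> bas A \<Longrightarrow> aug A a = (if P a then aug A' (f a) else 0)"
    and map_subb: "e \<in> subb A \<Longrightarrow> P e \<Longrightarrow> f e \<in> subb A'"
begin

abbreviation chm :: "nat \<Rightarrow> ('b list \<Rightarrow> 'a) \<Rightarrow> 'c list \<Rightarrow> 'a" where "chm \<equiv> chmap A P f"

definition kern :: "'b list \<Rightarrow> 'c list \<Rightarrow> 'a" where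
  "kern l l' = (if list_all P l then bvec (map f l) l' else 0)"

lemma chm_kern: "chm k c l' = (\<Sum>l\<in>S.tups (Suc k). c l * kern l l')"
proof -
  have "chm k c l' = (\<Sum>l\<in>S.tups (Suc k). if list_all P l \<and> map f l = l' then c l else 0)"
    unfolding chmap_def by (subst sum.inter_filter[symmetric]) simp_all
  also have "\<dots> = (\<Sum>l\<in>S.tups (Suc k). c l * kern l l')"
    by (intro sum.cong) (auto simp: kern_def bvec_def)
  finally show ?thesis .
qed

lemma map_tups: "l \<in> S.tups k \<Longrightarrow> list_all P l \<Longrightarrow> map f l \<in> T.tups k"
  using map_closed by (auto simp: tuples_def list_all_iff)

lemma map_merge:
  "Suc i < length l \<Longrightarrow> set l \<subseteq> bas A \<Longrightarrow>
    (list_all P (merge (mul A) i l) \<longleftrightarrow> list_all P l) \<and>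
    (list_all P l \<longrightarrow> map f (merge (mul A) i l) = merge (mul A') i (map f l))"
proof (induction i arbitrary: l)
  case 0
  then obtain a b l2 where "l = a # b # l2" by (cases l; cases "tl l") auto
  then show ?case using 0 P_mul[of a b] map_mul[of a b] by (auto simp: merge_Cons_0)
next
  case (Suc i)
  then obtain a l2 where l: "l = a # l2" by (cases l) auto
  then show ?case using Suc.IH[of l2] Suc.prems by (auto simp: merge_Cons_Suc)
qed

text \<open>Removing the leading entry could turn a tuple sent to 0 into one that is not; but then
  that entry fails \<open>P\<close>, and \<open>map_aug\<close> makes the coefficient vanish. For
  the other faces \<open>P_mul\<close> is an equivalence, so this cannot happen.\<close>

lemma kern_face:
  assumes l: "l \<in> S.tups (Suc (Suc k))" and i: "i < Suc (Suc k)"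
  shows "face_coef A i l * kern (face A i l) l' =
    (if list_all P l then face_coef A' i (map f l) * bvec (face A' i (map f l)) l' else 0)"
proof (cases i)
  case 0
  obtain a l2 where "l = a # l2" using l by (cases l) (auto simp: tuples_def)
  then show ?thesis using 0 l map_aug[of a] by (auto simp: face_coef_def face_def kern_def tuples_def)
next
  case (Suc j)
  have *: "Suc j < length l" "set l \<subseteq> bas A" using l i Suc by (auto simp: tuples_def)
  then have "l ! j \<in> bas A" "l ! Suc j \<in> bas A" using nth_mem[of j l] nth_mem[of "Suc j" l] by auto
  then show ?thesis using Suc map_merge[OF *] * map_coef[of "l ! j" "l ! Suc j"]
    by (auto simp: face_coef_def face_def kern_def list_all_length)
qed

lemma chm_bar_d: "bar_d A' (Suc k) (chm (Suc k) z) = chm k (bar_d A (Suc k) z)"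
proof
  fix l'
  have "bar_d A' (Suc k) (chm (Suc k) z) l' =
     (\<Sum>l\<in>S.tups (Suc (Suc k)). z l * (\<Sum>w\<in>T.tups (Suc (Suc k)). kern l w * bar_db A' w l'))"
    by (simp add: bar_d_def chm_kern sum_distrib_right sum_distrib_left mult.assoc sum.swap[of _ "T.tups _"])
  also have "\<dots> = (\<Sum>l\<in>S.tups (Suc (Suc k)). z l * (\<Sum>w\<in>S.tups (Suc k). bar_db A l w * kern w l'))"
  proof (intro sum.cong refl arg_cong[where f="(*) _"])
    fix l assume l: "l \<in> S.tups (Suc (Suc k))"
    have "(\<Sum>w\<in>S.tups (Suc k). bar_db A l w * kern w l') =
      (\<Sum>i<Suc (Suc k). (-1) ^ i * (face_coef A i l * kern (face A i l) l'))"
      by (simp add: S.bar_db_pairing[OF l] mult.assoc del: sum.lessThan_Suc)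
    also have "\<dots> = (if list_all P l then bar_db A' (map f l) l' else 0)"
      using l by (simp add: kern_face[OF l] bar_db_faces tuples_def mult.assoc del: sum.lessThan_Suc)
    also have "\<dots> = (\<Sum>w\<in>T.tups (Suc (Suc k)). if w =
        map f l then (if list_all P l then bar_db A' w l' else 0) else 0)"
      using map_tups[OF l] by auto
    also have "\<dots> = (\<Sum>w\<in>T.tups (Suc (Suc k)). kern l w * bar_db A' w l')"
      by (intro sum.cong) (auto simp: kern_def bvec_def)
    finally show "(\<Sum>w\<in>T.tups (Suc (Suc k)). kern l w * bar_db A' w l') =
        (\<Sum>w\<in>S.tups (Suc k). bar_db A l w * kern w l')" ..
  qed
  also have "\<dots> = chm k (bar_d A (Suc k) z) l'"
    by (simp add: bar_d_def chm_kern sum_distrib_right sum_distrib_left mult.assoc sum.swap[of _ "S.tups (Suc k)"])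
  finally show "bar_d A' (Suc k) (chm (Suc k) z) l' = chm k (bar_d A (Suc k) z) l'" .
qed

lemma chm_chains: "chm k z \<in> chains A' k"
  using map_tups by (auto simp: chains_def chm_kern kern_def bvec_def intro!: sum.neutral)

lemma chm_add: "chm k (\<lambda>l. c l + c' l) = (\<lambda>l. chm k c l + chm k c' l)"
  by (simp add: chm_kern fun_eq_iff distrib_right sum.distrib)

lemma chm_bvec: "l \<in> S.tups (Suc k) \<Longrightarrow> chm k (\<lambda>l'. a * bvec l l') l'' = a * kern l l''"
proof -
  assume l: "l \<in> S.tups (Suc k)"
  have "chm k (\<lambda>l'. a * bvec l l') l'' = (\<Sum>l'\<in>S.tups (Suc k). if l' = l then a * kern l' l'' else 0)"
    unfolding chm_kern by (intro sum.cong) (auto simp: bvec_def)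
  then show ?thesis using l by simp
qed

lemma chm_pairing:
  "(\<Sum>w\<in>T.tups (Suc k). chm k c w * \<phi> w) = (\<Sum>l\<in>S.tups (Suc k). c l * (if list_all P l then \<phi> (map f l) else 0))"
proof -
  have kern_pairing: "(\<Sum>w\<in>T.tups (Suc k). kern l w * \<phi> w) = (if list_all P l then \<phi> (map f l) else 0)"
    if l: "l \<in> S.tups (Suc k)" for l
  proof -
    have "(\<Sum>w\<in>T.tups (Suc k). kern l w * \<phi> w) =
        (\<Sum>w\<in>T.tups (Suc k). if w = map f l then (if list_all P l then \<phi> w else 0) else 0)"
      by (intro sum.cong) (auto simp: kern_def bvec_def)
    also have "\<dots> = (if list_all P l then \<phi> (map f l) else 0)" using map_tups[OF l] by simp
    finally show ?thesis .
  qed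
  have "(\<Sum>w\<in>T.tups (Suc k). chm k c w * \<phi> w) = (\<Sum>w\<in>T.tups (Suc k). \<Sum>l\<in>S.tups (Suc k). c l * (kern l w * \<phi> w))"
    unfolding chm_kern sum_distrib_right mult.assoc ..
  also have "\<dots> = (\<Sum>l\<in>S.tups (Suc k). \<Sum>w\<in>T.tups (Suc k). c l * (kern l w * \<phi> w))"
    by (rule sum.swap)
  also have "\<dots> = (\<Sum>l\<in>S.tups (Suc k). c l * (if list_all P l then \<phi> (map f l) else 0))"
    unfolding sum_distrib_left[symmetric] by (intro sum.cong refl) (simp only: kern_pairing)
  finally show ?thesis .
qed

lemma finite_subb_target: "finite (subb A')"
  using T.subb_subset T.finite_bas finite_subset by blast

text \<open>If every entry satisfies \<open>P\<close>, the image is again a generating relation.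
  Otherwise both terms die: either each tuple has an entry sent to 0, or \<open>e\<close> fails
  \<open>P\<close>, so that its augmentation is 0 and the product is sent to 0.\<close>

lemma chm_rel_gens:
  assumes "g \<in> rel_gens A k"
  shows "chm k g \<in> rspan (rel_gens A' k)"
proof -
  obtain as x e where g: "g = (\<lambda>l'. coef A x e * bvec (as @ [mul A x e]) l' - aug A e * bvec (as @ [x]) l')"
    and as: "as \<in> S.tups k" and x: "x \<in> bas A" and e: "e \<in> subb A"
    using assms unfolding rel_gens_def by blast
  have eb: "e \<in> bas A" using e S.subb_subset by blast
  have t: "as @ [mul A x e] \<in> S.tups (Suc k)" "as @ [x] \<in> S.tups (Suc k)"
    using as x eb S.mul_closed by (auto simp: tuples_def)
  have diff: "chm k (\<lambda>l. c l - c' l) l' = chm k c l' - chm k c' l'" for c c' l'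
    by (simp add: chm_kern left_diff_distrib sum_subtractf)
  have chg: "chm k g = (\<lambda>l'. coef A x e * kern (as @ [mul A x e]) l' - aug A e * kern (as @ [x]) l')"
    unfolding g by (simp add: fun_eq_iff diff chm_bvec t)
  show ?thesis
  proof (cases "list_all P as \<and> P x \<and> P e")
    case True
    have "chm k g = (\<lambda>l'. coef A' (f x) (f e) * bvec (map f as @ [mul A' (f x) (f e)]) l'
        - aug A' (f e) * bvec (map f as @ [f x]) l')"
      unfolding chg using True x eb by (simp add: kern_def P_mul map_mul map_coef map_aug)
    moreover have "\<dots> \<in> rel_gens A' k"
      unfolding rel_gens_def using True as x e eb map_tups map_closed map_subb by blast
    ultimately show ?thesis
      using rspan_base finite_rel_gens T.finite_bas finite_subb_target by metis
  next
    case False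
    then have "chm k g = (\<lambda>_. 0)" unfolding chg using x eb by (auto simp: kern_def P_mul map_aug)
    then show ?thesis by (simp add: rspan_0)
  qed
qed

lemma chm_relsub: "c \<in> relsub A k \<Longrightarrow> chm k c \<in> relsub A' k"
  unfolding relsub_def
proof (rule rspan_image[where L="chm k" and G="rel_gens A k"])
  show "chm k (\<lambda>l. \<Sum>g\<in>rel_gens A k. r g * g l) = (\<lambda>l'. \<Sum>g\<in>rel_gens A k. r g * chm k g l')" for r
    by (rule ext) (simp add: chm_kern sum_distrib_right sum_distrib_left mult.assoc sum.swap[of _ "S.tups _"])
qed (auto intro: chm_rel_gens)

lemma chm_cycles: "z \<in> cycles A k \<Longrightarrow> chm k z \<in> cycles A' k"
proof (cases k)
  case 0
  then show ?thesis unfolding cycles_def using chm_chains by (simp add: relsub_def rspan_0)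
next
  case (Suc k')
  assume "z \<in> cycles A k"
  then show ?thesis unfolding cycles_def Suc using chm_chains chm_relsub by (auto simp: chm_bar_d)
qed

lemma chm_boundaries:
  assumes "z \<in> boundaries A k"
  shows "chm k z \<in> boundaries A' k"
proof -
  obtain w s where w: "w \<in> chains A (Suc k)" "s \<in> relsub A k" and z: "z = (\<lambda>l. bar_d A (Suc k) w l + s l)"
    using assms unfolding boundaries_def by blast
  have "chm k z = (\<lambda>l. bar_d A' (Suc k) (chm (Suc k) w) l + chm k s l)"
    unfolding z chm_add chm_bar_d ..
  then show ?thesis unfolding boundaries_def using chm_chains chm_relsub[OF w(2)] by blast
qed

end

section \<open>Cycles outside the image of a retract\<close>

text \<open>What the homological argument uses of the partition algebra, with \<open>P\<close> for
  permutation diagrams and \<open>J\<close> for the basis of the left ideal. By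
  \<open>J_left\<close>, \<open>subb_J\<close> and \<open>J_factor\<close>, \<open>J\<close>
  consists of left multiples of the elements of \<open>subb A\<close> outside \<open>P\<close>, so
  the relations kill it; \<open>free\<close> excludes stabilisers outside \<open>J\<close>;
  \<open>acyclic_J\<close> is where the condition on delta and m enters.\<close>

locale augmented_algebra = based_algebra A
  for A :: "('a::comm_ring_1, 'b) malg" +
  fixes P :: "'b \<Rightarrow> bool" and J :: "'b set" and one :: 'b
  assumes aug: "a \<in> bas A \<Longrightarrow> aug A a = (if P a then 1 else 0)"
    and P_mult: "a \<in> bas A \<Longrightarrow> b \<in> bas A \<Longrightarrow> P (mul A a b) \<longleftrightarrow> P a \<and> P b"
    and one_subb: "one \<in> subb A" and P_one: "P one"
    and mul_one: "a \<in> bas A \<Longrightarrow> mul A a one = a"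
    and coef_P: "a \<in> bas A \<Longrightarrow> b \<in> bas A \<Longrightarrow> P b \<Longrightarrow> coef A a b = 1"
    and subb_mult: "g \<in> subb A \<Longrightarrow> h \<in> subb A \<Longrightarrow> P g \<Longrightarrow> P h \<Longrightarrow> mul A g h \<in> subb A"
    and subb_inv: "g \<in> subb A \<Longrightarrow> P g \<Longrightarrow> \<exists>h\<in>subb A. P h \<and> mul A g h = one"
    and J_bas: "J \<subseteq> bas A" and J_P: "x \<in> J \<Longrightarrow> \<not> P x"
    and J_left: "a \<in> bas A \<Longrightarrow> x \<in> J \<Longrightarrow> mul A a x \<in> J"
    and J_right: "x \<in> J \<Longrightarrow> g \<in> subb A \<Longrightarrow> P g \<Longrightarrow> mul A x g \<in> J"
    and subb_J: "e \<in> subb A \<Longrightarrow> \<not> P e \<Longrightarrow> e \<in> J"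
    and J_factor: "x \<in> J \<Longrightarrow> \<exists>y\<in>bas A. \<exists>e\<in>subb A. \<not> P e \<and> mul A y e = x \<and> coef A y e = 1"
    and free: "x \<in> bas A \<Longrightarrow> x \<notin> J \<Longrightarrow> g \<in> subb A \<Longrightarrow> h \<in> subb A \<Longrightarrow> P g \<Longrightarrow> P h \<Longrightarrow>
      mul A x g = mul A x h \<Longrightarrow> g = h"
    and acyclic_J: "acyclic {l. l \<noteq> [] \<and> last l \<in> J}"
begin

abbreviation VJ :: "'b list set" where "VJ \<equiv> {l. l \<noteq> [] \<and> last l \<in> J}"
abbreviation VN :: "'b list set" where "VN \<equiv> {l. \<not> list_all P l}"

definition Gp :: "'b set" where "Gp = {g \<in> subb A. P g}"

text \<open>Right translation of the module factor. Acting by \<open>g\<close> and afterwards by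
  \<open>h\<close> is acting by the product g h; the abstract locale only asks that some element
  represent each composite, so this reversed order is harmless.\<close>

definition ract :: "'b \<Rightarrow> 'b list \<Rightarrow> 'b list" where
  "ract g l = butlast l @ [mul A (last l) g]"

text \<open>A basis of the tuples with an entry outside \<open>P\<close>, modulo those ending in
  \<open>J\<close>. The index is the length, so degree k is \<open>Yb (Suc k)\<close>;
  \<open>Yb 0\<close> is empty because the empty tuple passes \<open>list_all\<close>.\<close>

definition Yb :: "nat \<Rightarrow> 'b list set" where
  "Yb k = {l \<in> tups k. \<not> list_all P l \<and> last l \<notin> J}"

lemma Gp_bas: "g \<in> Gp \<Longrightarrow> g \<in> bas A" using subb_subset by (auto simp: Gp_def)

lemma one_bas: "one \<in> bas A" using one_subb subb_subset by blast

text \<open>Only a right unit and right inverses are assumed; the left inverse comes from the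
  classical argument with an inverse of the inverse.\<close>

lemma Gp_inv:
  assumes g: "g \<in> Gp"
  shows "\<exists>h\<in>Gp. mul A g h = one \<and> mul A h g = one"
proof -
  obtain h where h: "h \<in> Gp" "mul A g h = one" using subb_inv g unfolding Gp_def by blast
  obtain k where k: "k \<in> Gp" "mul A h k = one" using subb_inv h unfolding Gp_def by blast
  note b = Gp_bas[OF g] Gp_bas[OF h(1)] Gp_bas[OF k(1)]
  have "mul A (mul A h g) one = mul A h (mul A g (mul A h k))"
    using mul_assoc[OF b(2,1) one_bas] k by simp
  also have "\<dots> = mul A h (mul A one k)"
    using mul_assoc[OF b(1,2,3)] h by simp
  also have "\<dots> = mul A (mul A h one) k"
    using mul_assoc[OF b(2) one_bas b(3)] by simp
  also have "\<dots> = one" using mul_one[OF b(2)] k by simp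
  finally have "mul A h g = one" using mul_one[OF mul_closed[OF b(2,1)]] by simp
  then show ?thesis using h by blast
qed

lemma list_all_butlast_last: "l \<noteq> [] \<Longrightarrow> list_all P l \<longleftrightarrow> list_all P (butlast l) \<and> P (last l)"
  by (cases l rule: rev_cases) auto

lemma tups_last: "l \<in> tups (Suc k) \<Longrightarrow> last l \<in> bas A"
  using last_in_set[OF tups_ne[of l k]] by (auto simp: tuples_def)

lemma ract_tups:
  assumes g: "g \<in> Gp" and l: "l \<in> tups (Suc k)"
  shows "ract g l \<in> tups (Suc k)"
proof -
  have "set (butlast l) \<subseteq> bas A" "length l = Suc k"
    using l by (auto simp: tuples_def dest: in_set_butlastD)
  moreover have "mul A (last l) g \<in> bas A" by (rule mul_closed[OF tups_last[OF l] Gp_bas[OF g]])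
  ultimately show ?thesis by (simp add: tuples_def ract_def)
qed

lemma ract_P:
  assumes g: "g \<in> Gp" and l: "l \<in> tups (Suc k)"
  shows "list_all P (ract g l) \<longleftrightarrow> list_all P l"
proof -
  have "P g" using g by (simp add: Gp_def)
  then show ?thesis
    unfolding list_all_butlast_last[OF tups_ne[OF l]] ract_def list_all_append
    using P_mult[OF tups_last[OF l] Gp_bas[OF g]] by simp
qed

lemma ract_ract:
  assumes "g \<in> Gp" "h \<in> Gp" "l \<in> tups (Suc k)"
  shows "ract h (ract g l) = ract (mul A g h) l"
  using mul_assoc[OF tups_last[OF assms(3)] Gp_bas[OF assms(1)] Gp_bas[OF assms(2)]] by (simp add: ract_def)

lemma ract_one: "l \<in> tups (Suc k) \<Longrightarrow> ract one l = l"
  using mul_one[OF tups_last[of l k]] tups_ne[of l k] by (simp add: ract_def)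

lemma Gp_mult:
  assumes g: "g \<in> Gp" and h: "h \<in> Gp"
  shows "mul A g h \<in> Gp"
proof -
  have "mul A g h \<in> subb A" using g h by (intro subb_mult) (simp_all add: Gp_def)
  then show ?thesis using P_mult[OF Gp_bas[OF g] Gp_bas[OF h]] g h by (simp add: Gp_def)
qed

lemma one_Gp: "one \<in> Gp" using one_subb P_one by (simp add: Gp_def)

lemma ract_J: "g \<in> Gp \<Longrightarrow> l \<in> tups (Suc k) \<Longrightarrow> last (ract g l) \<in> J \<longleftrightarrow> last l \<in> J"
proof
  assume g: "g \<in> Gp" and l: "l \<in> tups (Suc k)"
  show "last l \<in> J \<Longrightarrow> last (ract g l) \<in> J" using J_right[of "last l" g] g by (simp add: ract_def Gp_def)
  assume j: "last (ract g l) \<in> J"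
  obtain h where h: "h \<in> Gp" "mul A g h = one" using Gp_inv[OF g] by blast
  have "last (ract h (ract g l)) \<in> J" using J_right[OF j, of h] h(1) by (simp add: ract_def Gp_def)
  then show "last l \<in> J" using ract_ract[OF g h(1) l] ract_one[OF l] h(2) by simp
qed

lemma Yb_0: "Yb 0 = {}" by (auto simp: Yb_def tuples_def)

lemma ract_Yb: "g \<in> Gp \<Longrightarrow> l \<in> Yb k \<Longrightarrow> ract g l \<in> Yb k"
proof (cases k)
  case (Suc k')
  assume "g \<in> Gp" "l \<in> Yb k"
  then show ?thesis using ract_tups[of g l k'] ract_P[of g l k'] ract_J[of g l k'] Suc by (simp add: Yb_def)
qed (simp add: Yb_0)

lemma ract_inj:
  assumes "g \<in> Gp" "l \<in> tups (Suc k)" "l' \<in> tups (Suc k)" "ract g l = ract g l'"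
  shows "l = l'"
proof -
  obtain h where h: "h \<in> Gp" "mul A g h = one" using Gp_inv[OF assms(1)] by blast
  have "ract h (ract g l) = ract h (ract g l')" using assms(4) by simp
  then show ?thesis
    using ract_ract[OF assms(1) h(1)] ract_one assms(2,3) h(2) by simp
qed

text \<open>Associativity of the coefficients with \<open>g\<close> as last factor, where
  \<open>coef_P\<close> makes two of the four coefficients equal to 1. For diagrams: translating by
  a permutation closes no loops.\<close>

lemma coef_ract: "a \<in> bas A \<Longrightarrow> b \<in> bas A \<Longrightarrow> g \<in> Gp \<Longrightarrow> coef A a (mul A b g) = coef A a b"
  using coef_assoc[of a b g] coef_P[of "mul A a b" g] coef_P[of b g] mul_closed[of a b] Gp_bas[of g]
  by (simp add: Gp_def)

lemma face_ract:
  assumes g: "g \<in> Gp" and l: "l \<in> tups (Suc (Suc k))" and i: "i < Suc (Suc k)"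
  shows "face A i (ract g l) = ract g (face A i l)" "face_coef A i (ract g l) = face_coef A i l"
proof -
  obtain b x where bx: "l = b @ [x]" using tups_ne[OF l] by (cases l rule: rev_cases) auto
  have b: "length b = Suc k" "set b \<subseteq> bas A" and x: "x \<in> bas A" using l by (auto simp: bx tuples_def)
  have ne: "b \<noteq> []" using b by auto
  have bl: "last b \<in> bas A" using ne b(2) by auto
  have r: "ract g l = b @ [mul A x g]" by (simp add: bx ract_def)
  have "face A i (ract g l) = ract g (face A i l) \<and> face_coef A i (ract g l) = face_coef A i l"
  proof (cases "i = Suc k")
    case True
    then show ?thesis
      using face_last[OF ne] mul_assoc[OF bl x Gp_bas[OF g]] coef_ract[OF bl x g] b(1)
      unfolding r bx by (simp add: ract_def)
  next
    case False
    show ?thesis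
    proof (cases k)
      case 0
      then obtain a where "b = [a]" using b(1) by (auto simp: length_Suc_conv)
      moreover have "i = 0" using i False 0 by simp
      ultimately show ?thesis unfolding r bx by (simp add: face_def face_coef_def ract_def)
    next
      case (Suc k')
      have i': "i < Suc (Suc k')" using i False Suc by simp
      have b': "length b = Suc (Suc k')" using b Suc by simp
      show ?thesis unfolding r unfolding bx face_snoc[OF b' i'] by (simp add: ract_def)
    qed
  qed
  then show "face A i (ract g l) = ract g (face A i l)" "face_coef A i (ract g l) = face_coef A i l" by auto
qed

lemma bar_db_ract:
  assumes g: "g \<in> Gp" and l: "l \<in> tups (Suc (Suc k))" and l': "l' \<in> tups (Suc k)"
  shows "bar_db A (ract g l) (ract g l') = bar_db A l l'"
proof -
  have len: "length l = Suc (Suc k)" "length (ract g l) = Suc (Suc k)"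
    using l ract_tups[OF g l] by (auto simp: tuples_def)
  have bv: "bvec (ract g w) (ract g l') = (bvec w l' :: 'a)" if "w \<in> tups (Suc k)" for w
    using ract_inj[OF g l' that] by (auto simp: bvec_def)
  have "bar_db A (ract g l) (ract g l') =
      (\<Sum>i<Suc (Suc k). (-1) ^ i * face_coef A i (ract g l) * bvec (face A i (ract g l)) (ract g l'))"
    using len by (simp add: bar_db_faces del: sum.lessThan_Suc)
  also have "\<dots> = (\<Sum>i<Suc (Suc k). (-1) ^ i * face_coef A i l * bvec (face A i l) l')"
    using face_ract[OF g l] bv[OF face_closed[OF l]] by (intro sum.cong refl) simp
  also have "\<dots> = bar_db A l l'"
    using len by (simp add: bar_db_faces del: sum.lessThan_Suc)
  finally show ?thesis .
qed

section \<open>Tuples with an entry outside \<open>P\<close>, modulo those ending in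
  \<open>J\<close>\<close>

lemma VJ_subset_VN: "VJ \<subseteq> VN"
proof clarify
  fix l assume "l \<noteq> []" "last l \<in> J" "list_all P l"
  then show False using list_all_butlast_last[of l] J_P[of "last l"] by simp
qed

lemma subcomplex_VJ: "subcomplex VJ"
  by (rule subcomplex_last[OF J_left])

lemma merge_P: "Suc i < length l \<Longrightarrow> set l \<subseteq> bas A \<Longrightarrow> list_all P (merge (mul A) i l) \<longleftrightarrow> list_all P l"
proof (induction i arbitrary: l)
  case 0
  then obtain a b l2 where "l = a # b # l2" by (cases l; cases "tl l") auto
  then show ?case using 0 P_mult[of a b] by (auto simp: merge_Cons_0)
next
  case (Suc i)
  then obtain a l2 where l: "l = a # l2" by (cases l) auto
  then show ?case using Suc.IH[of l2] Suc.prems by (auto simp: merge_Cons_Suc)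
qed

text \<open>A product satisfies \<open>P\<close> only if both factors do, so multiplying neighbours
  keeps an offending entry. Removing the leading entry can lose the only one, but then its
  augmentation is 0.\<close>

lemma subcomplex_VN: "subcomplex VN"
proof (rule subcomplexI)
  fix k l i assume l: "l \<in> tups (Suc (Suc k))" "l \<in> VN" and i: "i < Suc (Suc k)"
  show "face_coef A i l = 0 \<or> face A i l \<in> VN"
  proof (cases i)
    case 0
    obtain a l2 where "l = a # l2" using tups_ne[OF l(1)] by (cases l) auto
    then show ?thesis using 0 l aug[of a] by (auto simp: face_def face_coef_def tuples_def)
  next
    case (Suc j)
    then show ?thesis using merge_P[of j l] l i by (auto simp: face_def tuples_def)
  qed
qed

text \<open>The final entry ranges over all of A here, so appending the unit contracts; a
  one-element tuple of this kind has augmentation 0.\<close>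

lemma acyclic_VN: "acyclic VN"
proof (rule contraction[where e = one and c = 1 and u = 1])
  fix l assume l: "l \<in> VN" "l \<noteq> []" "set l \<subseteq> bas A"
  have "last l \<in> bas A" using l(2,3) last_in_set by blast
  with l show "l @ [one] \<in> VN \<and> mul A (last l) one = last l \<and> coef A (last l) one = 1"
    using mul_one[of "last l"] coef_P[OF _ one_bas P_one, of "last l"] by auto
next
  show "aug A x = 0" if "[x] \<in> VN" "x \<in> bas A" for x using that aug by simp
qed (simp_all add: one_bas)

lemma sum_Yb:
  assumes "\<And>l. l \<in> tups k \<Longrightarrow> list_all P l \<Longrightarrow> f l = 0" "\<And>l. l \<in> tups k \<Longrightarrow> l \<in> VJ \<Longrightarrow> f l = 0"
  shows "(\<Sum>l\<in>tups k. f l) = (\<Sum>l\<in>Yb k. f l)"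
proof (rule sum.mono_neutral_right)
  show "\<forall>i\<in>tups k - Yb k. f i = 0"
  proof
    fix i assume i: "i \<in> tups k - Yb k"
    then have "list_all P i \<or> i \<in> VJ" by (auto simp: Yb_def)
    then show "f i = 0" using assms i by blast
  qed
qed (auto simp: Yb_def)

lemma Yb_iff: "l \<in> Yb k \<longleftrightarrow> l \<in> tups k \<and> l \<in> VN \<and> l \<notin> VJ"
  by (cases "l = []") (auto simp: Yb_def)

lemma bar_db_VJ: "l \<in> tups (Suc k) \<Longrightarrow> l \<in> VJ \<Longrightarrow> l' \<notin> VJ \<Longrightarrow> bar_db A l l' = 0"
  using subcomplex_VJ unfolding subcomplex_def by blast

lemma bar_db_VN: "l \<in> tups (Suc k) \<Longrightarrow> l \<in> VN \<Longrightarrow> list_all P l' \<Longrightarrow> bar_db A l l' = 0"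
  using subcomplex_VN unfolding subcomplex_def by blast

text \<open>The quotient of an acyclic complex by an acyclic subcomplex is acyclic: a cycle of the
  quotient is lifted, its boundary lies in the subcomplex and is filled there, and the corrected
  lift is an honest cycle, hence a boundary.\<close>

lemma exact_Yb:
  assumes cyc: "\<And>l'. l' \<in> Yb k \<Longrightarrow> (\<Sum>l\<in>Yb (Suc k). z l * bar_db A l l') = 0"
  shows "\<exists>w. \<forall>l'\<in>Yb (Suc k). z l' = (\<Sum>l\<in>Yb (Suc (Suc k)). w l * bar_db A l l')"
proof -
  define z0 where "z0 l = (if l \<in> Yb (Suc k) then z l else 0)" for l
  have z0: "z0 \<in> csupp VN k" by (auto simp: csupp_def z0_def Yb_iff)
  have d0: "bar_d A k z0 l' = (\<Sum>l\<in>Yb (Suc k). z l * bar_db A l l')" for l'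
  proof -
    have "(\<Sum>l\<in>tups (Suc k). z0 l * bar_db A l l') = (\<Sum>l\<in>Yb (Suc k). z0 l * bar_db A l l')"
      by (rule sum_Yb) (auto simp: z0_def Yb_iff)
    then show ?thesis by (simp add: bar_d_def z0_def)
  qed
  have "\<exists>w\<in>csupp VJ k. bar_d A k w = bar_d A k z0"
  proof (cases k)
    case 0
    then show ?thesis by (intro bexI[of _ "\<lambda>_. 0"]) (auto simp: csupp_def)
  next
    case (Suc k')
    have N: "bar_d A k z0 \<in> csupp VN k'" using subcomplex_bar_d[OF subcomplex_VN] z0 Suc by simp
    have "bar_d A k z0 l' = 0" if l': "l' \<notin> tups (Suc k') \<inter> VJ" for l'
    proof (cases "l' \<in> Yb k")
      case True
      then show ?thesis using d0 cyc by simp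
    next
      case False
      then have "l' \<notin> tups (Suc k') \<inter> VN" using l' Suc by (auto simp: Yb_iff)
      then show ?thesis using N unfolding csupp_def by blast
    qed
    then have "bar_d A k z0 \<in> csupp VJ k'" unfolding csupp_def by blast
    then show ?thesis using acyclic_J bar_d_bar_d[of k' z0] Suc unfolding acyclic_def by blast
  qed
  then obtain w where w: "w \<in> csupp VJ k" "bar_d A k w = bar_d A k z0" by blast
  have "(\<lambda>l. z0 l - w l) \<in> csupp VN k"
    unfolding csupp_def
  proof (intro CollectI allI impI)
    fix l assume l: "l \<notin> tups (Suc k) \<inter> VN"
    then have "l \<notin> tups (Suc k) \<inter> VJ" using VJ_subset_VN by blast
    then have "w l = 0" using w(1) unfolding csupp_def by blast
    moreover have "z0 l = 0" using z0 l unfolding csupp_def by blast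
    ultimately show "z0 l - w l = 0" by simp
  qed
  moreover have "bar_d A k (\<lambda>l. z0 l - w l) = (\<lambda>_. 0)" by (simp add: bar_d_diff w(2))
  ultimately obtain v where v: "v \<in> csupp VN (Suc k)" "bar_d A (Suc k) v = (\<lambda>l. z0 l - w l)"
    using acyclic_VN unfolding acyclic_def by blast
  have "z l' = (\<Sum>l\<in>Yb (Suc (Suc k)). v l * bar_db A l l')" if l': "l' \<in> Yb (Suc k)" for l'
  proof -
    have "l' \<notin> VJ" using l' by (simp add: Yb_iff)
    then have "w l' = 0" using w(1) unfolding csupp_def by blast
    then have "z l' = bar_d A (Suc k) v l'" using v(2) l' by (simp add: z0_def)
    also have "\<dots> = (\<Sum>l\<in>Yb (Suc (Suc k)). v l * bar_db A l l')"
      unfolding bar_d_def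
    proof (rule sum_Yb)
      show "v l * bar_db A l l' = 0" if "list_all P l" for l
        using v(1) that by (simp add: csupp_def)
      show "v l * bar_db A l l' = 0" if "l \<in> tups (Suc (Suc k))" "l \<in> VJ" for l
        using bar_db_VJ[OF that \<open>l' \<notin> VJ\<close>] by simp
    qed
    finally show ?thesis .
  qed
  then show ?thesis by blast
qed

lemma Yb_tups: "l \<in> Yb k \<Longrightarrow> \<exists>j. k = Suc j \<and> l \<in> tups (Suc j)"
  using Yb_0 by (cases k) (auto simp: Yb_def)

lemma ract_ract_Yb: "g \<in> Gp \<Longrightarrow> h \<in> Gp \<Longrightarrow> l \<in> Yb k \<Longrightarrow> ract h (ract g l) = ract (mul A g h) l"
  using Yb_tups[of l k] ract_ract[of g h l] by blast

lemma ract_one_Yb: "l \<in> Yb k \<Longrightarrow> ract one l = l"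
  using Yb_tups[of l k] ract_one[of l] by blast

text \<open>Passing from \<open>tups\<close> to \<open>Yb\<close> drops two kinds of terms: tuples
  with all entries in \<open>P\<close> are not reached from the others, and tuples ending in
  \<open>J\<close> lead only to tuples ending in \<open>J\<close>. Freeness is visible at the last
  entry, where \<open>free\<close> applies.\<close>

sublocale free_equivariant_complex Yb "bar_db A" Gp ract
proof
  show "Yb 0 = {}" by (rule Yb_0)
  show "finite (Yb k)" for k using finite_tups[of k] by (simp add: Yb_def)
  show "finite Gp" by (rule finite_subset[OF _ finite_bas]) (auto dest: Gp_bas)
  show "(\<Sum>w\<in>Yb (Suc k). bar_db A l w * bar_db A w l'') = 0"
    if l: "l \<in> Yb (Suc (Suc k))" and l'': "l'' \<in> Yb k" for l l'' k
  proof -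
    have "(\<Sum>w\<in>tups (Suc k). bar_db A l w * bar_db A w l'') = (\<Sum>w\<in>Yb (Suc k). bar_db A l w * bar_db A w l'')"
    proof (rule sum_Yb)
      show "bar_db A l w * bar_db A w l'' = 0" if "list_all P w" for w
        using bar_db_VN[of l "Suc k" w] l that by (simp add: Yb_iff)
      show "bar_db A l w * bar_db A w l'' = 0" if "w \<in> tups (Suc k)" "w \<in> VJ" for w
        using bar_db_VJ[OF that, of l''] l'' by (simp add: Yb_iff)
    qed
    then show ?thesis using bar_db_bar_db[of l k l''] l by (simp add: Yb_iff)
  qed
  show "\<exists>w. \<forall>l'\<in>Yb (Suc k). z l' = (\<Sum>l\<in>Yb (Suc (Suc k)). w l * bar_db A l l')"
    if "\<And>l'. l' \<in> Yb k \<Longrightarrow> (\<Sum>l\<in>Yb (Suc k). z l * bar_db A l l') = 0" for k z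
    using exact_Yb[OF that] .
  show "bij_betw (ract g) (Yb k) (Yb k)" if g: "g \<in> Gp" for g k
  proof -
    obtain h where h: "h \<in> Gp" "mul A g h = one" "mul A h g = one" using Gp_inv[OF g] by blast
    have "ract h (ract g l) = l" "ract g (ract h l) = l" if "l \<in> Yb k" for l
      using ract_ract_Yb[OF g h(1) that] ract_ract_Yb[OF h(1) g that] ract_one_Yb[OF that] h(2,3) by simp_all
    then show ?thesis
      using ract_Yb[OF g] ract_Yb[OF h(1)] by (intro bij_betw_byWitness[where f' = "ract h"]) auto
  qed
  show "\<exists>g\<in>Gp. \<forall>k. \<forall>l\<in>Yb k. ract g l = l"
    using ract_one_Yb one_Gp by blast
  show "\<exists>i\<in>Gp. \<forall>k. \<forall>l\<in>Yb k. ract i l = ract g (ract h l)" if gh: "g \<in> Gp" "h \<in> Gp" for g h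
    using ract_ract_Yb[OF gh(2,1)] by (intro bexI[OF _ Gp_mult[OF gh(2,1)]] allI ballI) simp
  show "\<exists>h\<in>Gp. \<forall>k. \<forall>l\<in>Yb k. ract h (ract g l) = l" if g: "g \<in> Gp" for g
  proof -
    obtain h where h: "h \<in> Gp" "mul A g h = one" using Gp_inv[OF g] by blast
    show ?thesis
      using ract_ract_Yb[OF g h(1)] ract_one_Yb h(2) by (intro bexI[OF _ h(1)] allI ballI) simp
  qed
  show "ract g l' = ract h l'" if gh: "g \<in> Gp" "h \<in> Gp" and l: "l \<in> Yb k" and eq: "ract g l = ract h l"
      for g h l k l' k'
  proof -
    obtain j where "l \<in> tups (Suc j)" using Yb_tups[OF l] by blast
    then have "last l \<in> bas A" "last l \<notin> J" using l tups_last by (auto simp: Yb_def)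
    moreover have "mul A (last l) g = mul A (last l) h" using eq by (simp add: ract_def)
    ultimately have "g = h" using free[of "last l" g h] gh by (simp add: Gp_def)
    then show ?thesis by simp
  qed
  show "bar_db A (ract g l) (ract g l') = bar_db A l l'" if g: "g \<in> Gp"
      and l: "l \<in> Yb (Suc k)" and l': "l' \<in> Yb k" for g l l' k
  proof -
    obtain j where j: "k = Suc j" "l' \<in> tups (Suc j)" using Yb_tups[OF l'] by blast
    moreover have "l \<in> tups (Suc (Suc j))" using l j(1) by (simp add: Yb_def)
    ultimately show ?thesis using bar_db_ract[OF g] by blast
  qed
qed

section \<open>Relations of the tensor product compared with coinvariants\<close>

lemma finite_gens: "finite (rel_gens A k)"
  by (rule finite_rel_gens[OF finite_bas finite_subset[OF subb_subset finite_bas]])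

lemma relsub_gen:
  assumes "as \<in> tups k" "x \<in> bas A" "e \<in> subb A"
  shows "(\<lambda>l'. coef A x e * bvec (as @ [mul A x e]) l' - aug A e * bvec (as @ [x]) l') \<in> relsub A k"
  unfolding relsub_def using assms by (intro rspan_base[OF finite_gens]) (auto simp: rel_gens_def)

lemma relsub_ract:
  assumes l: "l \<in> tups (Suc k)" and g: "g \<in> Gp"
  shows "(\<lambda>l'. bvec (ract g l) l' - bvec l l') \<in> relsub A k"
proof -
  have "butlast l \<in> tups k" using l by (auto simp: tuples_def dest: in_set_butlastD)
  then show ?thesis
    using relsub_gen[of "butlast l" k "last l" g] tups_last[OF l] tups_ne[OF l] g coef_P[of "last l" g]
        aug[of g] Gp_bas[OF g]
    by (simp add: ract_def Gp_def)
qed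

text \<open>\<open>J_factor\<close> writes the last entry as y e with coefficient 1 and
  \<open>e\<close> outside \<open>P\<close>. In the relation for y and e the second term carries the
  augmentation of \<open>e\<close>, which is 0.\<close>

lemma relsub_J:
  assumes l: "l \<in> tups (Suc k)" "l \<in> VJ"
  shows "bvec l \<in> relsub A k"
proof -
  have b: "butlast l \<in> tups k" using l by (auto simp: tuples_def dest: in_set_butlastD)
  obtain y e where ye: "y \<in> bas A" "e \<in> subb A" "\<not> P e" "mul A y e = last l" "coef A y e = 1"
    using J_factor l(2) by blast
  have "aug A e = 0" using aug ye subb_subset by auto
  then show ?thesis using relsub_gen[OF b ye(1,2)] ye l(2) by simp
qed

lemma csupp_VJ_relsub: "c \<in> csupp VJ k \<Longrightarrow> c \<in> relsub A k"
proof -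
  assume c: "c \<in> csupp VJ k"
  have "c = (\<lambda>l'. \<Sum>l\<in>tups (Suc k). c l * bvec l l')"
  proof
    fix l'
    have "(\<Sum>l\<in>tups (Suc k). c l * bvec l l') = (\<Sum>l\<in>tups (Suc k). if l = l' then c l' else 0)"
      by (intro sum.cong) (auto simp: bvec_def)
    also have "\<dots> = c l'" using c by (auto simp: csupp_def)
    finally show "c l' = (\<Sum>l\<in>tups (Suc k). c l * bvec l l')" ..
  qed
  moreover have "(\<lambda>l'. c l * bvec l l') \<in> relsub A k" if l: "l \<in> tups (Suc k)" for l
  proof (cases "l \<in> VJ")
    case True
    then show ?thesis using relsub_J[OF l] rspan_scale unfolding relsub_def by blast
  next
    case False
    then have "c l = 0" using c unfolding csupp_def by blast
    then show ?thesis by (simp add: relsub_def rspan_0)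
  qed
  then have "(\<lambda>l'. \<Sum>l\<in>tups (Suc k). c l * bvec l l') \<in> relsub A k"
    unfolding relsub_def by (rule rspan_sum)
  ultimately show ?thesis by simp
qed

text \<open>On \<open>Yb\<close> a relation with \<open>e\<close> in the group is the difference
  between a translate and its source, and a relation with any other \<open>e\<close> is invisible:
  the augmentation is 0 and the product ends in \<open>J\<close>. The lemmas
  \<open>relsub_ract\<close> and \<open>relsub_J\<close> are the converse.\<close>

lemma relsub_coinvariant:
  assumes "c \<in> relsub A k"
  shows "c \<in> coinvariant_rels (Suc k)"
proof -
  define Q where "Q g f \<longleftrightarrow> (\<forall>l'\<in>Yb (Suc k). g l' =
     (\<Sum>l\<in>Yb (Suc k). \<Sum>h\<in>Gp. f l h * ((if l' = ract h l then 1 else 0) - (if l' = l then 1 else 0))))"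
    for g :: "'b list \<Rightarrow> 'a" and f
  have gen: "\<exists>f. Q g f"
    if g: "g \<in> rel_gens A k" for g
  proof -
    obtain as x e where gd: "g = (\<lambda>l'. coef A x e * bvec (as @ [mul A x e]) l' - aug A e * bvec (as @ [x]) l')"
      and as: "as \<in> tups k" and x: "x \<in> bas A" and e: "e \<in> subb A"
      using g unfolding rel_gens_def by blast
    have eb: "e \<in> bas A" using e subb_subset by blast
    let ?l = "as @ [x]"
    have lt: "?l \<in> tups (Suc k)" using as x by (auto simp: tuples_def)
    show ?thesis
    proof (cases "P e \<and> ?l \<in> Yb (Suc k)")
      case True
      then have eG: "e \<in> Gp" using e by (simp add: Gp_def)
      \<comment> \<open>All weight sits at the tuple \<open>as @ [x]\<close> and the group element
        \<open>e\<close>.\<close>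
      define f where "f l h = (if l = ?l then if h = e then 1 else 0 else (0::'a))" for l h
      have "g l' = (\<Sum>l\<in>Yb (Suc k). \<Sum>h\<in>Gp. f l h * ((if l' = ract h l then 1 else 0) - (if l' = l then 1 else 0)))"
        for l'
      proof -
        have "(\<Sum>l\<in>Yb (Suc k). \<Sum>h\<in>Gp. f l h * ((if l' = ract h l then 1 else 0) - (if l' = l then 1 else 0)))
          = (\<Sum>l\<in>Yb (Suc k). if l = ?l then (\<Sum>h\<in>Gp. if h = e then ((if l' = ract h l then 1 else 0) - (if l' = l then 1 else 0)) else 0) else 0)"
          by (intro sum.cong refl) (auto simp: f_def intro!: sum.cong)
        also have "\<dots> = (if l' = ract e ?l then 1 else 0) - (if l' = ?l then 1 else 0)"
          using True eG finite_G finite_Y by simp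
        also have "\<dots> = g l'"
          unfolding gd using True coef_P[OF x eb] aug[OF eb] by (simp add: bvec_def ract_def)
        finally show ?thesis ..
      qed
      then show ?thesis unfolding Q_def by (intro exI[of _ f] ballI)
    next
      case False
      \<comment> \<open>The group preserves the complement of \<open>Yb\<close>, so for
        \<open>e\<close> in the group both tuples of the generator lie outside; otherwise only the
        product term survives, and it ends in \<open>J\<close>.\<close>
      have "g l' = 0" if l': "l' \<in> Yb (Suc k)" for l'
      proof (cases "P e")
        case True
        then have eG: "e \<in> Gp" using e by (simp add: Gp_def)
        have "?l \<notin> Yb (Suc k)" using False True by blast
        moreover then have "ract e ?l \<notin> Yb (Suc k)"
          using ract_P[OF eG lt] ract_J[OF eG lt] lt by (simp add: Yb_def)
        moreover have "ract e ?l = as @ [mul A x e]" by (simp add: ract_def)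
        ultimately have "as @ [mul A x e] \<noteq> l'" "?l \<noteq> l'" using l' by auto
        then show ?thesis unfolding gd by (simp add: bvec_def)
      next
        case False
        then have "mul A x e \<in> J" using subb_J[OF e] J_left[OF x] by blast
        then have "as @ [mul A x e] \<noteq> l'" using l' by (auto simp: Yb_def)
        then show ?thesis unfolding gd using aug[OF eb] False by (simp add: bvec_def)
      qed
      then show ?thesis unfolding Q_def by (intro exI[of _ "\<lambda>_ _. 0"]) simp
    qed
  qed
  have "\<forall>g\<in>rel_gens A k. \<exists>f. Q g f" using gen by (rule ballI)
  then have "\<exists>F. \<forall>g\<in>rel_gens A k. Q g (F g)" by (rule bchoice)
  then obtain F where F: "\<forall>g\<in>rel_gens A k. Q g (F g)" by (elim exE)
  obtain r where c: "c = (\<lambda>l. \<Sum>g\<in>rel_gens A k. r g * g l)"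
    using assms unfolding relsub_def rspan_def by blast
  define f where "f l h = (\<Sum>g\<in>rel_gens A k. r g * F g l h)" for l h
  have "c l' = (\<Sum>l\<in>Yb (Suc k). \<Sum>h\<in>Gp. f l h * ((if l' = ract h l then 1 else 0) - (if l' = l then 1 else 0)))"
    if l': "l' \<in> Yb (Suc k)" for l'
  proof -
    define t where "t l h = (if l' = ract h l then 1 else 0) - (if l' = l then 1 else (0::'a))" for l h
    have "c l' = (\<Sum>g\<in>rel_gens A k. r g * (\<Sum>l\<in>Yb (Suc k). \<Sum>h\<in>Gp. F g l h * t l h))"
      unfolding c t_def
    proof (intro sum.cong refl arg_cong[where f = "(*) _"])
      fix g assume "g \<in> rel_gens A k"
      then have "Q g (F g)" using F by (rule bspec[rotated])
      then show "g l' = (\<Sum>l\<in>Yb (Suc k). \<Sum>h\<in>Gp. F g l h * ((if l' = ract h l then 1 else 0) - (if l' = l then 1 else 0)))"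
        unfolding Q_def using l' by (rule bspec)
    qed
    also have "\<dots> = (\<Sum>g\<in>rel_gens A k. \<Sum>l\<in>Yb (Suc k). \<Sum>h\<in>Gp. r g * F g l h * t l h)"
      by (simp only: sum_distrib_left mult.assoc)
    also have "\<dots> = (\<Sum>l\<in>Yb (Suc k). \<Sum>g\<in>rel_gens A k. \<Sum>h\<in>Gp. r g * F g l h * t l h)"
      by (rule sum.swap)
    also have "\<dots> = (\<Sum>l\<in>Yb (Suc k). \<Sum>h\<in>Gp. \<Sum>g\<in>rel_gens A k. r g * F g l h * t l h)"
      by (intro sum.cong refl sum.swap)
    also have "\<dots> = (\<Sum>l\<in>Yb (Suc k). \<Sum>h\<in>Gp. f l h * t l h)"
      by (simp only: f_def sum_distrib_right)
    finally show ?thesis unfolding t_def .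
  qed
  then show ?thesis unfolding coinvariant_rels_def by blast
qed

text \<open>\<open>z\<close> is filled in the coinvariants of the quotient by \<open>J\<close>,
  where exactness is available. Lifting the filling back leaves two errors, one made of differences
  of translates and one carried by tuples ending in \<open>J\<close>; both are relations.\<close>

theorem nonP_cycle_boundary:
  assumes z: "z \<in> csupp VN k" and dz: "bar_d A k z \<in> relsub A (k - 1)"
  shows "z \<in> boundaries A k"
proof -
  have d: "bar_d A k z l' = (\<Sum>l\<in>Yb (Suc k). z l * bar_db A l l')" if "l' \<in> Yb k" for l'
    unfolding bar_d_def
  proof (rule sum_Yb)
    show "z l * bar_db A l l' = 0" if "list_all P l" for l using z that by (simp add: csupp_def)
    show "z l * bar_db A l l' = 0" if "l \<in> tups (Suc k)" "l \<in> VJ" for l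
      using bar_db_VJ[OF that, of l'] \<open>l' \<in> Yb k\<close> by (simp add: Yb_iff)
  qed
  have "(\<lambda>l'. \<Sum>l\<in>Yb (Suc k). z l * bar_db A l l') \<in> coinvariant_rels k"
  proof (cases k)
    case 0
    then show ?thesis by (simp add: coinvariant_rels_def Yb_0)
  next
    case (Suc k')
    then have "bar_d A k z \<in> coinvariant_rels k" using relsub_coinvariant dz by simp
    then show ?thesis unfolding coinvariant_rels_def using d by simp
  qed
  from exact_coinvariants[OF this] obtain w where
    w: "(\<lambda>l'. z l' - (\<Sum>l\<in>Yb (Suc (Suc k)). w l * bar_db A l l')) \<in> coinvariant_rels (Suc k)" by blast
  then obtain f where f: "\<And>l'. l' \<in> Yb (Suc k) \<Longrightarrow> z l' - (\<Sum>l\<in>Yb (Suc (Suc k)). w l * bar_db A l l') =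
     (\<Sum>l\<in>Yb (Suc k). \<Sum>g\<in>Gp. f l g * ((if l' = ract g l then 1 else 0) - (if l' = l then 1 else 0)))"
    unfolding coinvariant_rels_def by blast
  define w0 where "w0 l = (if l \<in> Yb (Suc (Suc k)) then w l else 0)" for l
  have w0: "w0 \<in> csupp VN (Suc k)" by (auto simp: csupp_def w0_def Yb_iff)
  have dw0: "bar_d A (Suc k) w0 l' = (\<Sum>l\<in>Yb (Suc (Suc k)). w l * bar_db A l l')" for l'
  proof -
    have "(\<Sum>l\<in>tups (Suc (Suc k)). w0 l * bar_db A l l') = (\<Sum>l\<in>Yb (Suc (Suc k)). w0 l * bar_db A l l')"
      by (rule sum_Yb) (auto simp: w0_def Yb_iff)
    then show ?thesis by (simp add: bar_d_def w0_def)
  qed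
  \<comment> \<open>The combination of differences with coefficients \<open>f\<close>, now as a
    function on all tuples and visibly a relation.\<close>
  define s where "s l' = (\<Sum>l\<in>Yb (Suc k). \<Sum>g\<in>Gp. f l g * (bvec (ract g l) l' - bvec l l'))" for l'
  have s: "s \<in> relsub A k"
    unfolding s_def relsub_def
  proof (intro rspan_sum rspan_scale)
    fix l g assume "l \<in> Yb (Suc k)" "g \<in> Gp"
    then show "(\<lambda>l'. bvec (ract g l) l' - bvec l l') \<in> rspan (rel_gens A k)"
      using relsub_ract[of l k g] by (simp add: relsub_def Yb_iff)
  qed
  have s0: "s l' = 0" if "l' \<notin> Yb (Suc k)" for l'
    unfolding s_def
  proof (intro sum.neutral ballI)
    fix l g assume "l \<in> Yb (Suc k)" "g \<in> Gp"
    then have "ract g l \<in> Yb (Suc k)" "l \<in> Yb (Suc k)" using ract_Yb by auto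
    then have "ract g l \<noteq> l'" "l \<noteq> l'" using that by auto
    then show "f l g * (bvec (ract g l) l' - bvec l l') = 0" by (simp add: bvec_def)
  qed
  \<comment> \<open>The rest vanishes on \<open>Yb\<close> by the choice of \<open>f\<close>, and
    outside \<open>VN\<close> because each of its parts does; hence it is carried by
    \<open>VJ\<close>.\<close>
  define t where "t l' = z l' - bar_d A (Suc k) w0 l' - s l'" for l'
  have "t \<in> csupp VJ k"
    unfolding csupp_def
  proof (intro CollectI allI impI)
    fix l' assume l': "l' \<notin> tups (Suc k) \<inter> VJ"
    show "t l' = 0"
    proof (cases "l' \<in> Yb (Suc k)")
      case True
      then show ?thesis using f[OF True] by (simp add: t_def dw0 s_def bvec_def)
    next
      case False
      then have n: "l' \<notin> tups (Suc k) \<inter> VN" using l' by (auto simp: Yb_iff)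
      have "z l' = 0" using z n unfolding csupp_def by blast
      moreover have "bar_d A (Suc k) w0 l' = 0"
        using subcomplex_bar_d[OF subcomplex_VN w0] n unfolding csupp_def by blast
      ultimately show ?thesis using s0[OF False] by (simp add: t_def)
    qed
  qed
  then have "(\<lambda>l. s l + t l) \<in> relsub A k"
    using s csupp_VJ_relsub rspan_add unfolding relsub_def by blast
  moreover have "w0 \<in> chains A (Suc k)" using w0 by (simp add: csupp_def chains_def)
  moreover have "z = (\<lambda>l. bar_d A (Suc k) w0 l + (s l + t l))" by (simp add: t_def)
  ultimately show ?thesis
    unfolding boundaries_def by (intro CollectI bexI[of _ w0] bexI[of _ "\<lambda>l. s l + t l"])
qed

end

section \<open>Stacking of diagrams as matrix multiplication\<close>

text \<open>The 2-colouring of the nodes by membership in S is constant on every block of Q.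
  Partitions are handled below through these colourings.\<close>

definition sat :: "'x set \<Rightarrow> 'x set set \<Rightarrow> bool" where
  "sat S Q \<longleftrightarrow> (\<forall>B\<in>Q. B \<subseteq> S \<or> B \<inter> S = {})"

text \<open>The closure also relates each point outside N to itself, so it is an equivalence on
  \<open>UNIV\<close>; classes of points of N stay in N because \<open>E\<close> does.\<close>

lemma partition_on_quotient_rtrancl:
  assumes E: "E \<subseteq> N \<times> N" "sym E"
  shows "partition_on N (N // E\<^sup>*)"
proof -
  have eq: "equiv UNIV (E\<^sup>*)"
    using E(2) by (auto simp: equiv_def refl_rtrancl trans_rtrancl sym_rtrancl)
  have sub: "E\<^sup>* `` {u} \<subseteq> N" if "u \<in> N" for u
  proof
    fix v assume "v \<in> E\<^sup>* `` {u}"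
    then have "(u, v) \<in> E\<^sup>*" by simp
    then show "v \<in> N" by (induction rule: rtrancl_induct) (use that E(1) in auto)
  qed
  show ?thesis
  proof (rule partition_onI)
    show "\<Union>(N // E\<^sup>*) = N" using sub by (auto simp: quotient_def)
    show "{} \<notin> N // E\<^sup>*" by (auto simp: quotient_def)
    fix p q assume "p \<in> N // E\<^sup>*" "q \<in> N // E\<^sup>*" "p \<noteq> q"
    then show "disjnt p q"
      using quotient_disj[OF eq, of p q] by (auto simp: quotient_def disjnt_def)
  qed
qed

text \<open>Constancy on components only has to be checked along the generating edges. A partition
  given by generators can thus be used without knowing its blocks.\<close>

lemma sat_quotient_rtrancl:
  assumes E: "E \<subseteq> N \<times> N" "sym E"
  shows "sat S (N // E\<^sup>*) \<longleftrightarrow> (\<forall>(u, v)\<in>E. u \<in> S \<longleftrightarrow> v \<in> S)"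
proof
  assume s: "sat S (N // E\<^sup>*)"
  show "\<forall>(u, v)\<in>E. u \<in> S \<longleftrightarrow> v \<in> S"
  proof clarify
    fix u v assume uv: "(u, v) \<in> E"
    then have "E\<^sup>* `` {u} \<in> N // E\<^sup>*" using E by (auto simp: quotient_def)
    moreover have "u \<in> E\<^sup>* `` {u}" "v \<in> E\<^sup>* `` {u}" using uv by auto
    ultimately show "u \<in> S \<longleftrightarrow> v \<in> S" using s unfolding sat_def by blast
  qed
next
  assume e: "\<forall>(u, v)\<in>E. u \<in> S \<longleftrightarrow> v \<in> S"
  have "u \<in> S \<longleftrightarrow> v \<in> S" if "(u, v) \<in> E\<^sup>*" for u v
    using that by (induction rule: rtrancl_induct) (use e in auto)
  then show "sat S (N // E\<^sup>*)" unfolding sat_def quotient_def by blast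
qed

text \<open>The block of a point is the least saturated set containing it, so the saturated sets
  determine the partition.\<close>

lemma sat_partition_eq:
  assumes "partition_on N Q" "partition_on N Q'"
    and "\<And>S. S \<subseteq> N \<Longrightarrow> sat S Q \<longleftrightarrow> sat S Q'"
  shows "Q = Q'"
proof -
  have *: "B \<in> Q2" if Q: "partition_on N Q1" "partition_on N Q2" and s: "\<And>S. S \<subseteq> N \<Longrightarrow> sat S Q1 \<longleftrightarrow> sat S Q2"
    and B: "B \<in> Q1" for Q1 Q2 B
  proof -
    have dj1: "C \<inter> C' = {}" if "C \<in> Q1" "C' \<in> Q1" "C \<noteq> C'" for C C'
      using partition_onD2[OF Q(1)] that by (auto simp: disjoint_def)
    have dj2: "C \<inter> C' = {}" if "C \<in> Q2" "C' \<in> Q2" "C \<noteq> C'" for C C'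
      using partition_onD2[OF Q(2)] that by (auto simp: disjoint_def)
    have "B \<noteq> {}" using partition_onD3[OF Q(1)] B by auto
    then obtain x where x: "x \<in> B" by blast
    have "B \<subseteq> N" using partition_onD1[OF Q(1)] B by auto
    then obtain B' where B': "B' \<in> Q2" "x \<in> B'" using partition_onD1[OF Q(2)] x by auto
    have "B' \<subseteq> N" using partition_onD1[OF Q(2)] B' by auto
    have "sat B Q1" using dj1[OF _ B] by (auto simp: sat_def) 
    then have "sat B Q2" using s \<open>B \<subseteq> N\<close> by simp
    then have "B' \<subseteq> B" using B' x by (auto simp: sat_def)
    moreover have "sat B' Q2" using dj2[OF _ B'(1)] by (auto simp: sat_def)
    then have "sat B' Q1" using s \<open>B' \<subseteq> N\<close> by simp
    then have "B \<subseteq> B'" using B' B x by (auto simp: sat_def)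
    ultimately show ?thesis using B' by simp
  qed
  show ?thesis using *[of Q Q'] *[of Q' Q] assms by blast
qed

text \<open>Blocks meeting Z have their colour forced by S0, blocks disjoint from Z are coloured
  freely. With Z the outer nodes the free blocks are the closed loops; this is the source of the
  powers of 2.\<close>

lemma card_sat_extensions:
  assumes Q: "partition_on N Q" and N: "finite N" and Z: "S0 \<subseteq> Z" "Z \<subseteq> N"
    and s: "\<And>C. C \<in> Q \<Longrightarrow> C \<inter> Z \<subseteq> S0 \<or> C \<inter> S0 = {}"
  shows "card {T. T \<subseteq> N \<and> T \<inter> Z = S0 \<and> sat T Q} = 2 ^ card {C \<in> Q. C \<inter> Z = {}}"
proof -
  have Un: "\<Union>Q = N" and ne: "{} \<notin> Q" using Q by (auto simp: partition_on_def)
  have dj: "x \<in> C \<Longrightarrow> x \<in> C' \<Longrightarrow> C \<in> Q \<Longrightarrow> C' \<in> Q \<Longrightarrow> C = C'" for x C C'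
    using partition_onD2[OF Q] by (auto simp: disjoint_def)
  let ?L = "{C \<in> Q. C \<inter> Z = {}}"
  define ext where "ext K = \<Union>(K \<union> {C \<in> Q. C \<inter> S0 \<noteq> {}})" for K
  have "bij_betw (\<lambda>T. {C \<in> ?L. C \<subseteq> T}) {T. T \<subseteq> N \<and> T \<inter> Z = S0 \<and> sat T Q} (Pow ?L)"
  proof (rule bij_betw_byWitness[where f' = ext])
    show "\<forall>T\<in>{T. T \<subseteq> N \<and> T \<inter> Z = S0 \<and> sat T Q}. ext {C \<in> ?L. C \<subseteq> T} = T"
    proof clarify
      fix T assume T: "T \<subseteq> N" "S0 = T \<inter> Z" "sat T Q"
      show "ext {C \<in> ?L. C \<subseteq> T} = T"
      proof (intro set_eqI iffI)
        fix x assume "x \<in> ext {C \<in> ?L. C \<subseteq> T}"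
        then show "x \<in> T" using T unfolding ext_def sat_def by blast
      next
        fix x assume x: "x \<in> T"
        then obtain C where C: "C \<in> Q" "x \<in> C" using T(1) Un by blast
        then have "C \<subseteq> T" using T(3) x unfolding sat_def by blast
        then show "x \<in> ext {C \<in> ?L. C \<subseteq> T}" using C T(2) unfolding ext_def by blast
      qed
    qed
    show "\<forall>K\<in>Pow ?L. {C \<in> ?L. C \<subseteq> ext K} = K"
    proof clarify
      fix K assume K: "K \<subseteq> ?L"
      show "{C \<in> ?L. C \<subseteq> ext K} = K"
      proof (intro set_eqI iffI)
        fix C assume C: "C \<in> {C \<in> ?L. C \<subseteq> ext K}"
        then obtain x where "x \<in> C" using ne by fastforce
        then obtain C' where C': "x \<in> C'" "C' \<in> K \<or> C' \<in> Q \<and> C' \<inter> S0 \<noteq> {}"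
          using C unfolding ext_def by blast
        then have "C = C'" using dj[OF \<open>x \<in> C\<close> C'(1)] C K by blast
        then show "C \<in> K" using C C' Z(1) by blast
      qed (use K in \<open>auto simp: ext_def\<close>)
    qed
    show "(\<lambda>T. {C \<in> ?L. C \<subseteq> T}) ` {T. T \<subseteq> N \<and> T \<inter> Z = S0 \<and> sat T Q} \<subseteq> Pow ?L" by auto
    show "ext ` Pow ?L \<subseteq> {T. T \<subseteq> N \<and> T \<inter> Z = S0 \<and> sat T Q}"
    proof clarify
      fix K assume K: "K \<subseteq> ?L"
      have "ext K \<subseteq> N" using K Un unfolding ext_def by blast
      moreover have "ext K \<inter> Z = S0"
      proof
        show "ext K \<inter> Z \<subseteq> S0" using K s unfolding ext_def by blast
        show "S0 \<subseteq> ext K \<inter> Z"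
        proof
          fix x assume x: "x \<in> S0"
          then obtain C where "C \<in> Q" "x \<in> C" using Z Un by blast
          then show "x \<in> ext K \<inter> Z" using x Z unfolding ext_def by blast
        qed
      qed
      moreover have "sat (ext K) Q"
        unfolding sat_def
      proof
        fix C assume C: "C \<in> Q"
        show "C \<subseteq> ext K \<or> C \<inter> ext K = {}"
        proof (cases "C \<inter> ext K = {}")
          case False
          then obtain x C' where x: "x \<in> C" "x \<in> C'" "C' \<in> K \<or> C' \<in> Q \<and> C' \<inter> S0 \<noteq> {}"
            unfolding ext_def by blast
          then have "C = C'" using dj[OF x(1,2) C] K by blast
          then show ?thesis using x(3) unfolding ext_def by blast
        qed simp
      qed
      ultimately show "ext K \<subseteq> N \<and> ext K \<inter> Z = S0 \<and> sat (ext K) Q" by blast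
    qed
  qed
  then have "card {T. T \<subseteq> N \<and> T \<inter> Z = S0 \<and> sat T Q} = card (Pow ?L)"
    by (rule bij_betw_same_card)
  also have "\<dots> = 2 ^ card ?L"
    using finite_elements[OF N Q] by (simp add: card_Pow)
  finally show ?thesis .
qed

text \<open>Left and right colours are kept as separate sets so that they can serve as row and
  column indices. The two images are disjoint unless both sets contain 0, which subsets of
  \<open>{1..n}\<close> never do.\<close>

definition glue :: "nat set \<Rightarrow> nat set \<Rightarrow> int set" where
  "glue F G = (\<lambda>i. - int i) ` F \<union> int ` G"

lemma subset_nodes_glue:
  assumes "S \<subseteq> nodes n"
  obtains F G where "F \<subseteq> {1..n}" "G \<subseteq> {1..n}" "S = glue F G"
proof
  show "{i \<in> {1..n}. - int i \<in> S} \<subseteq> {1..n}" "{i \<in> {1..n}. int i \<in> S} \<subseteq> {1..n}" by auto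
  show "S = glue {i \<in> {1..n}. - int i \<in> S} {i \<in> {1..n}. int i \<in> S}"
  proof (intro set_eqI iffI)
    fix x assume x: "x \<in> S"
    then have "x \<in> nodes n" using assms by blast
    then have "x = - int (nat (- x)) \<and> nat (- x) \<in> {1..n} \<or> x = int (nat x) \<and> nat x \<in> {1..n}"
      by (auto simp: nodes_def)
    then show "x \<in> glue {i \<in> {1..n}. - int i \<in> S} {i \<in> {1..n}. int i \<in> S}"
      using x unfolding glue_def by (metis (mono_tags, lifting) UnI1 UnI2 image_eqI mem_Collect_eq)
  qed (auto simp: glue_def)
qed

lemma mem_glue_neg: "F \<subseteq> {1..n} \<Longrightarrow> G \<subseteq> {1..n} \<Longrightarrow> - int i \<in> glue F G \<longleftrightarrow> i \<in> F"
  by (auto simp: glue_def) 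

lemma mem_glue_pos: "F \<subseteq> {1..n} \<Longrightarrow> G \<subseteq> {1..n} \<Longrightarrow> int i \<in> glue F G \<longleftrightarrow> i \<in> G"
  by (auto simp: glue_def)

lemma nodes_cases:
  assumes "x \<in> nodes n"
  obtains i where "i \<in> {1..n}" "x = - int i" | i where "i \<in> {1..n}" "x = int i"
proof -
  have "x = - int (nat (- x)) \<and> nat (- x) \<in> {1..n} \<or> x = int (nat x) \<and> nat x \<in> {1..n}"
    using assms by (auto simp: nodes_def)
  then show thesis using that by blast
qed

lemma finite_nodes: "finite (nodes n)" by (simp add: nodes_def)

lemma finite_diagrams: "finite (diagrams n)"
  unfolding diagrams_def by (rule finitely_many_partition_on[OF finite_nodes])

text \<open>Entries, indexed by 2-colourings of the left and right nodes (given as subsets), of the matrix by which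
  the diagram acts on a tensor power of a module of rank 2. Up to the factors 2 ^ loops, stacking
  becomes matrix multiplication (mat_mult); associativity and all products below are read off from this.\<close>
definition mat :: "int set set \<Rightarrow> nat set \<Rightarrow> nat set \<Rightarrow> nat" where
  "mat d F G = (if sat (glue F G) d then 1 else 0)"

lemma diagrams_eqI:
  assumes "d \<in> diagrams n" "d' \<in> diagrams n"
    and "\<And>F G. F \<subseteq> {1..n} \<Longrightarrow> G \<subseteq> {1..n} \<Longrightarrow> mat d F G = mat d' F G"
  shows "d = d'"
proof (rule sat_partition_eq)
  show "partition_on (nodes n) d" "partition_on (nodes n) d'" using assms by (auto simp: diagrams_def)
  fix S assume "S \<subseteq> nodes n"
  then obtain F G where FG: "F \<subseteq> {1..n}" "G \<subseteq> {1..n}" "S = glue F G" by (rule subset_nodes_glue)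
  show "sat S d = sat S d'"
    using assms(3)[OF FG(1,2)] unfolding FG(3) mat_def by (auto split: if_splits)
qed

text \<open>A colouring of the three layers of a stacked picture; G colours the middle layer, over
  which the matrix product sums.\<close>

definition triple :: "nat set \<Rightarrow> nat set \<Rightarrow> nat set \<Rightarrow> (nat \<times> nat) set" where
  "triple F G H = {0} \<times> F \<union> {1} \<times> G \<union> {2} \<times> H"

definition outer :: "nat \<Rightarrow> (nat \<times> nat) set" where
  "outer n = {0, 2} \<times> {1..n}"

lemma lift1_mem: "F \<subseteq> {1..n} \<Longrightarrow> G \<subseteq> {1..n} \<Longrightarrow> x \<in> nodes n \<Longrightarrow> lift1 x \<in> triple F G H \<longleftrightarrow> x \<in> glue F G"
  by (elim nodes_cases) (auto simp: lift1_def triple_def mem_glue_neg mem_glue_pos)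

lemma lift2_mem: "G \<subseteq> {1..n} \<Longrightarrow> H \<subseteq> {1..n} \<Longrightarrow> x \<in> nodes n \<Longrightarrow> lift2 x \<in> triple F G H \<longleftrightarrow> x \<in> glue G H"
  by (elim nodes_cases) (auto simp: lift2_def triple_def mem_glue_neg mem_glue_pos)

lemma unlift_mem: "F \<subseteq> {1..n} \<Longrightarrow> H \<subseteq> {1..n} \<Longrightarrow> u \<in> outer n \<Longrightarrow> unlift u \<in> glue F H \<longleftrightarrow> u \<in> triple F G H"
  by (auto simp: outer_def unlift_def triple_def mem_glue_neg mem_glue_pos)

lemma stack_rel_subset:
  assumes "d1 \<in> diagrams n" "d2 \<in> diagrams n"
  shows "stack_rel d1 d2 \<subseteq> stack_nodes n \<times> stack_nodes n"
proof -
  have "\<Union>d1 = nodes n" "\<Union>d2 = nodes n" using assms by (auto simp: diagrams_def partition_on_def)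
  moreover have "lift1 x \<in> stack_nodes n" "lift2 x \<in> stack_nodes n" if "x \<in> nodes n" for x
    using that by (auto simp: nodes_def stack_nodes_def lift1_def lift2_def)
  ultimately show ?thesis unfolding stack_rel_def by blast
qed

lemma sym_stack_rel: "sym (stack_rel d1 d2)"
  unfolding stack_rel_def sym_def by blast

lemma partition_components:
  assumes "d1 \<in> diagrams n" "d2 \<in> diagrams n"
  shows "partition_on (stack_nodes n) (components n d1 d2)"
  unfolding components_def
  by (rule partition_on_quotient_rtrancl[OF stack_rel_subset[OF assms] sym_stack_rel])

text \<open>The components are generated by the blocks of both diagrams, so a colouring respects
  them exactly if its two halves, which share the middle colouring G, respect the two
  diagrams.\<close>

lemma sat_components:
  assumes d: "d1 \<in> diagrams n" "d2 \<in> diagrams n"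
    and FGH: "F \<subseteq> {1..n}" "G \<subseteq> {1..n}" "H \<subseteq> {1..n}"
  shows "sat (triple F G H) (components n d1 d2) \<longleftrightarrow> sat (glue F G) d1 \<and> sat (glue G H) d2"
proof -
  have nod: "x \<in> nodes n" if "x \<in> B" "B \<in> d1 \<or> B \<in> d2" for x B
    using d that by (auto simp: diagrams_def partition_on_def)
  have "sat (glue F G) d1 \<longleftrightarrow> (\<forall>B\<in>d1. \<forall>x\<in>B. \<forall>y\<in>B. x \<in> glue F G \<longleftrightarrow> y \<in> glue F G)"
    unfolding sat_def by blast
  also have "\<dots> \<longleftrightarrow> (\<forall>B\<in>d1. \<forall>x\<in>B. \<forall>y\<in>B. lift1 x \<in> triple F G H \<longleftrightarrow> lift1 y \<in> triple F G H)"
    by (intro ball_cong refl) (simp add: lift1_mem[OF FGH(1,2)] nod)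
  finally have 1: "sat (glue F G) d1 \<longleftrightarrow> \<dots>" .
  have "sat (glue G H) d2 \<longleftrightarrow> (\<forall>B\<in>d2. \<forall>x\<in>B. \<forall>y\<in>B. x \<in> glue G H \<longleftrightarrow> y \<in> glue G H)"
    unfolding sat_def by blast
  also have "\<dots> \<longleftrightarrow> (\<forall>B\<in>d2. \<forall>x\<in>B. \<forall>y\<in>B. lift2 x \<in> triple F G H \<longleftrightarrow> lift2 y \<in> triple F G H)"
    by (intro ball_cong refl) (simp add: lift2_mem[OF FGH(2,3)] nod)
  finally have 2: "sat (glue G H) d2 \<longleftrightarrow> \<dots>" .
  show ?thesis
    unfolding components_def sat_quotient_rtrancl[OF stack_rel_subset[OF d] sym_stack_rel] 1 2
    unfolding stack_rel_def by (simp add: image_iff) blast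
qed

lemma outer_stack: "stack_nodes n \<inter> {u. fst u \<noteq> 1} = outer n"
  by (auto simp: stack_nodes_def outer_def)

lemma inj_unlift: "inj_on unlift (outer n)"
  by (auto simp: inj_on_def outer_def unlift_def)

lemma unlift_outer: "unlift ` outer n = nodes n"
proof (intro set_eqI iffI)
  fix x assume "x \<in> nodes n"
  then show "x \<in> unlift ` outer n"
  proof (cases rule: nodes_cases)
    case (1 i)
    then have "x = unlift (0, i)" "(0, i) \<in> outer n" by (auto simp: unlift_def outer_def)
    then show ?thesis by blast
  next
    case (2 i)
    then have "x = unlift (2, i)" "(2, i) \<in> outer n" by (auto simp: unlift_def outer_def)
    then show ?thesis by blast
  qed
qed (auto simp: outer_def unlift_def nodes_def)

text \<open>Restriction to the outer nodes followed by an injective relabelling: two operations that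
  are known to preserve partitions.\<close>

lemma diag_prod_outer:
  assumes "d1 \<in> diagrams n" "d2 \<in> diagrams n"
  shows "diag_prod n d1 d2 = (`) unlift ` ((\<inter>) (outer n) ` components n d1 d2 - {{}})"
proof -
  have "C \<inter> {u. fst u \<noteq> 1} = outer n \<inter> C" if "C \<in> components n d1 d2" for C
  proof -
    have "C \<subseteq> stack_nodes n" using that partition_onD1[OF partition_components[OF assms]] by auto
    then show ?thesis using outer_stack[of n] by blast
  qed
  then have eq: "\<And>C. C \<in> components n d1 d2 \<Longrightarrow> C \<inter> {u. fst u \<noteq> 1} = outer n \<inter> C" .
  have "B \<in> diag_prod n d1 d2 \<longleftrightarrow> (\<exists>C\<in>components n d1 d2. B = unlift ` (outer n \<inter> C) \<and> outer n \<inter> C \<noteq> {})" for B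
    unfolding diag_prod_def mem_Collect_eq Bex_def using eq by metis
  then show ?thesis by (intro set_eqI) (simp add: image_iff Bex_def, metis)
qed

lemma sat_image_restrict:
  "sat S ((`) f ` ((\<inter>) Z ` Q - {{}})) \<longleftrightarrow>
    (\<forall>C\<in>Q. (\<forall>u\<in>Z \<inter> C. f u \<in> S) \<or> (\<forall>u\<in>Z \<inter> C. f u \<notin> S))"
proof -
  have im: "f ` B \<subseteq> S \<or> f ` B \<inter> S = {} \<longleftrightarrow> (\<forall>u\<in>B. f u \<in> S) \<or> (\<forall>u\<in>B. f u \<notin> S)" for B
    by auto
  have drop_empty: "(\<forall>B\<in>g ` Q - {{}}. R B) \<longleftrightarrow> (\<forall>C\<in>Q. R (g C))" if "R {}" for R and g :: "'b set \<Rightarrow> 'b set"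
  proof
    assume l: "\<forall>B\<in>g ` Q - {{}}. R B"
    show "\<forall>C\<in>Q. R (g C)"
    proof
      fix C assume "C \<in> Q"
      then show "R (g C)" using l that by (cases "g C = {}") auto
    qed
  qed auto
  have "sat S ((`) f ` ((\<inter>) Z ` Q - {{}})) \<longleftrightarrow>
      (\<forall>B\<in>(\<inter>) Z ` Q - {{}}. (\<forall>u\<in>B. f u \<in> S) \<or> (\<forall>u\<in>B. f u \<notin> S))"
    unfolding sat_def ball_simps(9) im ..
  also have "\<dots> \<longleftrightarrow> (\<forall>C\<in>Q. (\<forall>u\<in>Z \<inter> C. f u \<in> S) \<or> (\<forall>u\<in>Z \<inter> C. f u \<notin> S))"
    by (rule drop_empty) simp
  finally show ?thesis .
qed

lemma diag_prod_closed:
  assumes d: "d1 \<in> diagrams n" "d2 \<in> diagrams n"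
  shows "diag_prod n d1 d2 \<in> diagrams n"
proof -
  have "outer n \<inter> stack_nodes n = outer n" using outer_stack[of n] by blast
  then have *: "partition_on (outer n) ((\<inter>) (outer n) ` components n d1 d2 - {{}})"
    using partition_on_restrict[OF partition_components[OF d], of "outer n"] by simp
  have "partition_on (unlift ` outer n) (diag_prod n d1 d2 - {{}})"
    unfolding diag_prod_outer[OF d] by (rule partition_on_inj_image[OF * inj_unlift])
  moreover have "{} \<notin> diag_prod n d1 d2" unfolding diag_prod_def by auto
  ultimately show ?thesis by (simp add: unlift_outer diagrams_def)
qed

text \<open>The sum counts the middle colourings G that complete F and H to a colouring constant on
  components. A completion exists exactly when F and H respect the product diagram, and then it is
  free precisely on the components made of middle nodes.\<close>

theorem mat_mult:
  assumes d: "d1 \<in> diagrams n" "d2 \<in> diagrams n" and FH: "F \<subseteq> {1..n}" "H \<subseteq> {1..n}"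
  shows "(\<Sum>G\<in>Pow {1..n}. mat d1 F G * mat d2 G H) = 2 ^ loops n d1 d2 * mat (diag_prod n d1 d2) F H"
proof -
  let ?C = "components n d1 d2"
  let ?S0 = "triple F {} H"
  note Q = partition_components[OF d]
  have fin: "finite (stack_nodes n)" by (simp add: stack_nodes_def)
  have "(\<Sum>G\<in>Pow {1..n}. mat d1 F G * mat d2 G H) =
      (\<Sum>G\<in>Pow {1..n}. if sat (triple F G H) ?C then 1 else 0)"
    by (intro sum.cong refl) (use sat_components[OF d FH(1) _ FH(2)] in \<open>auto simp: mat_def\<close>)
  also have "\<dots> = card {G \<in> Pow {1..n}. sat (triple F G H) ?C}"
    by (simp add: sum.inter_filter[symmetric])
  also have "\<dots> = card {T. T \<subseteq> stack_nodes n \<and> T \<inter> outer n = ?S0 \<and> sat T ?C}"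
  proof (rule bij_betw_same_card[of "\<lambda>G. triple F G H"], rule bij_betw_byWitness[where f' = "\<lambda>T. {i. (1, i) \<in> T}"])
    show "\<forall>G\<in>{G \<in> Pow {1..n}. sat (triple F G H) ?C}. {i. (1, i) \<in> triple F G H} = G"
      by (auto simp: triple_def)
    have *: "triple F {i. (1, i) \<in> T} H = T" if "T \<subseteq> stack_nodes n" "T \<inter> outer n = ?S0" for T
    proof (rule set_eqI)
      fix u :: "nat \<times> nat"
      obtain a i where u: "u = (a, i)" by (cases u)
      show "u \<in> triple F {i. (1, i) \<in> T} H \<longleftrightarrow> u \<in> T"
      proof (cases "a = 1")
        case True
        then show ?thesis by (auto simp: u triple_def)
      next
        case False
        then have "u \<in> stack_nodes n \<longleftrightarrow> u \<in> outer n"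
          unfolding outer_stack[symmetric] by (simp add: u)
        then have "u \<in> T \<longleftrightarrow> u \<in> T \<inter> outer n" using that(1) by blast
        then show ?thesis unfolding that(2) using False by (auto simp: u triple_def)
      qed
    qed
    then show "\<forall>T\<in>{T. T \<subseteq> stack_nodes n \<and> T \<inter> outer n = ?S0 \<and> sat T ?C}. triple F {i. (1, i) \<in> T} H = T"
      by blast
    show "(\<lambda>G. triple F G H) ` {G \<in> Pow {1..n}. sat (triple F G H) ?C}
        \<subseteq> {T. T \<subseteq> stack_nodes n \<and> T \<inter> outer n = ?S0 \<and> sat T ?C}"
      using FH by (auto simp: triple_def stack_nodes_def outer_def)
    show "(\<lambda>T. {i. (1, i) \<in> T}) ` {T. T \<subseteq> stack_nodes n \<and> T \<inter> outer n = ?S0 \<and> sat T ?C}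
        \<subseteq> {G \<in> Pow {1..n}. sat (triple F G H) ?C}"
    proof clarify
      fix T assume T: "T \<subseteq> stack_nodes n" "T \<inter> outer n = ?S0" "sat T ?C"
      have "{i. (1, i) \<in> T} \<subseteq> {1..n}" using T(1) by (auto simp: stack_nodes_def)
      then show "{i. (1, i) \<in> T} \<in> Pow {1..n} \<and> sat (triple F {i. (1, i) \<in> T} H) ?C"
        using *[OF T(1,2)] T(3) by simp
    qed
  qed
  also have "\<dots> = 2 ^ loops n d1 d2 * mat (diag_prod n d1 d2) F H"
  proof -
    have um: "unlift u \<in> glue F H \<longleftrightarrow> u \<in> ?S0" if "u \<in> outer n" for u
      by (rule unlift_mem[OF FH that])
    have "sat (glue F H) (diag_prod n d1 d2) \<longleftrightarrow>
        (\<forall>C\<in>?C. (\<forall>u\<in>outer n \<inter> C. unlift u \<in> glue F H) \<or> (\<forall>u\<in>outer n \<inter> C. unlift u \<notin> glue F H))"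
      unfolding diag_prod_outer[OF d] by (rule sat_image_restrict)
    also have "\<dots> \<longleftrightarrow> (\<forall>C\<in>?C. (\<forall>u\<in>outer n \<inter> C. u \<in> ?S0) \<or> (\<forall>u\<in>outer n \<inter> C. u \<notin> ?S0))"
      by (intro ball_cong refl) (auto simp: um)
    finally have sat_prod: "sat (glue F H) (diag_prod n d1 d2) \<longleftrightarrow>
        (\<forall>C\<in>?C. (\<forall>u\<in>outer n \<inter> C. u \<in> ?S0) \<or> (\<forall>u\<in>outer n \<inter> C. u \<notin> ?S0))" .
    have S0: "?S0 \<subseteq> outer n" "outer n \<subseteq> stack_nodes n"
      using FH by (auto simp: triple_def outer_def stack_nodes_def)
    have L: "loops n d1 d2 = card {C \<in> ?C. C \<inter> outer n = {}}"
    proof -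
      have "C \<subseteq> {u. fst u = 1} \<longleftrightarrow> C \<inter> outer n = {}" if "C \<in> ?C" for C
      proof -
        have "C \<subseteq> stack_nodes n" using that partition_onD1[OF Q] by auto
        then show ?thesis using outer_stack[of n] by blast
      qed
      then have "{C \<in> ?C. C \<subseteq> {u. fst u = 1}} = {C \<in> ?C. C \<inter> outer n = {}}" by blast
      then show ?thesis unfolding loops_def by simp
    qed
    show ?thesis
    proof (cases "sat (glue F H) (diag_prod n d1 d2)")
      case True
      have "C \<inter> outer n \<subseteq> ?S0 \<or> C \<inter> ?S0 = {}" if "C \<in> ?C" for C
      proof -
        have "(\<forall>u\<in>outer n \<inter> C. u \<in> ?S0) \<or> (\<forall>u\<in>outer n \<inter> C. u \<notin> ?S0)"
          using True that unfolding sat_prod by (rule bspec)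
        then show ?thesis using S0(1) by blast
      qed
      then show ?thesis using card_sat_extensions[OF Q fin S0] True L by (simp add: mat_def)
    next
      case False
      \<comment> \<open>Some component meets the outer nodes in both colours, so no choice in the
        middle layer makes it monochromatic.\<close>
      then obtain C where C: "C \<in> ?C" "\<not> outer n \<inter> C \<subseteq> ?S0" "outer n \<inter> C \<inter> ?S0 \<noteq> {}"
        unfolding sat_prod by blast
      have "\<not> sat T ?C" if T: "T \<inter> outer n = ?S0" for T
      proof
        assume "sat T ?C"
        then have "C \<subseteq> T \<or> C \<inter> T = {}" using C(1) unfolding sat_def by blast
        then show False using C(2,3) T by blast
      qed
      then have "{T. T \<subseteq> stack_nodes n \<and> T \<inter> outer n = ?S0 \<and> sat T ?C} = {}" by blast
      then show ?thesis using False by (simp only: mat_def card.empty if_False mult_zero_right)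
    qed
  qed
  finally show ?thesis .
qed

lemma mat_empty [simp]: "mat d {} {} = 1"
  by (simp add: mat_def sat_def glue_def)

text \<open>Diagram and loop count are recovered together: the entry at the empty colourings is
  always 1 and isolates the power of 2; the other entries then determine the diagram.\<close>

lemma diag_prod_eqI:
  assumes d: "d1 \<in> diagrams n" "d2 \<in> diagrams n" and y: "y \<in> diagrams n"
    and m: "\<And>F H. F \<subseteq> {1..n} \<Longrightarrow> H \<subseteq> {1..n} \<Longrightarrow>
      (\<Sum>G\<in>Pow {1..n}. mat d1 F G * mat d2 G H) = 2 ^ c * mat y F H"
  shows "diag_prod n d1 d2 = y \<and> loops n d1 d2 = c"
proof -
  have eq: "2 ^ loops n d1 d2 * mat (diag_prod n d1 d2) F H = 2 ^ c * mat y F H"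
    if "F \<subseteq> {1..n}" "H \<subseteq> {1..n}" for F H
    using m[OF that] mat_mult[OF d that] by simp
  have c: "loops n d1 d2 = c" using eq[of "{}" "{}"] by simp
  have "diag_prod n d1 d2 = y"
    by (rule diagrams_eqI[OF diag_prod_closed[OF d] y]) (use eq c in auto)
  then show ?thesis using c by simp
qed

text \<open>Both bracketings give the same threefold matrix product. Its entry at the empty
  colourings compares the total numbers of loops; cancelling the powers of 2 leaves equal
  matrices.\<close>

lemma diag_prod_assoc:
  assumes d: "d1 \<in> diagrams n" "d2 \<in> diagrams n" "d3 \<in> diagrams n"
  shows "diag_prod n (diag_prod n d1 d2) d3 = diag_prod n d1 (diag_prod n d2 d3)"
    and "loops n d1 d2 + loops n (diag_prod n d1 d2) d3 = loops n d2 d3 + loops n d1 (diag_prod n d2 d3)"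
proof -
  note d12 = diag_prod_closed[OF d(1,2)] and d23 = diag_prod_closed[OF d(2,3)]
  have eq: "2 ^ (loops n d1 d2 + loops n (diag_prod n d1 d2) d3) * mat (diag_prod n (diag_prod n d1 d2) d3) F K =
      2 ^ (loops n d2 d3 + loops n d1 (diag_prod n d2 d3)) * mat (diag_prod n d1 (diag_prod n d2 d3)) F K"
    if F: "F \<subseteq> {1..n}" and K: "K \<subseteq> {1..n}" for F K
  proof -
    have "2 ^ (loops n d1 d2 + loops n (diag_prod n d1 d2) d3) * mat (diag_prod n (diag_prod n d1 d2) d3) F K =
       2 ^ loops n d1 d2 * (\<Sum>H\<in>Pow {1..n}. mat (diag_prod n d1 d2) F H * mat d3 H K)"
      unfolding mat_mult[OF d12 d(3) F K] power_add mult.assoc ..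
    also have "\<dots> = (\<Sum>H\<in>Pow {1..n}. (\<Sum>G\<in>Pow {1..n}. mat d1 F G * mat d2 G H) * mat d3 H K)"
      unfolding sum_distrib_left by (intro sum.cong refl) (simp only: Pow_iff mat_mult[OF d(1,2) F] mult.assoc)
    also have "\<dots> = (\<Sum>H\<in>Pow {1..n}. \<Sum>G\<in>Pow {1..n}. mat d1 F G * (mat d2 G H * mat d3 H K))"
      unfolding sum_distrib_right mult.assoc ..
    also have "\<dots> = (\<Sum>G\<in>Pow {1..n}. \<Sum>H\<in>Pow {1..n}. mat d1 F G * (mat d2 G H * mat d3 H K))"
      by (rule sum.swap)
    also have "\<dots> = (\<Sum>G\<in>Pow {1..n}. mat d1 F G * (\<Sum>H\<in>Pow {1..n}. mat d2 G H * mat d3 H K))"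
      unfolding sum_distrib_left ..
    also have "\<dots> = (\<Sum>G\<in>Pow {1..n}. mat d1 F G * (2 ^ loops n d2 d3 * mat (diag_prod n d2 d3) G K))"
      by (intro sum.cong refl) (simp only: Pow_iff mat_mult[OF d(2,3) _ K])
    also have "\<dots> = 2 ^ loops n d2 d3 * (\<Sum>G\<in>Pow {1..n}. mat d1 F G * mat (diag_prod n d2 d3) G K)"
      unfolding sum_distrib_left by (simp only: mult.left_commute)
    also have "\<dots> = 2 ^ (loops n d2 d3 + loops n d1 (diag_prod n d2 d3)) * mat (diag_prod n d1 (diag_prod n d2 d3)) F K"
      unfolding mat_mult[OF d(1) d23 F K] power_add mult.assoc ..
    finally show ?thesis .
  qed
  show l: "loops n d1 d2 + loops n (diag_prod n d1 d2) d3 = loops n d2 d3 + loops n d1 (diag_prod n d2 d3)"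
    using eq[of "{}" "{}"] by simp
  show "diag_prod n (diag_prod n d1 d2) d3 = diag_prod n d1 (diag_prod n d2 d3)"
    by (rule diagrams_eqI[OF diag_prod_closed[OF d12 d(3)] diag_prod_closed[OF d(1) d23]])
      (use eq l in auto)
qed

text \<open>Forgetting multiplicities, a diagram is a relation between left and right colourings,
  and stacking is composition of relations.\<close>

lemma mat_diag_prod_pos:
  assumes d: "d1 \<in> diagrams n" "d2 \<in> diagrams n" and FH: "F \<subseteq> {1..n}" "H \<subseteq> {1..n}"
  shows "mat (diag_prod n d1 d2) F H = 1 \<longleftrightarrow> (\<exists>G\<subseteq>{1..n}. mat d1 F G = 1 \<and> mat d2 G H = 1)"
proof -
  have "mat (diag_prod n d1 d2) F H = 1 \<longleftrightarrow> (\<Sum>G\<in>Pow {1..n}. mat d1 F G * mat d2 G H) \<noteq> 0"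
    unfolding mat_mult[OF d FH] by (simp add: mat_def)
  also have "\<dots> \<longleftrightarrow> (\<exists>G\<subseteq>{1..n}. mat d1 F G = 1 \<and> mat d2 G H = 1)"
    by (auto simp: mat_def split: if_splits)
  finally show ?thesis .
qed

section \<open>Permutation diagrams\<close>

lemma mat_01: "mat d F G = 1 \<longleftrightarrow> mat d F G \<noteq> 0" "mat d F G \<noteq> 1 \<longleftrightarrow> mat d F G = 0"
  by (auto simp: mat_def)

lemma mat_eq_1: "mat d F G = 1 \<longleftrightarrow> sat (glue F G) d"
  by (simp add: mat_def)

lemma sum_mat:
  "(\<Sum>G\<in>Pow {1..n}. mat a F G * mat b G H) = card {G. G \<subseteq> {1..n} \<and> mat a F G = 1 \<and> mat b G H = 1}"
proof -
  have "(\<Sum>G\<in>Pow {1..n}. mat a F G * mat b G H) =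
      (\<Sum>G\<in>Pow {1..n}. if mat a F G = 1 \<and> mat b G H = 1 then 1 else 0)"
    by (intro sum.cong refl) (auto simp: mat_def)
  also have "\<dots> = card {G \<in> Pow {1..n}. mat a F G = 1 \<and> mat b G H = 1}"
    by (simp add: sum.inter_filter[symmetric])
  finally show ?thesis by (simp add: Pow_iff)
qed

lemma block_unique: "d \<in> diagrams n \<Longrightarrow> B \<in> d \<Longrightarrow> C \<in> d \<Longrightarrow> x \<in> B \<Longrightarrow> x \<in> C \<Longrightarrow> B = C"
  by (auto simp: diagrams_def partition_on_def disjoint_def)

lemma block_exists: "d \<in> diagrams n \<Longrightarrow> x \<in> nodes n \<Longrightarrow> \<exists>B\<in>d. x \<in> B"
  by (auto simp: diagrams_def partition_on_def)

lemma block_subset: "d \<in> diagrams n \<Longrightarrow> B \<in> d \<Longrightarrow> B \<subseteq> nodes n"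
  by (auto simp: diagrams_def partition_on_def)

lemma block_nonempty: "d \<in> diagrams n \<Longrightarrow> B \<in> d \<Longrightarrow> B \<noteq> {}"
  by (auto simp: diagrams_def partition_on_def)

lemma sat_block:
  assumes "d \<in> diagrams n" "B \<in> d"
  shows "sat B d"
  unfolding sat_def
proof
  fix C assume "C \<in> d"
  then show "C \<subseteq> B \<or> C \<inter> B = {}" using block_unique[OF assms(1) _ assms(2), of C] by auto
qed

lemma pos_node: "i \<in> {1..n} \<Longrightarrow> int i \<in> nodes n" and neg_node: "i \<in> {1..n} \<Longrightarrow> - int i \<in> nodes n"
  by (auto simp: nodes_def)

lemma permutes_image_subset: "\<sigma> permutes {1..n} \<Longrightarrow> G \<subseteq> {1..n} \<Longrightarrow> \<sigma> ` G \<subseteq> {1..n}"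
  using permutes_image by blast

lemma perm_diag_diagrams:
  assumes s: "\<sigma> permutes {1..n}"
  shows "perm_diag n \<sigma> \<in> diagrams n"
  unfolding diagrams_def mem_Collect_eq
proof (rule partition_onI)
  show "\<Union>(perm_diag n \<sigma>) = nodes n"
  proof (intro set_eqI iffI)
    fix x assume "x \<in> \<Union>(perm_diag n \<sigma>)"
    then obtain i where "i \<in> {1..n}" "x = - int (\<sigma> i) \<or> x = int i" by (auto simp: perm_diag_def)
    then show "x \<in> nodes n" using permutes_in_image[OF s, of i] pos_node neg_node by metis
  next
    fix x assume "x \<in> nodes n"
    then show "x \<in> \<Union>(perm_diag n \<sigma>)"
    proof (cases rule: nodes_cases)
      case (1 i)
      then obtain j where "j \<in> {1..n}" "\<sigma> j = i" using permutes_image[OF s] by (metis imageE)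
      then show ?thesis using 1 by (auto simp: perm_diag_def)
    next
      case (2 i)
      then show ?thesis by (auto simp: perm_diag_def)
    qed
  qed
  fix p q assume "p \<in> perm_diag n \<sigma>" "q \<in> perm_diag n \<sigma>" "p \<noteq> q"
  then obtain i j where ij: "i \<in> {1..n}" "j \<in> {1..n}" "p = {- int (\<sigma> i), int i}" "q = {- int (\<sigma> j), int j}"
    unfolding perm_diag_def by blast
  then have "i \<noteq> j" using \<open>p \<noteq> q\<close> by auto
  then have "\<sigma> i \<noteq> \<sigma> j" using permutes_inj[OF s] by (simp add: inj_eq)
  then show "disjnt p q" using ij \<open>i \<noteq> j\<close> by (auto simp: disjnt_def)
next
  show "{} \<notin> perm_diag n \<sigma>" by (auto simp: perm_diag_def)
qed

lemma is_perm_diag_perm_diag: "\<sigma> permutes {1..n} \<Longrightarrow> is_perm_diag (perm_diag n \<sigma>)"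
  unfolding is_perm_diag_def
proof
  fix B assume s: "\<sigma> permutes {1..n}" and "B \<in> perm_diag n \<sigma>"
  then obtain i where i: "i \<in> {1..n}" "B = {- int (\<sigma> i), int i}" by (auto simp: perm_diag_def)
  then have "\<sigma> i \<in> {1..n}" using permutes_in_image[OF s] by blast
  then show "\<exists>i j. i > 0 \<and> j > 0 \<and> B = {- i, j}"
    using i by (intro exI[of _ "int (\<sigma> i)"] exI[of _ "int i"]) auto
qed

lemma mat_perm_diag:
  assumes s: "\<sigma> permutes {1..n}" and FG: "F \<subseteq> {1..n}" "G \<subseteq> {1..n}"
  shows "mat (perm_diag n \<sigma>) F G = 1 \<longleftrightarrow> F = \<sigma> ` G"
proof -
  have "mat (perm_diag n \<sigma>) F G = 1 \<longleftrightarrow> (\<forall>i\<in>{1..n}. {- int (\<sigma> i), int i} \<subseteq> glue F G \<or>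
      {- int (\<sigma> i), int i} \<inter> glue F G = {})"
    unfolding mat_eq_1 sat_def perm_diag_def by simp
  also have "\<dots> \<longleftrightarrow> (\<forall>i\<in>{1..n}. \<sigma> i \<in> F \<longleftrightarrow> i \<in> G)"
    by (intro ball_cong refl) (auto simp: mem_glue_neg[OF FG] mem_glue_pos[OF FG])
  also have "\<dots> \<longleftrightarrow> F = \<sigma> ` G"
  proof
    assume a: "\<forall>i\<in>{1..n}. \<sigma> i \<in> F \<longleftrightarrow> i \<in> G"
    show "F = \<sigma> ` G"
    proof (intro set_eqI iffI)
      fix x assume x: "x \<in> F"
      then obtain i where "i \<in> {1..n}" "x = \<sigma> i" using FG permutes_image[OF s] by (metis imageE subsetD)
      then show "x \<in> \<sigma> ` G" using a x by auto
    qed (use a FG in auto)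
  next
    assume "F = \<sigma> ` G"
    then show "\<forall>i\<in>{1..n}. \<sigma> i \<in> F \<longleftrightarrow> i \<in> G" using permutes_inj[OF s] by (simp add: inj_image_mem_iff)
  qed
  finally show ?thesis .
qed

lemma perm_diag_inject:
  assumes "\<sigma> permutes {1..n}" "\<tau> permutes {1..n}" "perm_diag n \<sigma> = perm_diag n \<tau>"
  shows "\<sigma> = \<tau>"
proof
  fix i
  show "\<sigma> i = \<tau> i"
  proof (cases "i \<in> {1..n}")
    case True
    then have i: "{i} \<subseteq> {1..n}" by simp
    have "mat (perm_diag n \<sigma>) (\<sigma> ` {i}) {i} = 1"
      using mat_perm_diag[OF assms(1) permutes_image_subset[OF assms(1) i] i] by simp
    then have "\<sigma> ` {i} = \<tau> ` {i}"
      unfolding assms(3) mat_perm_diag[OF assms(2) permutes_image_subset[OF assms(1) i] i] .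
    then show ?thesis by simp
  next
    case False
    then show ?thesis using assms(1,2) by (simp add: permutes_not_in)
  qed
qed

lemma perm_of_perm_diag: "\<sigma> permutes {1..n} \<Longrightarrow> perm_of n (perm_diag n \<sigma>) = \<sigma>"
  unfolding perm_of_def by (rule the_equality) (simp, metis perm_diag_inject)

text \<open>Each right node has one left partner, and distinct right nodes have distinct partners
  because blocks are disjoint; finiteness makes this a permutation. Its diagram consists of blocks
  of \<open>d\<close> and covers all nodes, so it exhausts \<open>d\<close>.\<close>

lemma perm_diag_exists:
  assumes d: "d \<in> diagrams n" and p: "is_perm_diag d"
  shows "\<exists>\<sigma>. \<sigma> permutes {1..n} \<and> d = perm_diag n \<sigma>"
proof -
  have blk: "\<exists>i\<in>{1..n}. {- int i, int j} \<in> d" if j: "j \<in> {1..n}" for j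
  proof -
    obtain B where B: "B \<in> d" "int j \<in> B" using block_exists[OF d pos_node[OF j]] by blast
    then obtain a b where ab: "a > 0" "b > 0" "B = {- a, b}" using p unfolding is_perm_diag_def by blast
    then have "b = int j" using B(2) by auto
    moreover have "- a \<in> nodes n" using block_subset[OF d B(1)] ab by simp
    then have "nat a \<in> {1..n}" "a = int (nat a)" using ab(1) by (auto simp: nodes_def)
    ultimately show ?thesis using ab B(1) by metis
  qed
  then obtain f where f: "\<And>j. j \<in> {1..n} \<Longrightarrow> f j \<in> {1..n} \<and> {- int (f j), int j} \<in> d" by metis
  define \<sigma> where "\<sigma> j = (if j \<in> {1..n} then f j else j)" for j
  have "inj_on \<sigma> {1..n}"
  proof (rule inj_onI)
    fix i j assume ij: "i \<in> {1..n}" "j \<in> {1..n}" "\<sigma> i = \<sigma> j"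
    then have "{- int (f i), int i} = {- int (f i), int j}"
      using block_unique[OF d, of "{- int (f i), int i}" "{- int (f j), int j}" "- int (f i)"] f[of i] f[of j]
      by (simp add: \<sigma>_def)
    then show "i = j" by (auto simp: doubleton_eq_iff)
  qed
  moreover have "\<sigma> ` {1..n} \<subseteq> {1..n}" using f by (auto simp: \<sigma>_def)
  ultimately have "bij_betw \<sigma> {1..n} {1..n}"
    by (simp add: bij_betw_def endo_inj_surj)
  then have s: "\<sigma> permutes {1..n}" by (rule bij_imp_permutes) (auto simp: \<sigma>_def)
  have sub: "perm_diag n \<sigma> \<subseteq> d" using f by (auto simp: perm_diag_def \<sigma>_def)
  have "d \<subseteq> perm_diag n \<sigma>"
  proof
    fix B assume B: "B \<in> d"
    then obtain x where x: "x \<in> B" using block_nonempty[OF d] by blast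
    then have "x \<in> nodes n" using block_subset[OF d B] by blast
    then obtain C where C: "C \<in> perm_diag n \<sigma>" "x \<in> C"
      using block_exists[OF perm_diag_diagrams[OF s]] by blast
    then have "B = C" using block_unique[OF d B _ x] sub by blast
    then show "B \<in> perm_diag n \<sigma>" using C by simp
  qed
  then show ?thesis using s sub by blast
qed

lemma perm_of:
  assumes "d \<in> diagrams n" "is_perm_diag d"
  shows "perm_of n d permutes {1..n}" "perm_diag n (perm_of n d) = d"
  using perm_diag_exists[OF assms] perm_of_perm_diag by auto

text \<open>Only the middle colouring that is the image of H under \<sigma> contributes to the
  matrix product, so columns are permuted and the entry at the empty colourings leaves no room for
  loops.\<close>

lemma diag_prod_perm:
  assumes x: "x \<in> diagrams n" and s: "\<sigma> permutes {1..n}"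
  shows "loops n x (perm_diag n \<sigma>) = 0"
    and "F \<subseteq> {1..n} \<Longrightarrow> H \<subseteq> {1..n} \<Longrightarrow> mat (diag_prod n x (perm_diag n \<sigma>)) F H = mat x F (\<sigma> ` H)"
proof -
  have eq: "2 ^ loops n x (perm_diag n \<sigma>) * mat (diag_prod n x (perm_diag n \<sigma>)) F H = mat x F (\<sigma> ` H)"
    if F: "F \<subseteq> {1..n}" and H: "H \<subseteq> {1..n}" for F H
  proof -
    have "{G. G \<subseteq> {1..n} \<and> mat x F G = 1 \<and> mat (perm_diag n \<sigma>) G H = 1} =
        {G. G \<subseteq> {1..n} \<and> mat x F G = 1 \<and> G = \<sigma> ` H}"
      using mat_perm_diag[OF s _ H] by (intro Collect_cong) auto
    also have "\<dots> = (if mat x F (\<sigma> ` H) = 1 then {\<sigma> ` H} else {})"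
      using permutes_image_subset[OF s H] by auto
    finally show ?thesis
      unfolding mat_mult[OF x perm_diag_diagrams[OF s] F H, symmetric] sum_mat by (simp add: mat_def)
  qed
  show "loops n x (perm_diag n \<sigma>) = 0" using eq[of "{}" "{}"] by simp
  then show "F \<subseteq> {1..n} \<Longrightarrow> H \<subseteq> {1..n} \<Longrightarrow> mat (diag_prod n x (perm_diag n \<sigma>)) F H = mat x F (\<sigma> ` H)"
    using eq[of F H] by simp
qed

lemma diag_prod_perm_perm:
  assumes s: "\<sigma> permutes {1..n}" and t: "\<tau> permutes {1..n}"
  shows "diag_prod n (perm_diag n \<sigma>) (perm_diag n \<tau>) = perm_diag n (\<sigma> \<circ> \<tau>)"
proof (rule diagrams_eqI)
  note st = permutes_compose[OF t s]
  show "diag_prod n (perm_diag n \<sigma>) (perm_diag n \<tau>) \<in> diagrams n" "perm_diag n (\<sigma> \<circ> \<tau>) \<in> diagrams n"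
    using diag_prod_closed perm_diag_diagrams s t st by auto
  fix F G assume FG: "F \<subseteq> {1..n}" "G \<subseteq> {1..n}"
  have "mat (perm_diag n \<sigma>) F (\<tau> ` G) = 1 \<longleftrightarrow> mat (perm_diag n (\<sigma> \<circ> \<tau>)) F G = 1"
    unfolding mat_perm_diag[OF st FG] mat_perm_diag[OF s FG(1) permutes_image_subset[OF t FG(2)]]
    by (simp add: image_comp)
  then show "mat (diag_prod n (perm_diag n \<sigma>) (perm_diag n \<tau>)) F G = mat (perm_diag n (\<sigma> \<circ> \<tau>)) F G"
    unfolding diag_prod_perm(2)[OF perm_diag_diagrams[OF s] t FG] by (auto simp: mat_def split: if_splits)
qed

lemma diag_prod_id:
  assumes x: "x \<in> diagrams n"
  shows "diag_prod n x (perm_diag n id) = x"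
  by (rule diagrams_eqI[OF diag_prod_closed[OF x perm_diag_diagrams[OF permutes_id]] x])
    (simp add: diag_prod_perm(2)[OF x permutes_id])

text \<open>A criterion on the relation between colourings. A block with nodes on one side only
  would relate the empty colouring to a non-empty one. For a block containing the right node j, a
  left colouring related to the set of j alone confines its right nodes to j; likewise on the
  left.\<close>

lemma is_perm_diagI:
  assumes d: "d \<in> diagrams n"
    and ex: "\<And>G. G \<subseteq> {1..n} \<Longrightarrow> \<exists>F\<subseteq>{1..n}. mat d F G = 1" "\<And>F. F \<subseteq> {1..n} \<Longrightarrow> \<exists>G\<subseteq>{1..n}. mat d F G = 1"
    and un: "\<And>F. F \<subseteq> {1..n} \<Longrightarrow> mat d F {} = 1 \<Longrightarrow> F = {}" "\<And>G. G \<subseteq> {1..n} \<Longrightarrow> mat d {} G = 1 \<Longrightarrow> G = {}"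
  shows "is_perm_diag d"
  unfolding is_perm_diag_def
proof
  fix B assume B: "B \<in> d"
  obtain F G where FG: "F \<subseteq> {1..n}" "G \<subseteq> {1..n}" "B = glue F G"
    using subset_nodes_glue[OF block_subset[OF d B]] by blast
  have m: "mat d F G = 1" unfolding mat_eq_1 FG(3)[symmetric] by (rule sat_block[OF d B])
  have ne: "F \<noteq> {} \<or> G \<noteq> {}" using block_nonempty[OF d B] by (auto simp: FG(3) glue_def)
  have "F \<noteq> {}" using un(2)[OF FG(2)] m ne by auto
  moreover have "G \<noteq> {}" using un(1)[OF FG(1)] m ne by auto
  ultimately obtain i j where i: "i \<in> F" and j: "j \<in> G" by blast
  have "G = {j}"
  proof -
    have jn: "{j} \<subseteq> {1..n}" using j FG(2) by blast
    obtain F' where F': "F' \<subseteq> {1..n}" "mat d F' {j} = 1" using ex(1)[OF jn] by blast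
    have "int j \<in> glue F' {j}" "int j \<in> B"
      using j by (simp_all add: FG(3) mem_glue_pos[OF F'(1) jn] mem_glue_pos[OF FG(1,2)])
    then have "B \<subseteq> glue F' {j}" using F'(2) B unfolding mat_eq_1 sat_def by blast
    have "k = j" if k: "k \<in> G" for k
    proof -
      have "int k \<in> B" using k by (simp add: FG(3) mem_glue_pos[OF FG(1,2)])
      then have "int k \<in> glue F' {j}" using \<open>B \<subseteq> glue F' {j}\<close> by blast
      then show ?thesis by (simp add: mem_glue_pos[OF F'(1) jn])
    qed
    then show ?thesis using j by blast
  qed
  moreover have "F = {i}"
  proof -
    have iN: "{i} \<subseteq> {1..n}" using i FG(1) by blast
    obtain G' where G': "G' \<subseteq> {1..n}" "mat d {i} G' = 1" using ex(2)[OF iN] by blast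
    have "- int i \<in> glue {i} G'" "- int i \<in> B"
      using i by (simp_all add: FG(3) mem_glue_neg[OF iN G'(1)] mem_glue_neg[OF FG(1,2)])
    then have "B \<subseteq> glue {i} G'" using G'(2) B unfolding mat_eq_1 sat_def by blast
    have "k = i" if k: "k \<in> F" for k
    proof -
      have "- int k \<in> B" using k by (simp add: FG(3) mem_glue_neg[OF FG(1,2)])
      then have "- int k \<in> glue {i} G'" using \<open>B \<subseteq> glue {i} G'\<close> by blast
      then show ?thesis by (simp add: mem_glue_neg[OF iN G'(1)])
    qed
    then show ?thesis using i by blast
  qed
  ultimately have "B = {- int i, int j}" by (auto simp: FG(3) glue_def)
  moreover have "int i > 0" "int j > 0" using i j FG(1,2) by auto
  ultimately show "\<exists>i j. i > 0 \<and> j > 0 \<and> B = {- i, j}" by blast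
qed

text \<open>If a composite on a finite set is the graph of a bijection, neither factor can branch: a
  choice \<open>g\<close> of intermediate points is injective since F is recovered from
  \<open>g F\<close>, hence onto, and a further pair in either relation would give the composite a
  second value.\<close>

lemma relation_comp_bij:
  assumes X: "finite X" and b: "bij_betw \<beta> X X"
    and comp: "\<And>F H. F \<in> X \<Longrightarrow> H \<in> X \<Longrightarrow> (\<exists>G\<in>X. R F G \<and> S G H) \<longleftrightarrow> F = \<beta> H"
  shows "\<exists>g. bij_betw g X X \<and> (\<forall>F\<in>X. \<forall>G\<in>X. R F G \<longleftrightarrow> G = g F) \<and> (\<forall>G\<in>X. \<forall>H\<in>X. S G H \<longleftrightarrow> G = g (\<beta> H))"
proof -
  have "\<exists>G\<in>X. \<exists>H\<in>X. F = \<beta> H \<and> R F G \<and> S G H" if F: "F \<in> X" for F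
  proof -
    obtain H where H: "H \<in> X" "F = \<beta> H" using b F by (metis bij_betw_imp_surj_on imageE)
    then show ?thesis using comp[OF F H(1)] by blast
  qed
  then obtain g h where gh: "\<And>F. F \<in> X \<Longrightarrow> g F \<in> X \<and> h F \<in> X \<and> F = \<beta> (h F) \<and> R F (g F) \<and> S (g F) (h F)"
    by metis
  have "inj_on g X"
  proof (rule inj_onI)
    fix F F' assume F: "F \<in> X" "F' \<in> X" "g F = g F'"
    then have "R F (g F)" "S (g F) (h F')" "g F \<in> X" "h F' \<in> X" using gh[of F] gh[of F'] by auto
    then have "F = \<beta> (h F')" using comp F(1) by blast
    then show "F = F'" using gh[OF F(2)] by simp
  qed
  moreover have "g ` X \<subseteq> X" using gh by blast
  ultimately have bij: "bij_betw g X X" using endo_inj_surj[OF X] by (simp add: bij_betw_def)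
  have pre: "\<exists>F\<in>X. G = g F" if "G \<in> X" for G using bij that by (metis bij_betw_imp_surj_on imageE)
  have "R F G \<longleftrightarrow> G = g F" if F: "F \<in> X" and G: "G \<in> X" for F G
  proof
    assume R: "R F G"
    obtain F' where F': "F' \<in> X" "G = g F'" using pre[OF G] by blast
    then have "F = \<beta> (h F')" using comp[OF F, of "h F'"] gh[of F'] R G by blast
    then show "G = g F" using F' gh[of F'] by simp
  qed (use gh[OF F] in simp)
  moreover have "S G H \<longleftrightarrow> G = g (\<beta> H)" if G: "G \<in> X" and H: "H \<in> X" for G H
  proof
    assume S: "S G H"
    obtain F' where F': "F' \<in> X" "G = g F'" using pre[OF G] by blast
    then have "F' = \<beta> H" using comp[OF F'(1) H] gh[of F'] S G by blast
    then show "G = g (\<beta> H)" using F' by simp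
  next
    assume G': "G = g (\<beta> H)"
    have bH: "\<beta> H \<in> X" using b H by (meson bij_betwE)
    have "h (\<beta> H) = H" using gh[OF bH] b H by (metis bij_betw_imp_inj_on inj_onD)
    then show "S G H" using gh[OF bH] G' by simp
  qed
  ultimately show ?thesis using bij by blast
qed

text \<open>The substantial direction is that a permutation diagram has only permutation factors.
  Its relation is a bijection on colourings, so by \<open>relation_comp_bij\<close> both factors are
  bijections, and they match the empty colouring with itself; \<open>is_perm_diagI\<close> asks for
  no more.\<close>

lemma is_perm_diag_mult:
  assumes d: "d1 \<in> diagrams n" "d2 \<in> diagrams n"
  shows "is_perm_diag (diag_prod n d1 d2) \<longleftrightarrow> is_perm_diag d1 \<and> is_perm_diag d2"
proof
  assume "is_perm_diag d1 \<and> is_perm_diag d2"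
  then obtain \<sigma> \<tau> where "\<sigma> permutes {1..n}" "d1 = perm_diag n \<sigma>" "\<tau> permutes {1..n}" "d2 = perm_diag n \<tau>"
    using perm_diag_exists[OF d(1)] perm_diag_exists[OF d(2)] by blast
  then show "is_perm_diag (diag_prod n d1 d2)"
    using diag_prod_perm_perm is_perm_diag_perm_diag permutes_compose by metis
next
  assume p: "is_perm_diag (diag_prod n d1 d2)"
  obtain \<sigma> where s: "\<sigma> permutes {1..n}" and prod: "diag_prod n d1 d2 = perm_diag n \<sigma>"
    using perm_diag_exists[OF diag_prod_closed[OF d] p] by blast
  let ?X = "Pow {1..n}"
  have b: "bij_betw ((`) \<sigma>) ?X ?X"
    using permutes_imp_bij[OF s] by (rule bij_betw_Pow)
  have "\<exists>g. bij_betw g ?X ?X \<and> (\<forall>F\<in>?X. \<forall>G\<in>?X. mat d1 F G = 1 \<longleftrightarrow> G = g F) \<and>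
      (\<forall>G\<in>?X. \<forall>H\<in>?X. mat d2 G H = 1 \<longleftrightarrow> G = g (\<sigma> ` H))"
  proof (rule relation_comp_bij[OF _ b])
    fix F H assume "F \<in> ?X" "H \<in> ?X"
    then have FH: "F \<subseteq> {1..n}" "H \<subseteq> {1..n}" by auto
    show "(\<exists>G\<in>?X. mat d1 F G = 1 \<and> mat d2 G H = 1) \<longleftrightarrow> F = \<sigma> ` H"
      using mat_diag_prod_pos[OF d FH] unfolding prod mat_perm_diag[OF s FH] by (simp add: Bex_def)
  qed simp
  then obtain g where g: "bij_betw g ?X ?X"
    and g12: "\<forall>F\<in>?X. \<forall>G\<in>?X. mat d1 F G = 1 \<longleftrightarrow> G = g F" "\<forall>G\<in>?X. \<forall>H\<in>?X. mat d2 G H = 1 \<longleftrightarrow> G = g (\<sigma> ` H)"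
    by (elim exE conjE)
  have g1: "\<And>F G. F \<subseteq> {1..n} \<Longrightarrow> G \<subseteq> {1..n} \<Longrightarrow> mat d1 F G = 1 \<longleftrightarrow> G = g F"
    using g12(1) by (simp only: Pow_iff Ball_def)
  have g2: "\<And>G H. G \<subseteq> {1..n} \<Longrightarrow> H \<subseteq> {1..n} \<Longrightarrow> mat d2 G H = 1 \<longleftrightarrow> G = g (\<sigma> ` H)"
    using g12(2) by (simp only: Pow_iff Ball_def)
  have g0: "g {} = {}" using g1[of "{}" "{}"] by simp
  have gs: "g F \<subseteq> {1..n}" if "F \<subseteq> {1..n}" for F using bij_betwE[OF g] that by simp
  have gi: "F = F'" if "g F = g F'" "F \<subseteq> {1..n}" "F' \<subseteq> {1..n}" for F F'
    using bij_betw_imp_inj_on[OF g] that by (auto simp: inj_on_def)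
  have gsurj: "\<exists>F\<subseteq>{1..n}. G = g F" if "G \<subseteq> {1..n}" for G
    using bij_betw_imp_surj_on[OF g] that by (metis Pow_iff imageE)
  have ssurj: "\<exists>H\<subseteq>{1..n}. F = \<sigma> ` H" if "F \<subseteq> {1..n}" for F
    using bij_betw_imp_surj_on[OF b] that by (metis Pow_iff imageE)
  have "is_perm_diag d1"
  proof (rule is_perm_diagI[OF d(1)])
    show "\<exists>F\<subseteq>{1..n}. mat d1 F G = 1" if "G \<subseteq> {1..n}" for G using gsurj[OF that] g1 that by blast
    show "\<exists>G\<subseteq>{1..n}. mat d1 F G = 1" if "F \<subseteq> {1..n}" for F using gs[OF that] g1[OF that] by blast
    show "F = {}" if "F \<subseteq> {1..n}" "mat d1 F {} = 1" for F
      using g1[OF that(1), of "{}"] that gi[of F "{}"] g0 by simp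
    show "G = {}" if "G \<subseteq> {1..n}" "mat d1 {} G = 1" for G
      using g1[of "{}" G] that g0 by simp
  qed
  moreover have "is_perm_diag d2"
  proof (rule is_perm_diagI[OF d(2)])
    show "\<exists>F\<subseteq>{1..n}. mat d2 F G = 1" if G: "G \<subseteq> {1..n}" for G
      using g2[OF gs[OF permutes_image_subset[OF s G]] G] gs[OF permutes_image_subset[OF s G]] by blast
    show "\<exists>G\<subseteq>{1..n}. mat d2 F G = 1" if F: "F \<subseteq> {1..n}" for F
    proof -
      obtain F' where F': "F' \<subseteq> {1..n}" "F = g F'" using gsurj[OF F] by blast
      obtain H where "H \<subseteq> {1..n}" "F' = \<sigma> ` H" using ssurj[OF F'(1)] by blast
      then show ?thesis using g2[OF F] F' by blast
    qed
    show "F = {}" if "F \<subseteq> {1..n}" "mat d2 F {} = 1" for F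
      using g2[OF that(1), of "{}"] that g0 by simp
    show "G = {}" if G: "G \<subseteq> {1..n}" "mat d2 {} G = 1" for G
      using g2[of "{}" G] that g0 gi[of "\<sigma> ` G" "{}"] permutes_image_subset[OF s G(1)] by simp
  qed
  ultimately show "is_perm_diag d1 \<and> is_perm_diag d2" ..
qed

section \<open>Singleton and connected right nodes\<close>

text \<open>The right node i is a singleton block of x, respectively the right nodes i and j lie in the same
  block of x, expressed by the matrix of x so that invariance under left multiplication is immediate.\<close>
definition sing :: "nat \<Rightarrow> nat \<Rightarrow> int set set \<Rightarrow> bool" where
  "sing n i x \<longleftrightarrow> (\<forall>F G. F \<subseteq> {1..n} \<longrightarrow> G \<subseteq> {1..n} \<longrightarrow> mat x F G = 1 \<longrightarrow>
     mat x F (insert i G) = 1 \<and> mat x F (G - {i}) = 1)"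

definition conn :: "nat \<Rightarrow> nat \<Rightarrow> nat \<Rightarrow> int set set \<Rightarrow> bool" where
  "conn n i j x \<longleftrightarrow> (\<forall>F G. F \<subseteq> {1..n} \<longrightarrow> G \<subseteq> {1..n} \<longrightarrow> mat x F G = 1 \<longrightarrow> (i \<in> G \<longleftrightarrow> j \<in> G))"

lemma sing_mult:
  assumes d: "a \<in> diagrams n" "x \<in> diagrams n" and i: "i \<in> {1..n}" and s: "sing n i x"
  shows "sing n i (diag_prod n a x)"
  unfolding sing_def
proof (intro allI impI)
  fix F H assume FH: "F \<subseteq> {1..n}" "H \<subseteq> {1..n}" and "mat (diag_prod n a x) F H = 1"
  then obtain G where G: "G \<subseteq> {1..n}" "mat a F G = 1" "mat x G H = 1"
    using mat_diag_prod_pos[OF d FH] by blast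
  have H': "insert i H \<subseteq> {1..n}" "H - {i} \<subseteq> {1..n}" using FH(2) i by auto
  have "mat x G (insert i H) = 1" "mat x G (H - {i}) = 1" using s G FH(2) unfolding sing_def by blast+
  then show "mat (diag_prod n a x) F (insert i H) = 1 \<and> mat (diag_prod n a x) F (H - {i}) = 1"
    using mat_diag_prod_pos[OF d FH(1) H'(1)] mat_diag_prod_pos[OF d FH(1) H'(2)] G by blast
qed

lemma conn_mult:
  assumes d: "a \<in> diagrams n" "x \<in> diagrams n" and c: "conn n i j x"
  shows "conn n i j (diag_prod n a x)"
  unfolding conn_def
proof (intro allI impI)
  fix F H assume FH: "F \<subseteq> {1..n}" "H \<subseteq> {1..n}" and "mat (diag_prod n a x) F H = 1"
  then obtain G where "G \<subseteq> {1..n}" "mat x G H = 1"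
    using mat_diag_prod_pos[OF d FH] by blast
  then show "i \<in> H \<longleftrightarrow> j \<in> H" using c FH(2) unfolding conn_def by blast
qed

lemma sing_union_diff:
  assumes F: "F \<subseteq> {1..n}" and "finite T" "T \<subseteq> {1..n}" "\<And>i. i \<in> T \<Longrightarrow> sing n i x"
    and "G \<subseteq> {1..n}" "mat x F G = 1"
  shows "mat x F (G \<union> T) = 1 \<and> mat x F (G - T) = 1"
  using assms(2-4)
proof (induction T rule: finite_induct)
  case empty
  then show ?case using assms(6) by simp
next
  case (insert i T)
  then have IH: "mat x F (G \<union> T) = 1" "mat x F (G - T) = 1" and i: "sing n i x" by auto
  have "G \<union> T \<subseteq> {1..n}" "G - T \<subseteq> {1..n}" using insert.prems assms(5) by auto
  then have "mat x F (insert i (G \<union> T)) = 1" "mat x F (G - T - {i}) = 1"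
    using i F IH unfolding sing_def by blast+
  then show ?case by (metis Diff_insert Un_insert_right)
qed

text \<open>Singleton nodes may be recoloured at will: those of T outside H are switched off, those
  of T in H switched on, and outside T the colourings agree.\<close>

lemma sing_change:
  assumes F: "F \<subseteq> {1..n}" and T: "T \<subseteq> {1..n}" "\<And>i. i \<in> T \<Longrightarrow> sing n i x"
    and G: "G \<subseteq> {1..n}" "mat x F G = 1" and H: "G - T = H - T"
  shows "mat x F H = 1"
proof -
  have fin: "finite (T - H)" "finite (T \<inter> H)" using T(1) finite_subset by blast+
  have "mat x F (G - (T - H)) = 1"
    using sing_union_diff[OF F fin(1) _ _ G] T by blast
  then have "mat x F (G - (T - H) \<union> (T \<inter> H)) = 1"
    using sing_union_diff[OF F fin(2), of x "G - (T - H)"] T G(1) by blast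
  moreover have "G - (T - H) \<union> (T \<inter> H) = H" using H by blast
  ultimately show ?thesis by simp
qed

lemma glue_insert: "glue F (insert i G) = insert (int i) (glue F G)"
  by (auto simp: glue_def)

lemma glue_Diff: "F \<subseteq> {1..n} \<Longrightarrow> G \<subseteq> {1..n} \<Longrightarrow> i \<in> {1..n} \<Longrightarrow> glue F (G - {i}) = glue F G - {int i}"
  by (auto simp: glue_def)

lemma sing_block:
  assumes x: "x \<in> diagrams n" and i: "i \<in> {1..n}" "{int i} \<in> x"
  shows "sing n i x"
  unfolding sing_def
proof (intro allI impI)
  fix F G assume FG: "F \<subseteq> {1..n}" "G \<subseteq> {1..n}" "mat x F G = 1"
  have "sat (insert (int i) (glue F G)) x \<and> sat (glue F G - {int i}) x"
    unfolding sat_def ball_conj_distrib[symmetric]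
  proof
    fix B assume B: "B \<in> x"
    have "B \<subseteq> glue F G \<or> B \<inter> glue F G = {}" using FG(3) B unfolding mat_eq_1 sat_def by blast
    moreover have "B = {int i} \<or> int i \<notin> B" using block_unique[OF x B i(2)] by blast
    ultimately show "(B \<subseteq> insert (int i) (glue F G) \<or> B \<inter> insert (int i) (glue F G) = {}) \<and>
       (B \<subseteq> glue F G - {int i} \<or> B \<inter> (glue F G - {int i}) = {})" by blast
  qed
  then show "mat x F (insert i G) = 1 \<and> mat x F (G - {i}) = 1"
    unfolding mat_eq_1 glue_insert glue_Diff[OF FG(1,2) i(1)] .
qed

lemma conn_block:
  assumes "B \<in> x" "int i \<in> B" "int j \<in> B"
  shows "conn n i j x"
  unfolding conn_def
proof (intro allI impI)
  fix F G assume FG: "F \<subseteq> {1..n}" "G \<subseteq> {1..n}" "mat x F G = 1"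
  then have "int i \<in> glue F G \<longleftrightarrow> int j \<in> glue F G" using assms unfolding mat_eq_1 sat_def by blast
  then show "i \<in> G \<longleftrightarrow> j \<in> G" by (simp add: mem_glue_pos[OF FG(1,2)])
qed

text \<open>Colouring the singleton i alone respects the diagram and separates i from every other
  node.\<close>

lemma sing_not_conn: "sing n i x \<Longrightarrow> i \<noteq> j \<Longrightarrow> i \<in> {1..n} \<Longrightarrow> \<not> conn n i j x \<and> \<not> conn n j i x"
proof -
  assume s: "sing n i x" and ij: "i \<noteq> j" "i \<in> {1..n}"
  have "mat x {} {i} = 1" using s mat_empty[of x] unfolding sing_def by blast
  then show ?thesis using ij unfolding conn_def by blast
qed

lemma not_sing_perm: "x \<in> diagrams n \<Longrightarrow> is_perm_diag x \<Longrightarrow> i \<in> {1..n} \<Longrightarrow> \<not> sing n i x"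
proof
  assume x: "x \<in> diagrams n" "is_perm_diag x" and i: "i \<in> {1..n}" and s: "sing n i x"
  obtain \<sigma> where sg: "\<sigma> permutes {1..n}" "x = perm_diag n \<sigma>" using perm_diag_exists[OF x] by blast
  have "mat x {} {i} = 1" using s mat_empty[of x] unfolding sing_def by blast
  then show False using mat_perm_diag[OF sg(1), of "{}" "{i}"] i sg(2) by simp
qed

lemma not_conn_perm:
  assumes x: "x \<in> diagrams n" "is_perm_diag x" and ij: "i \<in> {1..n}" "i \<noteq> j"
  shows "\<not> conn n i j x"
proof
  assume c: "conn n i j x"
  obtain \<sigma> where sg: "\<sigma> permutes {1..n}" "x = perm_diag n \<sigma>" using perm_diag_exists[OF x] by blast
  have sub: "\<sigma> ` {i} \<subseteq> {1..n}" "{i} \<subseteq> {1..n}" using permutes_image_subset[OF sg(1), of "{i}"] ij by auto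
  have "mat x (\<sigma> ` {i}) {i} = 1" using mat_perm_diag[OF sg(1) sub] sg(2) by simp
  then show False using c sub ij(2) unfolding conn_def by blast
qed

lemma sing_perm:
  assumes x: "x \<in> diagrams n" and s: "\<sigma> permutes {1..n}" and i: "i \<in> {1..n}" "sing n (\<sigma> i) x"
  shows "sing n i (diag_prod n x (perm_diag n \<sigma>))"
  unfolding sing_def
proof (intro allI impI)
  fix F H assume FH: "F \<subseteq> {1..n}" "H \<subseteq> {1..n}" and m: "mat (diag_prod n x (perm_diag n \<sigma>)) F H = 1"
  have H': "insert i H \<subseteq> {1..n}" "H - {i} \<subseteq> {1..n}" using FH(2) i by auto
  have "mat x F (\<sigma> ` H) = 1" using m diag_prod_perm(2)[OF x s FH] by simp
  then have "mat x F (insert (\<sigma> i) (\<sigma> ` H)) = 1 \<and> mat x F (\<sigma> ` H - {\<sigma> i}) = 1"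
    using i(2) FH(1) permutes_image_subset[OF s FH(2)] unfolding sing_def by blast
  moreover have "\<sigma> ` (H - {i}) = \<sigma> ` H - {\<sigma> i}"
    using permutes_inj[OF s] by (simp add: image_set_diff)
  ultimately show "mat (diag_prod n x (perm_diag n \<sigma>)) F (insert i H) = 1 \<and>
      mat (diag_prod n x (perm_diag n \<sigma>)) F (H - {i}) = 1"
    using diag_prod_perm(2)[OF x s FH(1) H'(1)] diag_prod_perm(2)[OF x s FH(1) H'(2)] by simp
qed

lemma conn_perm:
  assumes x: "x \<in> diagrams n" and s: "\<sigma> permutes {1..n}" and c: "conn n (\<sigma> i) (\<sigma> j) x"
  shows "conn n i j (diag_prod n x (perm_diag n \<sigma>))"
  unfolding conn_def
proof (intro allI impI)
  fix F H assume FH: "F \<subseteq> {1..n}" "H \<subseteq> {1..n}" and m: "mat (diag_prod n x (perm_diag n \<sigma>)) F H = 1"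
  have "mat x F (\<sigma> ` H) = 1" using m diag_prod_perm(2)[OF x s FH] by simp
  then have "\<sigma> i \<in> \<sigma> ` H \<longleftrightarrow> \<sigma> j \<in> \<sigma> ` H"
    using c FH(1) permutes_image_subset[OF s FH(2)] unfolding conn_def by blast
  then show "i \<in> H \<longleftrightarrow> j \<in> H" using permutes_inj[OF s] by (simp add: inj_image_mem_iff)
qed

section \<open>Diagrams given by generating edges, and the right units of the strata\<close>

definition diag_of :: "nat \<Rightarrow> (int \<times> int) set \<Rightarrow> int set set" where
  "diag_of n r = nodes n // ((r \<union> r\<inverse>)\<^sup>*)"

lemma diag_of:
  assumes r: "r \<subseteq> nodes n \<times> nodes n"
  shows "diag_of n r \<in> diagrams n"
    and "mat (diag_of n r) F G = 1 \<longleftrightarrow> (\<forall>(x, y)\<in>r. x \<in> glue F G \<longleftrightarrow> y \<in> glue F G)"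
proof -
  have E: "r \<union> r\<inverse> \<subseteq> nodes n \<times> nodes n" "sym (r \<union> r\<inverse>)"
    using r by (auto simp: sym_def)
  show "diag_of n r \<in> diagrams n"
    unfolding diag_of_def diagrams_def using partition_on_quotient_rtrancl[OF E] by simp
  show "mat (diag_of n r) F G = 1 \<longleftrightarrow> (\<forall>(x, y)\<in>r. x \<in> glue F G \<longleftrightarrow> y \<in> glue F G)"
    unfolding diag_of_def mat_eq_1 sat_quotient_rtrancl[OF E] by auto
qed

text \<open>The right units of the strata: the identity with the strands in T cut, right nodes tied
  along \<rho>, and the left ends in Z of cut strands tied to the right node 1. With Z empty the
  left ends are isolated and may close loops; with Z = T and 1 outside T they hang on the strand of
  node 1 instead.\<close>

definition near_id :: "nat \<Rightarrow> nat set \<Rightarrow> (nat \<times> nat) set \<Rightarrow> nat set \<Rightarrow> int set set" where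
  "near_id n T \<rho> Z = diag_of n ((\<lambda>k. (- int k, int k)) ` ({1..n} - T) \<union> (\<lambda>(i, j). (int i, int j)) ` \<rho>
     \<union> (\<lambda>t. (- int t, 1)) ` Z)"

lemma near_id:
  assumes T: "T \<subseteq> {1..n}" and \<rho>: "\<rho> \<subseteq> {1..n} \<times> {1..n}" and Z: "Z \<subseteq> T"
  shows "near_id n T \<rho> Z \<in> diagrams n"
    and "G \<subseteq> {1..n} \<Longrightarrow> H \<subseteq> {1..n} \<Longrightarrow> mat (near_id n T \<rho> Z) G H = 1 \<longleftrightarrow>
      G - T = H - T \<and> (\<forall>(i, j)\<in>\<rho>. i \<in> H \<longleftrightarrow> j \<in> H) \<and> (\<forall>t\<in>Z. t \<in> G \<longleftrightarrow> 1 \<in> H)"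
proof -
  let ?r = "(\<lambda>k. (- int k, int k)) ` ({1..n} - T) \<union> (\<lambda>(i, j). (int i, int j)) ` \<rho> \<union> (\<lambda>t. (- int t, 1)) ` Z"
  have r: "?r \<subseteq> nodes n \<times> nodes n"
    using T \<rho> Z by (auto simp: nodes_def)
  show "near_id n T \<rho> Z \<in> diagrams n" unfolding near_id_def by (rule diag_of(1)[OF r])
  assume GH: "G \<subseteq> {1..n}" "H \<subseteq> {1..n}"
  have one: "1 \<in> glue G H \<longleftrightarrow> 1 \<in> H" using mem_glue_pos[OF GH, of 1] by simp
  have "mat (near_id n T \<rho> Z) G H = 1 \<longleftrightarrow> (\<forall>k\<in>{1..n} - T. k \<in> G \<longleftrightarrow> k \<in> H) \<and>
      (\<forall>(i, j)\<in>\<rho>. i \<in> H \<longleftrightarrow> j \<in> H) \<and> (\<forall>t\<in>Z. t \<in> G \<longleftrightarrow> 1 \<in> H)"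
    unfolding near_id_def diag_of(2)[OF r] ball_Un
    by (simp add: mem_glue_pos[OF GH] mem_glue_neg[OF GH] one case_prod_beta)
  also have "(\<forall>k\<in>{1..n} - T. k \<in> G \<longleftrightarrow> k \<in> H) \<longleftrightarrow> G - T = H - T" using GH by blast
  finally show "mat (near_id n T \<rho> Z) G H = 1 \<longleftrightarrow>
      G - T = H - T \<and> (\<forall>(i, j)\<in>\<rho>. i \<in> H \<longleftrightarrow> j \<in> H) \<and> (\<forall>t\<in>Z. t \<in> G \<longleftrightarrow> 1 \<in> H)" .
qed

lemma pair_block:
  assumes d: "d \<in> diagrams n" and x: "x \<in> nodes n" and s: "sat {x, y} d"
    and xy: "\<And>S. S \<subseteq> nodes n \<Longrightarrow> sat S d \<Longrightarrow> x \<in> S \<Longrightarrow> y \<in> S"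
  shows "{x, y} \<in> d"
proof -
  obtain B where B: "B \<in> d" "x \<in> B" using block_exists[OF d x] by blast
  then have "B \<subseteq> {x, y}" using s unfolding sat_def by blast
  moreover have "y \<in> B" by (rule xy[OF block_subset[OF d B(1)] sat_block[OF d B(1)] B(2)])
  ultimately have "B = {x, y}" using B(2) by blast
  then show ?thesis using B(1) by simp
qed

lemma near_id_block:
  assumes T: "T \<subseteq> {1..n}" and \<rho>: "\<rho> \<subseteq> {1..n} \<times> {1..n}"
    and k: "k \<in> {1..n}" "k \<notin> T" "k \<notin> fst ` \<rho>" "k \<notin> snd ` \<rho>"
  shows "{- int k, int k} \<in> near_id n T \<rho> {}"
proof (rule pair_block)
  show "near_id n T \<rho> {} \<in> diagrams n" by (rule near_id(1)[OF T \<rho>]) simp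
  show "- int k \<in> nodes n" using k by (auto simp: nodes_def)
  have "mat (near_id n T \<rho> {}) {k} {k} = 1"
    using near_id(2)[OF T \<rho>, of "{}" "{k}" "{k}"] k by force
  moreover have "glue {k} {k} = {- int k, int k}" by (auto simp: glue_def)
  ultimately show "sat {- int k, int k} (near_id n T \<rho> {})" by (simp only: mat_eq_1)
  fix S assume S: "S \<subseteq> nodes n" "sat S (near_id n T \<rho> {})" "- int k \<in> S"
  obtain F G where FG: "F \<subseteq> {1..n}" "G \<subseteq> {1..n}" "S = glue F G" using subset_nodes_glue[OF S(1)] by blast
  have "F - T = G - T"
    using near_id(2)[OF T \<rho>, of "{}" F G] FG S(2) by (simp only: mat_eq_1 empty_subsetI)
  moreover have "k \<in> F" using S(3) by (simp add: FG(3) mem_glue_neg[OF FG(1,2)])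
  ultimately have "k \<in> G" using k(2) by blast
  then show "int k \<in> S" by (simp add: FG(3) mem_glue_pos[OF FG(1,2)])
qed

text \<open>Since the nodes of T are singletons of \<open>x\<close>, the middle colouring is
  arbitrary on T and agrees with H elsewhere, so 2 to the power \<open>card T\<close> terms survive.
  The ties along \<rho> impose nothing new on colourings that \<open>x\<close> admits.\<close>

lemma near_id_mult:
  assumes x: "x \<in> diagrams n" and T: "T \<subseteq> {1..n}" "\<And>t. t \<in> T \<Longrightarrow> sing n t x"
    and \<rho>: "\<rho> \<subseteq> {1..n} \<times> {1..n}" "\<And>i j. (i, j) \<in> \<rho> \<Longrightarrow> conn n i j x"
  shows "diag_prod n x (near_id n T \<rho> {}) = x \<and> loops n x (near_id n T \<rho> {}) = card T"
proof (rule diag_prod_eqI[OF x near_id(1)[OF T(1) \<rho>(1)] x])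
  fix F H assume F: "F \<subseteq> {1..n}" and H: "H \<subseteq> {1..n}"
  let ?S = "{G. G \<subseteq> {1..n} \<and> mat x F G = 1 \<and> mat (near_id n T \<rho> {}) G H = 1}"
  show "(\<Sum>G\<in>Pow {1..n}. mat x F G * mat (near_id n T \<rho> {}) G H) = 2 ^ card T * mat x F H"
  proof (cases "mat x F H = 1")
    case True
    have rho: "\<forall>(i, j)\<in>\<rho>. i \<in> H \<longleftrightarrow> j \<in> H" using \<rho>(2) True F H unfolding conn_def by blast
    \<comment> \<open>A middle colouring is determined by its part in T; the rest is copied from
      H.\<close>
    have "bij_betw (\<lambda>G. G \<inter> T) ?S (Pow T)"
    proof (rule bij_betw_byWitness[where f' = "\<lambda>K. (H - T) \<union> K"])
      have m: "mat (near_id n T \<rho> {}) G H = 1 \<longleftrightarrow> G - T = H - T" if "G \<subseteq> {1..n}" for G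
        using near_id(2)[OF T(1) \<rho>(1) empty_subsetI that H] rho by simp
      show "\<forall>G\<in>?S. (H - T) \<union> (G \<inter> T) = G" using m by blast
      show "\<forall>K\<in>Pow T. ((H - T) \<union> K) \<inter> T = K" by blast
      show "(\<lambda>G. G \<inter> T) ` ?S \<subseteq> Pow T" by blast
      show "(\<lambda>K. (H - T) \<union> K) ` Pow T \<subseteq> ?S"
      proof clarify
        fix K assume K: "K \<subseteq> T"
        have sub: "(H - T) \<union> K \<subseteq> {1..n}" using H K T(1) by blast
        have eq: "H - T = ((H - T) \<union> K) - T" using K by blast
        show "(H - T) \<union> K \<subseteq> {1..n} \<and> mat x F ((H - T) \<union> K) = 1 \<and> mat (near_id n T \<rho> {}) ((H - T) \<union> K) H = 1"
          using sub m[OF sub] eq sing_change[OF F T H True eq] by simp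
      qed
    qed
    then have "card ?S = card (Pow T)" by (rule bij_betw_same_card)
    also have "\<dots> = 2 ^ card T" using finite_subset[OF T(1)] by (simp add: card_Pow)
    finally show ?thesis unfolding sum_mat using True by simp
  next
    case False
    then have zero: "mat x F H = 0" using mat_01(2)[of x F H] by blast
    have "?S = {}"
    proof (rule ccontr)
      assume "?S \<noteq> {}"
      then obtain G where G: "G \<subseteq> {1..n}" "mat x F G = 1" "mat (near_id n T \<rho> {}) G H = 1" by blast
      then have "G - T = H - T" using near_id(2)[OF T(1) \<rho>(1) empty_subsetI G(1) H] by simp
      then show False using sing_change[OF F T G(1,2)] False by blast
    qed
    then show ?thesis unfolding sum_mat zero by (simp only: card.empty mult_zero_right)
  qed
qed simp

text \<open>Each cut left end takes the colour of node 1, so the middle colouring is forced and no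
  loop can form. Attaching singletons of \<open>x\<close> to node 1 does not change the partition of
  the outer nodes.\<close>

lemma near_id_mult_link:
  assumes x: "x \<in> diagrams n" and T: "T \<subseteq> {1..n}" "\<And>t. t \<in> T \<Longrightarrow> sing n t x" "1 \<notin> T"
    and \<rho>: "\<rho> \<subseteq> {1..n} \<times> {1..n}" "\<And>i j. (i, j) \<in> \<rho> \<Longrightarrow> conn n i j x"
  shows "diag_prod n x (near_id n T \<rho> T) = x \<and> loops n x (near_id n T \<rho> T) = 0"
proof (rule diag_prod_eqI[OF x near_id(1)[OF T(1) \<rho>(1)] x])
  fix F H assume F: "F \<subseteq> {1..n}" and H: "H \<subseteq> {1..n}"
  let ?S = "{G. G \<subseteq> {1..n} \<and> mat x F G = 1 \<and> mat (near_id n T \<rho> T) G H = 1}"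
  show "(\<Sum>G\<in>Pow {1..n}. mat x F G * mat (near_id n T \<rho> T) G H) = 2 ^ 0 * mat x F H"
  proof (cases "mat x F H = 1")
    case True
    have rho: "\<forall>(i, j)\<in>\<rho>. i \<in> H \<longleftrightarrow> j \<in> H" using \<rho>(2) True F H unfolding conn_def by blast
    \<comment> \<open>Off T this copies H; on T it is constant, with the colour of the right node
      1.\<close>
    let ?G = "(H - T) \<union> (if 1 \<in> H then T else {})"
    have m: "mat (near_id n T \<rho> T) G H = 1 \<longleftrightarrow> G = ?G" if "G \<subseteq> {1..n}" for G
    proof -
      have "mat (near_id n T \<rho> T) G H = 1 \<longleftrightarrow> G - T = H - T \<and> (\<forall>t\<in>T. t \<in> G \<longleftrightarrow> 1 \<in> H)"
        using near_id(2)[OF T(1) \<rho>(1) subset_refl that H] rho by simp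
      also have "\<dots> \<longleftrightarrow> G = ?G" by auto
      finally show ?thesis .
    qed
    have sub: "?G \<subseteq> {1..n}" using H T(1) by auto
    have eq: "H - T = ?G - T" by auto
    have "?S = {?G}" using m sub sing_change[OF F T(1,2) H True eq] by blast
    then show ?thesis unfolding sum_mat using True by simp
  next
    case False
    then have zero: "mat x F H = 0" using mat_01(2)[of x F H] by blast
    have "?S = {}"
    proof (rule ccontr)
      assume "?S \<noteq> {}"
      then obtain G where G: "G \<subseteq> {1..n}" "mat x F G = 1" "mat (near_id n T \<rho> T) G H = 1" by blast
      then have "G - T = H - T" using near_id(2)[OF T(1) \<rho>(1) subset_refl G(1) H] by simp
      then show False using sing_change[OF F T(1,2) G(1,2)] False by blast
    qed
    then show ?thesis unfolding sum_mat zero by (simp only: card.empty mult_zero_right)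
  qed
qed simp

text \<open>The matrix condition never looks at the colour of the right node t: its strand is cut,
  \<rho> does not tie it, and it is not the node 1 when something is attached there.\<close>

lemma sing_near_id:
  assumes T: "T \<subseteq> {1..n}" and \<rho>: "\<rho> \<subseteq> {1..n} \<times> {1..n}" and Z: "Z \<subseteq> T"
    and t: "t \<in> T" "t \<notin> fst ` \<rho>" "t \<notin> snd ` \<rho>" "Z = {} \<or> t \<noteq> 1"
  shows "sing n t (near_id n T \<rho> Z)"
  unfolding sing_def
proof (intro allI impI)
  fix G H assume G: "G \<subseteq> {1..n}" and H: "H \<subseteq> {1..n}" and m: "mat (near_id n T \<rho> Z) G H = 1"
  have *: "mat (near_id n T \<rho> Z) G H' = 1" if H': "H' \<subseteq> {1..n}" "\<And>k. k \<noteq> t \<Longrightarrow> k \<in> H' \<longleftrightarrow> k \<in> H" for H'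
  proof -
    have p: "G - T = H - T" "\<forall>(i, j)\<in>\<rho>. i \<in> H \<longleftrightarrow> j \<in> H" "\<forall>t\<in>Z. t \<in> G \<longleftrightarrow> 1 \<in> H"
      using m unfolding near_id(2)[OF T \<rho> Z G H] by auto
    have "H' - T = H - T"
    proof (rule set_eqI)
      show "k \<in> H' - T \<longleftrightarrow> k \<in> H - T" for k using H'(2)[of k] t(1) by (cases "k = t") auto
    qed
    moreover have "\<forall>(i, j)\<in>\<rho>. i \<in> H' \<longleftrightarrow> j \<in> H'"
    proof clarify
      fix i j assume ij: "(i, j) \<in> \<rho>"
      then have "i \<noteq> t" "j \<noteq> t" using t(2,3) by force+
      then show "i \<in> H' \<longleftrightarrow> j \<in> H'" using H'(2) p(2) ij by auto
    qed
    moreover have "\<forall>s\<in>Z. s \<in> G \<longleftrightarrow> 1 \<in> H'" using p(3) H'(2)[of 1] t(4) by auto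
    ultimately show ?thesis unfolding near_id(2)[OF T \<rho> Z G H'(1)] using p(1) by simp
  qed
  show "mat (near_id n T \<rho> Z) G (insert t H) = 1 \<and> mat (near_id n T \<rho> Z) G (H - {t}) = 1"
    using *[of "insert t H"] *[of "H - {t}"] H T t(1) by blast
qed

lemma conn_near_id:
  assumes T: "T \<subseteq> {1..n}" and \<rho>: "\<rho> \<subseteq> {1..n} \<times> {1..n}" and Z: "Z \<subseteq> T" and ij: "(i, j) \<in> \<rho>"
  shows "conn n i j (near_id n T \<rho> Z)"
  unfolding conn_def using near_id(2)[OF T \<rho> Z] ij by blast

text \<open>A singleton right node i of x can be split off: merging it with the node -1 before
  multiplying by the diagram that isolates i creates no loop.\<close>
lemma sing_factor:
  assumes x: "x \<in> diagrams n" and i: "i \<in> {1..n}" and s: "sing n i x"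
  shows "\<exists>x'\<in>diagrams n. diag_prod n x' (near_id n {i} {} {}) = x \<and> loops n x' (near_id n {i} {} {}) = 0"
proof -
  define r where "r = {(u, v). \<exists>B\<in>x. u \<in> B \<and> v \<in> B} \<union> {(int i, -1)}"
  have r: "r \<subseteq> nodes n \<times> nodes n"
    using block_subset[OF x] i by (auto simp: r_def nodes_def)
  let ?x = "diag_of n r"
  have m: "mat ?x F G = 1 \<longleftrightarrow> mat x F G = 1 \<and> (i \<in> G \<longleftrightarrow> 1 \<in> F)" if FG: "F \<subseteq> {1..n}" "G \<subseteq> {1..n}" for F G
  proof -
    have "-1 \<in> glue F G \<longleftrightarrow> 1 \<in> F" using mem_glue_neg[OF FG, of 1] by simp
    moreover have "(\<forall>(u, v)\<in>{(u, v). \<exists>B\<in>x. u \<in> B \<and> v \<in> B}. u \<in> glue F G \<longleftrightarrow> v \<in> glue F G) \<longleftrightarrow> mat x F G = 1"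
      unfolding mat_eq_1 sat_def by blast
    ultimately show ?thesis
      unfolding diag_of(2)[OF r] unfolding r_def ball_Un by (simp add: mem_glue_pos[OF FG])
  qed
  have iN: "{i} \<subseteq> {1..n}" using i by simp
  let ?p = "near_id n {i} {} {}"
  note p1 = near_id(1)[OF iN empty_subsetI empty_subsetI]
  have p: "mat ?p G H = 1 \<longleftrightarrow> G - {i} = H - {i}" if "G \<subseteq> {1..n}" "H \<subseteq> {1..n}" for G H
    using near_id(2)[OF iN empty_subsetI empty_subsetI that] by simp
  have change: "mat x F H = 1"
    if "F \<subseteq> {1..n}" "G \<subseteq> {1..n}" "mat x F G = 1" "G - {i} = H - {i}" for F G H
    using sing_change[OF that(1) iN _ that(2-4)] s by simp
  have "diag_prod n ?x ?p = x \<and> loops n ?x ?p = 0"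
  proof (rule diag_prod_eqI[OF diag_of(1)[OF r] p1 x])
    fix F H assume F: "F \<subseteq> {1..n}" and H: "H \<subseteq> {1..n}"
    let ?S = "{G. G \<subseteq> {1..n} \<and> mat ?x F G = 1 \<and> mat ?p G H = 1}"
    \<comment> \<open>The edge from i to the node -1 puts i into G exactly if 1 is in F, so a single
      middle colouring survives where the singleton i alone would allow two.\<close>
    let ?G = "if 1 \<in> F then insert i H else H - {i}"
    have S: "G \<in> ?S \<longleftrightarrow> G \<subseteq> {1..n} \<and> mat x F G = 1 \<and> G = ?G" for G
    proof (cases "G \<subseteq> {1..n}")
      case True
      have "(i \<in> G \<longleftrightarrow> 1 \<in> F) \<and> G - {i} = H - {i} \<longleftrightarrow> G = ?G" by auto
      then show ?thesis using m[OF F True] p[OF True H] True by blast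
    qed simp
    have sub: "?G \<subseteq> {1..n}" using H i by auto
    have "mat x F ?G = 1 \<longleftrightarrow> mat x F H = 1"
    proof
      assume "mat x F ?G = 1"
      then show "mat x F H = 1" using change[OF F sub, of H] by auto
    next
      assume "mat x F H = 1"
      then show "mat x F ?G = 1" using change[OF F H, of ?G] by auto
    qed
    then have "?S = (if mat x F H = 1 then {?G} else {})"
      by (intro set_eqI) (unfold S, use sub in auto)
    then show "(\<Sum>G\<in>Pow {1..n}. mat ?x F G * mat ?p G H) = 2 ^ 0 * mat x F H"
      unfolding sum_mat by (simp add: mat_def)
  qed
  then show ?thesis using diag_of(1)[OF r] by blast
qed

section \<open>The embedded subalgebra\<close>

lemma partition_on_Un:
  assumes "partition_on A P" "partition_on B Q" "A \<inter> B = {}"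
  shows "partition_on (A \<union> B) (P \<union> Q)"
proof (rule partition_onI)
  show "\<Union>(P \<union> Q) = A \<union> B" using assms by (auto simp: partition_on_def)
  show "{} \<notin> P \<union> Q" using assms by (auto simp: partition_on_def)
  fix p q assume pq: "p \<in> P \<union> Q" "q \<in> P \<union> Q" "p \<noteq> q"
  have PA: "p \<subseteq> A" if "p \<in> P" for p using that assms(1) by (auto simp: partition_on_def)
  have QB: "q \<subseteq> B" if "q \<in> Q" for q using that assms(2) by (auto simp: partition_on_def)
  have PP: "disjnt p q" if "p \<in> P" "q \<in> P" using that pq(3) assms(1)
      by (auto simp: partition_on_def pairwise_def)
  have QQ: "disjnt p q" if "p \<in> Q" "q \<in> Q" using that pq(3) assms(2)
      by (auto simp: partition_on_def pairwise_def)
  show "disjnt p q"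
    using pq(1,2) PP QQ PA[of p] PA[of q] QB[of p] QB[of q] assms(3)
    unfolding disjnt_def by blast
qed

lemma partition_on_Diff:
  assumes "partition_on A P" "Q \<subseteq> P"
  shows "partition_on (A - \<Union>Q) (P - Q)"
proof (rule partition_onI)
  have A: "\<Union>P = A" using assms(1) by (simp add: partition_on_def)
  have dj: "X = Y" if "X \<in> P" "Y \<in> P" "x \<in> X" "x \<in> Y" for X Y x
    using that partition_onD2[OF assms(1)] by (auto simp: disjoint_def)
  show "\<Union>(P - Q) = A - \<Union>Q"
  proof (intro set_eqI iffI)
    fix x assume "x \<in> \<Union>(P - Q)"
    then obtain X where X: "X \<in> P" "X \<notin> Q" "x \<in> X" by blast
    have "x \<notin> Y" if "Y \<in> Q" for Y
      using dj[OF X(1) _ X(3), of Y] that assms(2) X(2) by blast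
    then show "x \<in> A - \<Union>Q" using X A by blast
  qed (use A in blast)
  show "{} \<notin> P - Q" using assms by (auto simp: partition_on_def)
  show "disjnt p q" if "p \<in> P - Q" "q \<in> P - Q" "p \<noteq> q" for p q
    using that assms(1) by (auto simp: partition_on_def pairwise_def)
qed

definition fixed_blocks :: "nat \<Rightarrow> int set set" where
  "fixed_blocks k = (\<lambda>i. {- int i, int i}) ` {1..k}"

lemma partition_fixed_blocks: "partition_on (\<Union>(fixed_blocks k)) (fixed_blocks k)"
  by (rule partition_onI) (auto simp: fixed_blocks_def disjnt_def)

lemma shift_nodes:
  assumes "m \<le> n"
  shows "shift_node (n - m) ` nodes m = nodes n - \<Union>(fixed_blocks (n - m))"
proof (intro set_eqI iffI)
  fix x assume "x \<in> shift_node (n - m) ` nodes m"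
  then show "x \<in> nodes n - \<Union>(fixed_blocks (n - m))"
    using assms by (auto simp: shift_node_def nodes_def fixed_blocks_def of_nat_diff)
next
  fix x assume x: "x \<in> nodes n - \<Union>(fixed_blocks (n - m))"
  then have "x \<in> nodes n" by blast
  then show "x \<in> shift_node (n - m) ` nodes m"
  proof (cases rule: nodes_cases)
    case (1 i)
    then have "i \<notin> {1..n - m}" using x by (auto simp: fixed_blocks_def)
    then have "- int (i - (n - m)) \<in> nodes m" "x = shift_node (n - m) (- int (i - (n - m)))"
      using 1 assms by (auto simp: nodes_def shift_node_def)
    then show ?thesis by (rule rev_image_eqI)
  next
    case (2 i)
    then have "i \<notin> {1..n - m}" using x by (auto simp: fixed_blocks_def)
    then have "int (i - (n - m)) \<in> nodes m" "x = shift_node (n - m) (int (i - (n - m)))"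
      using 2 assms by (auto simp: nodes_def shift_node_def)
    then show ?thesis by (rule rev_image_eqI)
  qed
qed

lemma inj_shift: "inj_on (shift_node k) (nodes m)"
  by (auto simp: inj_on_def shift_node_def nodes_def split: if_splits)

lemma fixed_blocks_nodes: "m \<le> n \<Longrightarrow> \<Union>(fixed_blocks (n - m)) \<subseteq> nodes n"
  by (auto simp: fixed_blocks_def nodes_def)

text \<open>Deleting the adjoined blocks leaves a partition of the shifted nodes, which can be moved
  back. Later arguments on embedded diagrams work with the condition on blocks instead of the
  shift.\<close>

lemma diag_emb_image:
  assumes mn: "m \<le> n"
  shows "diag_emb n m ` diagrams m = {e \<in> diagrams n. fixed_blocks (n - m) \<subseteq> e}"
proof (intro set_eqI iffI)
  let ?s = "shift_node (n - m)" and ?f = "fixed_blocks (n - m)"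
  fix e assume "e \<in> diag_emb n m ` diagrams m"
  then obtain d where d: "d \<in> diagrams m" and e: "e = (`) ?s ` d \<union> ?f"
    by (auto simp: diag_emb_def fixed_blocks_def)
  have "{} \<notin> d" using d by (auto simp: diagrams_def partition_on_def)
  then have "(`) ?s ` d - {{}} = (`) ?s ` d" by auto
  then have "partition_on (?s ` nodes m) ((`) ?s ` d)"
    using partition_on_inj_image[OF _ inj_shift, of m d "n - m"] d by (simp add: diagrams_def)
  then have "partition_on (?s ` nodes m \<union> \<Union>?f) e"
    unfolding e using shift_nodes[OF mn] by (intro partition_on_Un partition_fixed_blocks) auto
  moreover have "?s ` nodes m \<union> \<Union>?f = nodes n"
    using shift_nodes[OF mn] fixed_blocks_nodes[OF mn] by blast
  ultimately show "e \<in> {e \<in> diagrams n. ?f \<subseteq> e}" by (auto simp: diagrams_def e)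
next
  let ?s = "shift_node (n - m)" and ?f = "fixed_blocks (n - m)"
  fix e assume "e \<in> {e \<in> diagrams n. ?f \<subseteq> e}"
  then have e: "partition_on (nodes n) e" "?f \<subseteq> e" by (auto simp: diagrams_def)
  define t where "t = inv_into (nodes m) ?s"
  define d where "d = (`) t ` (e - ?f)"
  have p: "partition_on (?s ` nodes m) (e - ?f)"
    using partition_on_Diff[OF e] shift_nodes[OF mn] by simp
  have "inj_on t (?s ` nodes m)" unfolding t_def by (rule inj_on_inv_into) simp
  then have "partition_on (t ` ?s ` nodes m) ((`) t ` (e - ?f) - {{}})"
    by (rule partition_on_inj_image[OF p])
  moreover have "t ` ?s ` nodes m = nodes m"
    unfolding t_def using inj_shift by (simp add: image_image)
  moreover have "(`) t ` (e - ?f) - {{}} = d" using p by (auto simp: d_def partition_on_def)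
  ultimately have "d \<in> diagrams m" by (simp add: diagrams_def)
  moreover have "(`) ?s ` d = e - ?f"
  proof -
    have "?s ` t ` B = B" if "B \<in> e - ?f" for B
    proof -
      have "B \<subseteq> ?s ` nodes m" using p that by (auto simp: partition_on_def)
      then show ?thesis unfolding t_def by (rule image_inv_into_cancel[OF refl])
    qed
    then show ?thesis unfolding d_def by (simp add: image_image)
  qed
  then have "diag_emb n m d = e" using e(2) by (auto simp: diag_emb_def fixed_blocks_def)
  ultimately show "e \<in> diag_emb n m ` diagrams m" by blast
qed

lemma fixed_block_perm_diag:
  assumes s: "\<sigma> permutes {1..n}" and k: "k \<le> n"
  shows "fixed_blocks k \<subseteq> perm_diag n \<sigma> \<longleftrightarrow> (\<forall>i\<in>{1..k}. \<sigma> i = i)"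
proof -
  have "{- int i, int i} \<in> perm_diag n \<sigma> \<longleftrightarrow> \<sigma> i = i" if i: "i \<in> {1..k}" for i
  proof
    have iN: "i \<in> {1..n}" using i k by auto
    show "{- int i, int i} \<in> perm_diag n \<sigma>" if "\<sigma> i = i"
      using that iN unfolding perm_diag_def by (intro image_eqI[of _ _ i]) auto
    assume "{- int i, int i} \<in> perm_diag n \<sigma>"
    then obtain j where j: "j \<in> {1..n}" "{- int i, int i} = {- int (\<sigma> j), int j}" by (auto simp: perm_diag_def)
    have "\<sigma> j \<in> {1..n}" using permutes_in_image[OF s] j(1) by blast
    then show "\<sigma> i = i" using j iN by (auto simp: doubleton_eq_iff)
  qed
  then show ?thesis unfolding fixed_blocks_def by blast
qed

text \<open>The fixed points up to k are their own images, so injectivity keeps all other points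
  away from them.\<close>

lemma permutes_upper:
  fixes n k :: nat
  assumes s: "\<sigma> permutes {1..n}" and f: "\<And>i. i \<in> {1..k} \<Longrightarrow> \<sigma> i = i" and i: "i \<in> {k<..n}"
  shows "\<sigma> i \<in> {k<..n}"
proof -
  have "i \<in> {1..n}" using i by auto
  then have "\<sigma> i \<in> {1..n}" using permutes_in_image[OF s] by blast
  moreover have "\<sigma> i \<notin> {1..k}"
  proof
    assume k: "\<sigma> i \<in> {1..k}"
    then have "\<sigma> (\<sigma> i) = \<sigma> i" by (rule f)
    then have "\<sigma> i = i" using permutes_inj[OF s] by (simp add: inj_eq)
    then show False using i k by simp
  qed
  ultimately show ?thesis by auto
qed

lemma perm_emb_permutes:
  assumes mn: "m \<le> n" and s: "\<sigma> permutes {1..m}"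
  shows "perm_emb n m \<sigma> permutes {1..n}"
proof -
  have s_in: "\<sigma> (i - (n - m)) \<in> {1..m}" if "n - m < i" "i \<le> n" for i
    using permutes_in_image[OF s, of "i - (n - m)"] that mn by auto
  have "inj_on (perm_emb n m \<sigma>) {1..n}"
  proof (rule inj_onI)
    fix i j assume ij: "i \<in> {1..n}" "j \<in> {1..n}" "perm_emb n m \<sigma> i = perm_emb n m \<sigma> j"
    have big: "perm_emb n m \<sigma> i > n - m \<longleftrightarrow> i > n - m" if "i \<in> {1..n}" for i
      using s_in[of i] that by (auto simp: perm_emb_def)
    show "i = j"
    proof (cases "i > n - m")
      case True
      then have j: "j > n - m" using big ij by metis
      then have "\<sigma> (i - (n - m)) = \<sigma> (j - (n - m))" using ij True by (simp add: perm_emb_def)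
      then have "i - (n - m) = j - (n - m)" using permutes_inj[OF s] by (simp add: inj_eq)
      then show ?thesis using True j by simp
    next
      case False
      then have "\<not> j > n - m" using big ij by metis
      then show ?thesis using ij(3) False by (simp add: perm_emb_def)
    qed
  qed
  moreover have "perm_emb n m \<sigma> ` {1..n} \<subseteq> {1..n}"
  proof clarify
    fix i assume i: "i \<in> {1..n}"
    show "perm_emb n m \<sigma> i \<in> {1..n}" using s_in[of i] i mn by (auto simp: perm_emb_def)
  qed
  ultimately have "bij_betw (perm_emb n m \<sigma>) {1..n} {1..n}"
    by (simp add: bij_betw_def endo_inj_surj)
  then show ?thesis
  proof (rule bij_imp_permutes)
    fix i assume "i \<notin> {1..n}"
    then show "perm_emb n m \<sigma> i = i" by (auto simp: perm_emb_def)
  qed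
qed

text \<open>The preimage shifts up, applies the permutation and shifts down. Truncated subtraction
  does no harm because the upper nodes are mapped among themselves.\<close>

lemma perm_emb_image:
  assumes mn: "m \<le> n"
  shows "perm_emb n m ` {\<sigma>. \<sigma> permutes {1..m}} = {\<tau>. \<tau> permutes {1..n} \<and> (\<forall>i\<in>{1..n - m}. \<tau> i = i)}"
proof (intro set_eqI iffI)
  fix \<tau> assume "\<tau> \<in> perm_emb n m ` {\<sigma>. \<sigma> permutes {1..m}}"
  then show "\<tau> \<in> {\<tau>. \<tau> permutes {1..n} \<and> (\<forall>i\<in>{1..n - m}. \<tau> i = i)}"
    using perm_emb_permutes[OF mn] by (auto simp: perm_emb_def)
next
  fix \<tau> assume "\<tau> \<in> {\<tau>. \<tau> permutes {1..n} \<and> (\<forall>i\<in>{1..n - m}. \<tau> i = i)}"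
  then have t: "\<tau> permutes {1..n}" and f: "\<And>i. i \<in> {1..n - m} \<Longrightarrow> \<tau> i = i" by auto
  let ?k = "n - m"
  define \<sigma> where "\<sigma> j = (if j \<in> {1..m} then \<tau> (j + ?k) - ?k else j)" for j
  have big: "\<tau> i \<in> {?k<..n}" if "i \<in> {?k<..n}" for i
    using permutes_upper[OF t f that] .
  have bigj: "\<tau> (j + ?k) \<in> {?k<..n}" if "j \<in> {1..m}" for j
    by (rule big) (use that mn in auto)
  have "inj_on \<sigma> {1..m}"
  proof (rule inj_onI)
    fix i j assume ij: "i \<in> {1..m}" "j \<in> {1..m}" "\<sigma> i = \<sigma> j"
    then have "\<tau> (i + ?k) - ?k = \<tau> (j + ?k) - ?k" by (simp add: \<sigma>_def)
    then have "\<tau> (i + ?k) = \<tau> (j + ?k)" using bigj[OF ij(1)] bigj[OF ij(2)]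
      by (simp only: greaterThanAtMost_iff) linarith
    then show "i = j" using permutes_inj[OF t] by (simp add: inj_eq)
  qed
  moreover have "\<sigma> ` {1..m} \<subseteq> {1..m}"
  proof clarify
    fix j assume j: "j \<in> {1..m}"
    show "\<sigma> j \<in> {1..m}" using bigj[OF j] j mn by (auto simp: \<sigma>_def)
  qed
  ultimately have "bij_betw \<sigma> {1..m} {1..m}"
    by (simp add: bij_betw_def endo_inj_surj)
  then have s: "\<sigma> permutes {1..m}" by (rule bij_imp_permutes) (auto simp: \<sigma>_def)
  have "perm_emb n m \<sigma> = \<tau>"
  proof
    fix i
    show "perm_emb n m \<sigma> i = \<tau> i"
    proof (cases "?k < i \<and> i \<le> n")
      case True
      then have "i - ?k \<in> {1..m}" using mn by auto
      then show ?thesis using True big[of i] by (simp add: perm_emb_def \<sigma>_def)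
    next
      case False
      have "\<tau> i = i"
      proof (cases "i \<in> {1..?k}")
        case True
        then show ?thesis by (rule f)
      next
        case notin: False
        then have "i \<notin> {1..n}" using False by auto
        then show ?thesis by (rule permutes_not_in[OF t])
      qed
      then show ?thesis using False by (auto simp: perm_emb_def)
    qed
  qed
  then show "\<tau> \<in> perm_emb n m ` {\<sigma>. \<sigma> permutes {1..m}}" using s by blast
qed

section \<open>The degenerate diagrams and the main theorem\<close>

lemma Palg_simps [simp]:
  "bas (Palg n m \<delta>) = diagrams n" "mul (Palg n m \<delta>) = diag_prod n"
  "coef (Palg n m \<delta>) d d' = \<delta> ^ loops n d d'" "aug (Palg n m \<delta>) d = (if is_perm_diag d then 1 else 0)"
  "subb (Palg n m \<delta>) = diag_emb n m ` diagrams m"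
  by (simp_all add: Palg_def)

lemma Salg_simps [simp]:
  "bas (Salg n m) = {\<sigma>. \<sigma> permutes {1..n}}" "mul (Salg n m) = (\<circ>)"
  "coef (Salg n m) s t = 1" "aug (Salg n m) s = 1"
  "subb (Salg n m) = perm_emb n m ` {\<sigma>. \<sigma> permutes {1..m}}"
  by (simp_all add: Salg_def)

lemma based_Palg:
  assumes mn: "m \<le> n"
  shows "based_algebra (Palg n m \<delta>)"
proof
  show "coef (Palg n m \<delta>) a b * aug (Palg n m \<delta>) (mul (Palg n m \<delta>) a b) =
      aug (Palg n m \<delta>) a * aug (Palg n m \<delta>) b"
    if "a \<in> bas (Palg n m \<delta>)" "b \<in> bas (Palg n m \<delta>)" for a b
  proof -
    have d: "a \<in> diagrams n" "b \<in> diagrams n" using that by simp_all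
    \<comment> \<open>If \<open>b\<close> is a permutation diagram the coefficient has to be 1;
      otherwise both sides are 0.\<close>
    have "loops n a b = 0" if p: "is_perm_diag b"
    proof -
      obtain \<sigma> where "\<sigma> permutes {1..n}" "b = perm_diag n \<sigma>" using perm_diag_exists[OF d(2) p] by blast
      then show ?thesis using diag_prod_perm(1)[OF d(1)] by simp
    qed
    then show ?thesis using is_perm_diag_mult[OF d] by simp
  qed
  show "subb (Palg n m \<delta>) \<subseteq> bas (Palg n m \<delta>)"
    unfolding Palg_simps diag_emb_image[OF mn] by blast
qed (simp_all add: finite_diagrams diag_prod_closed diag_prod_assoc flip: power_add)

lemma based_Salg:
  assumes mn: "m \<le> n"
  shows "based_algebra (Salg n m :: ('a::comm_ring_1, nat \<Rightarrow> nat) malg)"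
proof
  show "subb (Salg n m :: ('a, nat \<Rightarrow> nat) malg) \<subseteq> bas (Salg n m :: ('a, nat \<Rightarrow> nat) malg)"
    unfolding Salg_simps perm_emb_image[OF mn] by blast
qed (auto simp: finite_permutations permutes_compose comp_assoc)

lemma subb_perm_diag:
  assumes mn: "m \<le> n" and s: "\<sigma> permutes {1..n}"
  shows "perm_diag n \<sigma> \<in> diag_emb n m ` diagrams m \<longleftrightarrow> (\<forall>i\<in>{1..n - m}. \<sigma> i = i)"
  using fixed_block_perm_diag[OF s, of "n - m"] perm_diag_diagrams[OF s] by (simp add: diag_emb_image[OF mn])

lemma iota_map:
  assumes mn: "m \<le> n"
  shows "based_algebra_map (Salg n m) (Palg n m \<delta>) (\<lambda>_. True) (perm_diag n)"
proof -
  interpret S: based_algebra "Salg n m :: ('a, nat \<Rightarrow> nat) malg" by (rule based_Salg[OF mn])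
  interpret T: based_algebra "Palg n m \<delta>" by (rule based_Palg[OF mn])
  show ?thesis
  proof
    fix e assume "e \<in> subb (Salg n m :: ('a, nat \<Rightarrow> nat) malg)"
    then have "e permutes {1..n} \<and> (\<forall>i\<in>{1..n - m}. e i = i)"
      unfolding Salg_simps perm_emb_image[OF mn] by blast
    then show "perm_diag n e \<in> subb (Palg n m \<delta>)" using subb_perm_diag[OF mn] by simp
  qed (simp_all add: perm_diag_diagrams diag_prod_perm_perm diag_prod_perm(1) is_perm_diag_perm_diag)
qed

lemma pi_map:
  assumes mn: "m \<le> n"
  shows "based_algebra_map (Palg n m \<delta>) (Salg n m) is_perm_diag (perm_of n)"
proof -
  interpret S: based_algebra "Salg n m :: ('a, nat \<Rightarrow> nat) malg" by (rule based_Salg[OF mn])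
  interpret T: based_algebra "Palg n m \<delta>" by (rule based_Palg[OF mn])
  show ?thesis
  proof
    fix a b assume "a \<in> bas (Palg n m \<delta>)" "b \<in> bas (Palg n m \<delta>)" and p: "is_perm_diag a" "is_perm_diag b"
    then have ab: "a \<in> diagrams n" "b \<in> diagrams n" by simp_all
    note pa = perm_of[OF ab(1) p(1)] and pb = perm_of[OF ab(2) p(2)]
    show "perm_of n (mul (Palg n m \<delta>) a b) = mul (Salg n m :: ('a, nat \<Rightarrow> nat) malg) (perm_of n a) (perm_of n b)"
      using diag_prod_perm_perm[OF pa(1) pb(1)] perm_of_perm_diag[OF permutes_compose[OF pb(1) pa(1)]]
      unfolding pa(2) pb(2) by simp
    show "coef (Palg n m \<delta>) a b = coef (Salg n m) (perm_of n a) (perm_of n b)"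
      using diag_prod_perm(1)[OF ab(1) pb(1)] unfolding pb(2) by simp
  next
    show "perm_of n a \<in> bas (Salg n m :: ('a, nat \<Rightarrow> nat) malg)"
      if "a \<in> bas (Palg n m \<delta>)" "is_perm_diag a" for a
      using perm_of(1)[of a n] that by simp
  next
    fix e assume e: "e \<in> subb (Palg n m \<delta>)" and p: "is_perm_diag e"
    then have ed: "e \<in> diagrams n" using T.subb_subset by auto
    note pe = perm_of[OF ed p]
    have "\<forall>i\<in>{1..n - m}. perm_of n e i = i"
      using e subb_perm_diag[OF mn pe(1)] unfolding pe(2) by simp
    then show "perm_of n e \<in> subb (Salg n m :: ('a, nat \<Rightarrow> nat) malg)"
      unfolding Salg_simps perm_emb_image[OF mn] using pe(1) by blast
  qed (simp_all add: is_perm_diag_mult)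
qed

text \<open>The nodes above n - m are those on which the embedded algebra acts. An upper right node
  may be joined to a left node or to a lower right node without degeneracy, since such a partner
  stays in place when the upper nodes are permuted.\<close>

definition degenerate :: "nat \<Rightarrow> nat \<Rightarrow> int set set set" where
  "degenerate n m = {x \<in> diagrams n. (\<exists>i\<in>{n - m<..n}. sing n i x) \<or>
     (\<exists>i\<in>{n - m<..n}. \<exists>j\<in>{n - m<..n}. i \<noteq> j \<and> conn n i j x)}"

lemma degenerate_not_perm: "x \<in> degenerate n m \<Longrightarrow> \<not> is_perm_diag x"
proof
  assume x: "x \<in> degenerate n m" and p: "is_perm_diag x"
  then have xd: "x \<in> diagrams n" by (simp add: degenerate_def)
  have sub: "i \<in> {1..n}" if "i \<in> {n - m<..n}" for i using that by auto
  show False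
    using x not_sing_perm[OF xd p] not_conn_perm[OF xd p] sub unfolding degenerate_def by blast
qed

lemma degenerate_left:
  assumes a: "a \<in> diagrams n" and x: "x \<in> degenerate n m"
  shows "diag_prod n a x \<in> degenerate n m"
proof -
  have xd: "x \<in> diagrams n" using x by (simp add: degenerate_def)
  have sub: "i \<in> {1..n}" if "i \<in> {n - m<..n}" for i using that by auto
  have "(\<exists>i\<in>{n - m<..n}. sing n i x) \<or> (\<exists>i\<in>{n - m<..n}. \<exists>j\<in>{n - m<..n}. i \<noteq> j \<and> conn n i j x)"
    using x by (simp add: degenerate_def)
  then have "(\<exists>i\<in>{n - m<..n}. sing n i (diag_prod n a x)) \<or>
      (\<exists>i\<in>{n - m<..n}. \<exists>j\<in>{n - m<..n}. i \<noteq> j \<and> conn n i j (diag_prod n a x))"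
    using sing_mult[OF a xd] conn_mult[OF a xd] sub by meson
  then show ?thesis using diag_prod_closed[OF a xd] by (simp add: degenerate_def)
qed

text \<open>An embedded permutation fixes the lower nodes and hence permutes the upper ones, so a
  singleton or a joined pair above n - m is carried to another one there.\<close>

lemma degenerate_right:
  assumes mn: "m \<le> n" and x: "x \<in> degenerate n m" and g: "g \<in> diag_emb n m ` diagrams m" "is_perm_diag g"
  shows "diag_prod n x g \<in> degenerate n m"
proof -
  have xd: "x \<in> diagrams n" using x by (simp add: degenerate_def)
  have gd: "g \<in> diagrams n" using g(1) unfolding diag_emb_image[OF mn] by blast
  obtain \<sigma> where s: "\<sigma> permutes {1..n}" "g = perm_diag n \<sigma>" using perm_diag_exists[OF gd g(2)] by blast
  have f: "\<sigma> i = i" if "i \<in> {1..n - m}" for i using g(1) subb_perm_diag[OF mn s(1)] s(2) that by blast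
  have f': "inv \<sigma> i = i" if "i \<in> {1..n - m}" for i using f[OF that] permutes_inv_eq[OF s(1)] by blast
  have up: "inv \<sigma> i \<in> {n - m<..n}" if "i \<in> {n - m<..n}" for i
    by (rule permutes_upper[OF permutes_inv[OF s(1)] f' that])
  have si: "\<sigma> (inv \<sigma> i) = i" for i using permutes_inverses(1)[OF s(1)] .
  have sub: "i \<in> {1..n}" if "i \<in> {n - m<..n}" for i using that by auto
  have "(\<exists>i\<in>{n - m<..n}. sing n i x) \<or> (\<exists>i\<in>{n - m<..n}. \<exists>j\<in>{n - m<..n}. i \<noteq> j \<and> conn n i j x)"
    using x by (simp add: degenerate_def)
  then have "(\<exists>i\<in>{n - m<..n}. sing n i (diag_prod n x g)) \<or>
      (\<exists>i\<in>{n - m<..n}. \<exists>j\<in>{n - m<..n}. i \<noteq> j \<and> conn n i j (diag_prod n x g))"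
  proof
    assume "\<exists>i\<in>{n - m<..n}. sing n i x"
    then obtain i where i: "i \<in> {n - m<..n}" "sing n i x" by blast
    have "sing n (inv \<sigma> i) (diag_prod n x g)"
      unfolding s(2) by (rule sing_perm[OF xd s(1)]) (use sub[OF up[OF i(1)]] i(2) si in auto)
    then show ?thesis using up[OF i(1)] by blast
  next
    assume "\<exists>i\<in>{n - m<..n}. \<exists>j\<in>{n - m<..n}. i \<noteq> j \<and> conn n i j x"
    then obtain i j where ij: "i \<in> {n - m<..n}" "j \<in> {n - m<..n}" "i \<noteq> j" "conn n i j x" by blast
    have "conn n (inv \<sigma> i) (inv \<sigma> j) (diag_prod n x g)"
      unfolding s(2) by (rule conn_perm[OF xd s(1)]) (use ij(4) si in simp)
    moreover have "inv \<sigma> i \<noteq> inv \<sigma> j" using ij(3) si by metis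
    ultimately show ?thesis using up[OF ij(1)] up[OF ij(2)] by blast
  qed
  then show ?thesis using diag_prod_closed[OF xd gd] by (simp add: degenerate_def)
qed

lemma not_degenerate_block:
  assumes x: "x \<in> diagrams n" "x \<notin> degenerate n m" and i: "i \<in> {n - m<..n}" and B: "B \<in> x" "int i \<in> B"
  shows "\<exists>y\<in>B. y \<noteq> int i" and "j \<in> {n - m<..n} \<Longrightarrow> int j \<in> B \<Longrightarrow> j = i"
proof -
  have nd: "\<not> sing n i x" "\<And>j. j \<in> {n - m<..n} \<Longrightarrow> j \<noteq> i \<Longrightarrow> \<not> conn n j i x"
    using x i unfolding degenerate_def by blast+
  show "\<exists>y\<in>B. y \<noteq> int i"
  proof (rule ccontr)
    assume "\<not> (\<exists>y\<in>B. y \<noteq> int i)"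
    then have "B = {int i}" using B(2) by blast
    then show False using sing_block[OF x(1), of i] B(1) i nd(1) by simp
  qed
  show "j = i" if "j \<in> {n - m<..n}" "int j \<in> B"
    using conn_block[OF B(1) that(2) B(2)] nd(2)[OF that(1)] by blast
qed

text \<open>In a diagram outside the degenerate ones, the m right nodes above n - m are joined to
  left nodes in distinct blocks; if the remaining nodes are fixed there is no room for anything else.\<close>
lemma subb_degenerate:
  assumes mn: "m \<le> n" and e: "e \<in> diag_emb n m ` diagrams m" "\<not> is_perm_diag e"
  shows "e \<in> degenerate n m"
proof (rule ccontr)
  assume nd: "e \<notin> degenerate n m"
  have ed: "e \<in> diagrams n" and fb: "fixed_blocks (n - m) \<subseteq> e"
    using e(1) unfolding diag_emb_image[OF mn] by auto
  let ?X = "{n - m<..n}"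
  have small: "B = {- int i, int i}" if "B \<in> e" "i \<in> {1..n - m}" "int i \<in> B \<or> - int i \<in> B" for B i
  proof -
    have "{- int i, int i} \<in> e" using fb that(2) by (auto simp: fixed_blocks_def)
    then show ?thesis using block_unique[OF ed that(1), of "{- int i, int i}"] that(3) by blast
  qed
  \<comment> \<open>The block of an upper right node is no singleton, has no second upper right node
    and, the lower nodes being in their fixed blocks, no lower node; what is left is an upper left
    node.\<close>
  have "\<exists>f\<in>?X. \<exists>B\<in>e. int i \<in> B \<and> - int f \<in> B" if i: "i \<in> ?X" for i
  proof -
    have "int i \<in> nodes n" using i by (auto simp: nodes_def)
    then obtain B where B: "B \<in> e" "int i \<in> B" using block_exists[OF ed] by blast
    obtain y where y: "y \<in> B" "y \<noteq> int i" using not_degenerate_block(1)[OF ed nd i B] by blast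
    have i': "i \<notin> {1..n - m}" using i by auto
    have nosmall: "int j \<notin> B \<and> - int j \<notin> B" if j: "j \<in> {1..n - m}" for j
    proof (rule ccontr)
      assume "\<not> ?thesis"
      then have "B = {- int j, int j}" using small[OF B(1) j] by blast
      then have "i = j" using B(2) j by auto
      then show False using i' j by simp
    qed
    have "y \<in> nodes n" using block_subset[OF ed B(1)] y(1) by blast
    then show ?thesis
    proof (cases rule: nodes_cases)
      case (1 a)
      then have "a \<notin> {1..n - m}" using nosmall y(1) by blast
      then have "a \<in> ?X" using 1(1) by auto
      then show ?thesis using B y(1) 1(2) by blast
    next
      case (2 a)
      then have "a \<notin> {1..n - m}" using nosmall y(1) by blast
      then have "a \<in> ?X" using 2(1) by auto
      then have "a = i" using not_degenerate_block(2)[OF ed nd i B] y(1) 2(2) by blast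
      then show ?thesis using y(2) 2(2) by simp
    qed
  qed
  then obtain f C where f: "\<And>i. i \<in> ?X \<Longrightarrow> f i \<in> ?X \<and> C i \<in> e \<and> int i \<in> C i \<and> - int (f i) \<in> C i"
    by metis
  have inj: "inj_on f ?X"
  proof (rule inj_onI)
    fix i j assume ij: "i \<in> ?X" "j \<in> ?X" "f i = f j"
    have "C i = C j" using block_unique[OF ed, of "C i" "C j" "- int (f i)"] f[OF ij(1)] f[OF ij(2)] ij(3)
        by simp
    then have "int j \<in> C i" using f[OF ij(2)] by simp
    then show "i = j" using not_degenerate_block(2)[OF ed nd ij(1), of "C i" j] f[OF ij(1)] ij(2) by simp
  qed
  have "f ` ?X \<subseteq> ?X" using f by blast
  \<comment> \<open>Every upper left node is now the partner of some upper right node, so no left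
    node remains for a further block.\<close>
  then have surj: "f ` ?X = ?X" using endo_inj_surj[OF _ _ inj] by simp
  have blk: "B = {- int (f i), int i}" if B: "B \<in> e" and i: "i \<in> ?X" "int i \<in> B" for B i
  proof -
    have BC: "B = C i" using block_unique[OF ed B, of "C i" "int i"] f[OF i(1)] i(2) by blast
    have "y = - int (f i) \<or> y = int i" if y: "y \<in> B" for y
    proof -
      have yn: "y \<in> nodes n" using block_subset[OF ed B] y by blast
      from yn show ?thesis
      proof (cases rule: nodes_cases)
        case (1 a)
        have "a \<in> ?X"
        proof (rule ccontr)
          assume "a \<notin> ?X"
          then have a: "a \<in> {1..n - m}" using 1(1) by auto
          then have "B = {- int a, int a}" using small[OF B a] y 1(2) by blast
          then show False using i a by auto
        qed
        then obtain j where j: "j \<in> ?X" "a = f j" using surj by blast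
        have "B = C j" using block_unique[OF ed B, of "C j" y] f[OF j(1)] y 1(2) j(2) by simp
        then have "int j \<in> B" using f[OF j(1)] by simp
        then have "j = i" using not_degenerate_block(2)[OF ed nd i(1) B i(2) j(1)] by simp
        then show ?thesis using 1(2) j(2) by simp
      next
        case (2 a)
        have "a \<in> ?X"
        proof (rule ccontr)
          assume "a \<notin> ?X"
          then have a: "a \<in> {1..n - m}" using 2(1) by auto
          then have "B = {- int a, int a}" using small[OF B a] y 2(2) by blast
          then show False using i a by auto
        qed
        then have "a = i" using not_degenerate_block(2)[OF ed nd i(1) B i(2), of a] y 2(2) by simp
        then show ?thesis using 2(2) by simp
      qed
    qed
    then show ?thesis using BC f[OF i(1)] by blast
  qed
  have "is_perm_diag e"
    unfolding is_perm_diag_def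
  proof
    fix B assume B: "B \<in> e"
    obtain y where y: "y \<in> B" using block_nonempty[OF ed B] by blast
    have yn: "y \<in> nodes n" using block_subset[OF ed B] y by blast
    then obtain a where a: "a \<in> {1..n}" "y = - int a \<or> y = int a" by (elim nodes_cases) auto
    have "\<exists>i j. i \<in> {1..n} \<and> j \<in> {1..n} \<and> B = {- int i, int j}"
    proof (cases "a \<in> {1..n - m}")
      case True
      then show ?thesis using small[OF B True] y a by auto
    next
      case False
      then have aX: "a \<in> ?X" using a(1) by auto
      show ?thesis
      proof (cases "y = int a")
        case True
        then have "B = {- int (f a), int a}" using blk[OF B aX] y by simp
        moreover have "f a \<in> {1..n}" using f[OF aX] by auto
        ultimately show ?thesis using a(1) by blast
      next
        case False
        then have ya: "y = - int a" using a(2) by blast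
        obtain j where j: "j \<in> ?X" "a = f j" using surj aX by blast
        have "B = C j" using block_unique[OF ed B, of "C j" y] f[OF j(1)] y ya j(2) by simp
        then have "B = {- int (f j), int j}" using blk[OF B j(1)] f[OF j(1)] by simp
        moreover have "j \<in> {1..n}" using j(1) by auto
        ultimately show ?thesis using a(1) j(2) by blast
      qed
    qed
    then obtain i j where "i \<in> {1..n}" "j \<in> {1..n}" "B = {- int i, int j}" by blast
    then show "\<exists>i j. i > 0 \<and> j > 0 \<and> B = {- i, j}"
      by (intro exI[of _ "int i"] exI[of _ "int j"]) auto
  qed
  then show False using e(2) by simp
qed

text \<open>Let r be \<tau> composed with the inverse of \<sigma>. Translation by r preserves the
  matrix of \<open>x\<close> and fixes the lower nodes. The block of an upper right node i has a
  further node, which r does not move; so the translated block still contains the whole block, in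
  particular i. As i is the only upper right node of its block, r fixes i.\<close>

lemma perm_free:
  assumes mn: "m \<le> n" and x: "x \<in> diagrams n" "x \<notin> degenerate n m"
    and s: "\<sigma> permutes {1..n}" "\<And>i. i \<in> {1..n - m} \<Longrightarrow> \<sigma> i = i"
    and t: "\<tau> permutes {1..n}" "\<And>i. i \<in> {1..n - m} \<Longrightarrow> \<tau> i = i"
    and eq: "diag_prod n x (perm_diag n \<sigma>) = diag_prod n x (perm_diag n \<tau>)"
  shows "\<sigma> = \<tau>"
proof -
  let ?X = "{n - m<..n}" and ?r = "\<tau> \<circ> inv \<sigma>"
  have r: "?r permutes {1..n}" using permutes_compose[OF permutes_inv[OF s(1)] t(1)] .
  have rf: "?r i = i" if "i \<in> {1..n - m}" for i
  proof -
    have "inv \<sigma> i = i" using s(2)[OF that] permutes_inv_eq[OF s(1)] by blast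
    then show ?thesis using t(2)[OF that] by simp
  qed
  have mat_r: "mat x F (?r ` G) = 1" if FG: "F \<subseteq> {1..n}" "G \<subseteq> {1..n}" "mat x F G = 1" for F G
  proof -
    let ?H = "inv \<sigma> ` G"
    have H: "?H \<subseteq> {1..n}" by (rule permutes_image_subset[OF permutes_inv[OF s(1)] FG(2)])
    have "\<sigma> ` ?H = G" using permutes_inverses(1)[OF s(1)] by (simp add: image_image)
    then have "mat x F (\<tau> ` ?H) = 1"
      using diag_prod_perm(2)[OF x(1) s(1) FG(1) H] diag_prod_perm(2)[OF x(1) t(1) FG(1) H] eq FG(3) by simp
    then show ?thesis by (simp add: image_comp)
  qed
  have rX: "?r i = i" if i: "i \<in> ?X" for i
  proof -
    have "int i \<in> nodes n" using i by (auto simp: nodes_def)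
    then obtain B where B: "B \<in> x" "int i \<in> B" using block_exists[OF x(1)] by blast
    note nd = not_degenerate_block[OF x i B]
    obtain y where y: "y \<in> B" "y \<noteq> int i" using nd(1) by blast
    obtain F G where FG: "F \<subseteq> {1..n}" "G \<subseteq> {1..n}" "B = glue F G"
      using subset_nodes_glue[OF block_subset[OF x(1) B(1)]] by blast
    have iG: "i \<in> G" using B(2) by (simp add: FG(3) mem_glue_pos[OF FG(1,2)])
    have GX: "j = i" if "j \<in> G" "j \<in> ?X" for j
      using nd(2)[OF that(2)] that(1) by (simp add: FG(3) mem_glue_pos[OF FG(1,2)])
    have rG: "?r ` G \<subseteq> {1..n}" by (rule permutes_image_subset[OF r FG(2)])
    have "mat x F G = 1" unfolding mat_eq_1 FG(3)[symmetric] by (rule sat_block[OF x(1) B(1)])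
    then have sat: "sat (glue F (?r ` G)) x" using mat_r[OF FG(1,2)] by (simp only: mat_eq_1)
    have "y \<in> nodes n" using block_subset[OF x(1) B(1)] y(1) by blast
    \<comment> \<open>\<open>y\<close> is a left node or a lower right node, hence untouched by the
      translation.\<close>
    then have "y \<in> glue F (?r ` G)"
    proof (cases rule: nodes_cases)
      case (1 a)
      then have "a \<in> F" using y(1) by (simp add: FG(3) mem_glue_neg[OF FG(1,2)])
      then show ?thesis unfolding 1(2) mem_glue_neg[OF FG(1) rG] .
    next
      case (2 a)
      have aG: "a \<in> G" using y(1) 2(2) by (simp add: FG(3) mem_glue_pos[OF FG(1,2)])
      have "a \<noteq> i" using y(2) 2(2) by simp
      then have "a \<notin> ?X" using GX[OF aG] by blast
      then have "?r a = a" using rf[of a] 2(1) by simp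
      then have "a \<in> ?r ` G" using aG by (metis imageI)
      then show ?thesis unfolding 2(2) mem_glue_pos[OF FG(1) rG] .
    qed
    then have "B \<subseteq> glue F (?r ` G)" using sat B(1) y(1) unfolding sat_def by blast
    then have "i \<in> ?r ` G" using B(2) mem_glue_pos[OF FG(1) rG] by blast
    then obtain j where j: "j \<in> G" "i = ?r j" by blast
    have "j \<in> ?X"
    proof (rule ccontr)
      assume jX: "j \<notin> ?X"
      then have "j \<in> {1..n - m}" using j(1) FG(2) by auto
      then have "?r j = j" by (rule rf)
      then show False using j(2) i jX by simp
    qed
    then have "j = i" using GX[OF j(1)] by blast
    then show ?thesis using j(2) by simp
  qed
  have "?r i = i" for i
  proof (cases "i \<in> {1..n}")
    case True
    then show ?thesis using rX[of i] rf[of i] by (cases "i \<in> ?X") auto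
  next
    case False
    then show ?thesis by (rule permutes_not_in[OF r])
  qed
  then have "\<tau> (inv \<sigma> (\<sigma> i)) = \<sigma> i" for i by (metis comp_apply)
  then show ?thesis using permutes_inverses(2)[OF s(1)] by (intro ext) simp
qed

lemma near_id_subb:
  assumes mn: "m \<le> n" and T: "T \<subseteq> {n - m<..n}" and \<rho>: "\<rho> \<subseteq> {n - m<..n} \<times> {n - m<..n}"
  shows "near_id n T \<rho> {} \<in> diag_emb n m ` diagrams m"
proof -
  have T': "T \<subseteq> {1..n}" using T by auto
  have \<rho>': "\<rho> \<subseteq> {1..n} \<times> {1..n}" using \<rho> by auto
  have "{- int i, int i} \<in> near_id n T \<rho> {}" if i: "i \<in> {1..n - m}" for i
  proof -
    have "i \<notin> {n - m<..n}" using i by simp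
    then have "i \<notin> T" "i \<notin> fst ` \<rho>" "i \<notin> snd ` \<rho>" using T \<rho> by auto
    moreover have "i \<in> {1..n}" using i by auto
    ultimately show ?thesis using near_id_block[OF T' \<rho>'] by blast
  qed
  then have "fixed_blocks (n - m) \<subseteq> near_id n T \<rho> {}" by (auto simp: fixed_blocks_def)
  then show ?thesis unfolding diag_emb_image[OF mn] using near_id(1)[OF T' \<rho>'] by simp
qed

text \<open>Coefficient 1 matters: the relations then kill \<open>x\<close> itself and not just its
  multiple by a power of delta. For a joined pair, multiplying by the tied diagram reproduces
  \<open>x\<close> without loops; for a singleton the loop is avoided by
  \<open>sing_factor\<close>.\<close>

lemma degenerate_factor:
  assumes mn: "m \<le> n" and x: "x \<in> degenerate n m"
  shows "\<exists>y\<in>diagrams n. \<exists>e\<in>diag_emb n m ` diagrams m. \<not> is_perm_diag e \<and> diag_prod n y e = x \<and> loops n y e = 0"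
proof -
  have xd: "x \<in> diagrams n" using x by (simp add: degenerate_def)
  have "(\<exists>i\<in>{n - m<..n}. sing n i x) \<or> (\<exists>i\<in>{n - m<..n}. \<exists>j\<in>{n - m<..n}. i \<noteq> j \<and> conn n i j x)"
    using x by (simp add: degenerate_def)
  then show ?thesis
  proof
    assume "\<exists>i\<in>{n - m<..n}. sing n i x"
    then obtain i where i: "i \<in> {n - m<..n}" "sing n i x" by blast
    have iN: "i \<in> {1..n}" "{i} \<subseteq> {1..n}" "{i} \<subseteq> {n - m<..n}" using i by auto
    obtain y where y: "y \<in> diagrams n" "diag_prod n y (near_id n {i} {} {}) =
        x" "loops n y (near_id n {i} {} {}) = 0"
      using sing_factor[OF xd iN(1) i(2)] by blast
    have e: "near_id n {i} {} {} \<in> diag_emb n m ` diagrams m" by (rule near_id_subb[OF mn iN(3)]) simp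
    have "sing n i (near_id n {i} {} {})" by (rule sing_near_id[OF iN(2)]) auto
    then have "\<not> is_perm_diag (near_id n {i} {} {})"
      using not_sing_perm[OF near_id(1)[OF iN(2) empty_subsetI empty_subsetI] _ iN(1)] by blast
    then show ?thesis using y e by blast
  next
    assume "\<exists>i\<in>{n - m<..n}. \<exists>j\<in>{n - m<..n}. i \<noteq> j \<and> conn n i j x"
    then obtain i j where ij: "i \<in> {n - m<..n}" "j \<in> {n - m<..n}" "i \<noteq> j" "conn n i j x" by blast
    have N: "i \<in> {1..n}" "{(i, j)} \<subseteq> {1..n} \<times> {1..n}" "{(i, j)} \<subseteq> {n - m<..n} \<times> {n - m<..n}" using ij by auto
    let ?e = "near_id n {} {(i, j)} {}"
    have e: "?e \<in> diag_emb n m ` diagrams m" by (rule near_id_subb[OF mn _ N(3)]) simp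
    have "conn n i j ?e" by (rule conn_near_id[OF empty_subsetI N(2) empty_subsetI]) simp
    then have "\<not> is_perm_diag ?e"
      using not_conn_perm[OF near_id(1)[OF empty_subsetI N(2) empty_subsetI] _ N(1) ij(3)] by blast
    moreover have "diag_prod n x ?e = x \<and> loops n x ?e = 0"
      using near_id_mult[OF xd empty_subsetI _ N(2)] ij(4) by simp
    ultimately show ?thesis using xd e by blast
  qed
qed

text \<open>Tuples ending in the left ideal cut out by prescribed singletons and joined pairs.
  Intersecting two strata unites the prescriptions, which keeps the family closed.\<close>

definition stratum :: "nat \<Rightarrow> nat set \<Rightarrow> (nat \<times> nat) set \<Rightarrow> int set set list set" where
  "stratum n T \<rho> = {l. l \<noteq> [] \<and> last l \<in> {x \<in> diagrams n. (\<forall>t\<in>T. sing n t x) \<and> (\<forall>(i, j)\<in>\<rho>. conn n i j x)}}"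

text \<open>A nonempty stratum is A e for a diagram e acting on it from the right as a unit multiple of the
  identity: if delta is invertible, e isolates the nodes of T (each producing a loop); if m < n, it
  instead ties the left copies of T to the free node 1, so that no loops appear.\<close>
lemma acyclic_stratum:
  fixes \<delta> :: "'a::comm_ring_1"
  assumes mn: "m \<le> n" and \<delta>: "(\<exists>u. \<delta> * u = 1) \<or> m < n"
    and T: "T \<subseteq> {n - m<..n}" and \<rho>: "\<rho> \<subseteq> {n - m<..n} \<times> {n - m<..n}" "\<And>i j. (i, j) \<in> \<rho> \<Longrightarrow> i \<noteq> j"
    and ne: "T \<noteq> {} \<or> \<rho> \<noteq> {}"
  shows "based_algebra.acyclic (Palg n m \<delta>) (stratum n T \<rho>)"
proof -
  interpret based_algebra "Palg n m \<delta>" by (rule based_Palg[OF mn])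
  have T': "T \<subseteq> {1..n}" using T by auto
  have \<rho>': "\<rho> \<subseteq> {1..n} \<times> {1..n}" using \<rho>(1) by auto
  show ?thesis
  proof (cases "stratum n T \<rho> = {}")
    case True
    then show ?thesis using acyclic_empty by simp
  next
    case False
    then obtain l where "l \<in> stratum n T \<rho>" by blast
    then have x0: "\<And>t. t \<in> T \<Longrightarrow> sing n t (last l)" "\<And>i j. (i, j) \<in> \<rho> \<Longrightarrow> conn n i j (last l)"
      by (auto simp: stratum_def)
    \<comment> \<open>A member of the stratum shows that no node is prescribed both as a singleton
      and as joined to another one; this puts the chosen \<open>near_id\<close> into the stratum
      itself.\<close>
    have disj: "t \<notin> fst ` \<rho> \<and> t \<notin> snd ` \<rho>" if t: "t \<in> T" for t
    proof -
      have "(t, j) \<notin> \<rho> \<and> (j, t) \<notin> \<rho>" for j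
        using sing_not_conn[OF x0(1)[OF t], of j] x0(2)[of t j] x0(2)[of j t] \<rho>(2)[of t j] \<rho>(2)[of j t] t T'
            by blast
      then show ?thesis by force
    qed
    \<comment> \<open>The two cases of the hypothesis: Z = T with factor 1 if there is a free node,
      Z empty with factor \<open>\<delta> ^ card T\<close> otherwise.\<close>
    have "\<exists>Z c u. Z \<subseteq> T \<and> c * u = 1 \<and> (Z = {} \<or> 1 \<notin> T) \<and>
      (\<forall>x\<in>diagrams n. (\<forall>t\<in>T. sing n t x) \<and> (\<forall>(i, j)\<in>\<rho>. conn n i j x) \<longrightarrow>
        diag_prod n x (near_id n T \<rho> Z) = x \<and> \<delta> ^ loops n x (near_id n T \<rho> Z) = c)"
    proof (cases "m < n")
      case True
      \<comment> \<open>Here n - m is at least 1, so node 1 lies below the range of T.\<close>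
      then have one: "1 \<notin> T" using T by auto
      show ?thesis
      proof (intro exI[of _ T] exI[of _ "1::'a"] conjI ballI impI)
        fix x assume x: "x \<in> diagrams n" "(\<forall>t\<in>T. sing n t x) \<and> (\<forall>(i, j)\<in>\<rho>. conn n i j x)"
        have "diag_prod n x (near_id n T \<rho> T) = x \<and> loops n x (near_id n T \<rho> T) = 0"
          by (rule near_id_mult_link[OF x(1) T' _ one \<rho>']) (use x(2) in auto)
        then show "diag_prod n x (near_id n T \<rho> T) = x" "\<delta> ^ loops n x (near_id n T \<rho> T) = 1" by simp_all
      qed (use one in auto)
    next
      case False
      then obtain u where u: "\<delta> * u = 1" using \<delta> by blast
      show ?thesis
      proof (rule exI[of _ "{}"], rule exI[of _ "\<delta> ^ card T"], rule exI[of _ "u ^ card T"], intro conjI ballI impI)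
        show "\<delta> ^ card T * u ^ card T = 1" by (simp only: power_mult_distrib[symmetric] u power_one)
        fix x assume x: "x \<in> diagrams n" "(\<forall>t\<in>T. sing n t x) \<and> (\<forall>(i, j)\<in>\<rho>. conn n i j x)"
        have "diag_prod n x (near_id n T \<rho> {}) = x \<and> loops n x (near_id n T \<rho> {}) = card T"
          by (rule near_id_mult[OF x(1) T' _ \<rho>']) (use x(2) in auto)
        then show "diag_prod n x (near_id n T \<rho> {}) = x" "\<delta> ^ loops n x (near_id n T \<rho> {}) = \<delta> ^ card T"
            by simp_all
      qed auto
    qed
    then obtain Z c u where Z: "Z \<subseteq> T" "Z = {} \<or> 1 \<notin> T" and cu: "c * u = 1"
      and e0: "\<forall>x\<in>diagrams n. (\<forall>t\<in>T. sing n t x) \<and> (\<forall>(i, j)\<in>\<rho>. conn n i j x) \<longrightarrow>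
        diag_prod n x (near_id n T \<rho> Z) = x \<and> \<delta> ^ loops n x (near_id n T \<rho> Z) = c"
      by (elim exE conjE)
    have e: "diag_prod n x (near_id n T \<rho> Z) = x \<and> \<delta> ^ loops n x (near_id n T \<rho> Z) = c"
      if "x \<in> diagrams n" "(\<forall>t\<in>T. sing n t x) \<and> (\<forall>(i, j)\<in>\<rho>. conn n i j x)" for x
      using bspec[OF e0 that(1)] that(2) by (rule mp)
    note ed = near_id(1)[OF T' \<rho>' Z(1)]
    have es: "sing n t (near_id n T \<rho> Z)" if t: "t \<in> T" for t
      by (rule sing_near_id[OF T' \<rho>' Z(1) t]) (use disj[OF t] Z(2) t in auto)
    have ec: "conn n i j (near_id n T \<rho> Z)" if "(i, j) \<in> \<rho>" for i j
      by (rule conn_near_id[OF T' \<rho>' Z(1) that])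
    show ?thesis
    proof (rule contraction[OF _ cu])
      show "near_id n T \<rho> Z \<in> bas (Palg n m \<delta>)" using ed by simp
      fix l assume l: "l \<in> stratum n T \<rho>"
      have "l @ [near_id n T \<rho> Z] \<in> stratum n T \<rho>" using ed es ec by (auto simp: stratum_def)
      moreover have "diag_prod n (last l) (near_id n T \<rho> Z) = last l \<and>
          \<delta> ^ loops n (last l) (near_id n T \<rho> Z) = c"
        using l by (intro e) (auto simp: stratum_def)
      ultimately show "l @ [near_id n T \<rho> Z] \<in> stratum n T \<rho> \<and>
          mul (Palg n m \<delta>) (last l) (near_id n T \<rho> Z) = last l \<and> coef (Palg n m \<delta>) (last l)
              (near_id n T \<rho> Z) = c"
        by simp
    next
      fix x assume "[x] \<in> stratum n T \<rho>" "x \<in> bas (Palg n m \<delta>)"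
      then have x: "x \<in> diagrams n" "\<And>t. t \<in> T \<Longrightarrow> sing n t x" "\<And>i j. (i, j) \<in> \<rho> \<Longrightarrow> conn n i j x"
        by (auto simp: stratum_def)
      have "\<not> is_perm_diag x"
      proof
        assume p: "is_perm_diag x"
        show False
        proof (cases "T = {}")
          case False
          then show False using not_sing_perm[OF x(1) p] x(2) T' by blast
        next
          case True
          then obtain i j where ij: "(i, j) \<in> \<rho>" using ne by auto
          then show False using not_conn_perm[OF x(1) p] x(3)[OF ij] \<rho>(2)[OF ij] \<rho>' by blast
        qed
      qed
      then show "aug (Palg n m \<delta>) x = 0" by simp
    qed
  qed
qed

text \<open>\<open>?C\<close> collects all strata with at least one prescription and is closed under
  intersection; \<open>?F\<close> picks those with a single prescription, which already cover the
  degenerate tuples.\<close>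

lemma acyclic_degenerate:
  fixes \<delta> :: "'a::comm_ring_1"
  assumes mn: "m \<le> n" and \<delta>: "(\<exists>u. \<delta> * u = 1) \<or> m < n"
  shows "based_algebra.acyclic (Palg n m \<delta>) {l. l \<noteq> [] \<and> last l \<in> degenerate n m}"
proof -
  interpret based_algebra "Palg n m \<delta>" by (rule based_Palg[OF mn])
  let ?X = "{n - m<..n}"
  \<comment> \<open>Pairs (i, i) and the empty prescription are excluded: every diagram satisfies
    them, so permutations with their non-zero augmentation would be let in.\<close>
  let ?I = "{(T, \<rho>). T \<subseteq> ?X \<and> \<rho> \<subseteq> ?X \<times> ?X \<and> (\<forall>(i, j)\<in>\<rho>. i \<noteq> j) \<and> (T \<noteq> {} \<or> \<rho> \<noteq> {})}"
  let ?C = "(\<lambda>(T, \<rho>). stratum n T \<rho>) ` ?I"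
  let ?F = "(\<lambda>i. stratum n {i} {}) ` ?X \<union> (\<lambda>(i, j). stratum n {} {(i, j)}) ` {(i, j) \<in> ?X \<times> ?X. i \<noteq> j}"
  have "acyclic (\<Union>?F)"
  proof (rule acyclic_Union[of ?C])
    fix V assume "V \<in> ?C"
    then obtain T \<rho> where V: "V = stratum n T \<rho>" and T\<rho>: "T \<subseteq> ?X" "\<rho> \<subseteq> ?X \<times> ?X" "\<forall>(i, j)\<in>\<rho>. i \<noteq> j" "T \<noteq> {} \<or>
        \<rho> \<noteq> {}"
      by auto
    show "acyclic V" unfolding V by (rule acyclic_stratum[OF mn \<delta> T\<rho>(1,2)]) (use T\<rho>(3,4) in auto)
    have N: "t \<in> {1..n}" if "t \<in> T" for t using T\<rho>(1) that by auto
    show "subcomplex V"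
      unfolding V stratum_def
    proof (rule subcomplex_last)
      fix a x assume "a \<in> bas (Palg n m \<delta>)"
        and x: "x \<in> {x \<in> diagrams n. (\<forall>t\<in>T. sing n t x) \<and> (\<forall>(i, j)\<in>\<rho>. conn n i j x)}"
      then have a: "a \<in> diagrams n" and xd: "x \<in> diagrams n" by auto
      have "\<forall>t\<in>T. sing n t (diag_prod n a x)" using sing_mult[OF a xd] N x by blast
      moreover have "\<forall>(i, j)\<in>\<rho>. conn n i j (diag_prod n a x)" using conn_mult[OF a xd] x by blast
      ultimately show "mul (Palg n m \<delta>) a x \<in> {x \<in> diagrams n. (\<forall>t\<in>T. sing n t x) \<and> (\<forall>(i, j)\<in>\<rho>. conn n i j x)}"
        using diag_prod_closed[OF a xd] by simp
    qed
  next
    fix V W assume "V \<in> ?C" "W \<in> ?C"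
    then obtain T \<rho> T' \<rho>' where V: "V = stratum n T \<rho>" "(T, \<rho>) \<in> ?I"
        and W: "W = stratum n T' \<rho>'" "(T', \<rho>') \<in> ?I"
      by auto
    have "V \<inter> W = stratum n (T \<union> T') (\<rho> \<union> \<rho>')" unfolding V W stratum_def by auto
    moreover have "(T \<union> T', \<rho> \<union> \<rho>') \<in> ?I" using V(2) W(2) by auto
    ultimately show "V \<inter> W \<in> ?C" by (intro image_eqI[of _ _ "(T \<union> T', \<rho> \<union> \<rho>')"]) auto
  next
    have "finite {(i, j) \<in> ?X \<times> ?X. i \<noteq> j}" by (rule finite_subset[of _ "?X \<times> ?X"]) auto
    then show "finite ?F" by (intro finite_UnI finite_imageI) auto
    have "(\<lambda>i. stratum n {i} {}) ` ?X \<subseteq> ?C"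
    proof clarify
      fix i assume "i \<in> ?X"
      then show "stratum n {i} {} \<in> ?C" by (intro image_eqI[of _ _ "({i}, {})"]) auto
    qed
    moreover have "(\<lambda>(i, j). stratum n {} {(i, j)}) ` {(i, j) \<in> ?X \<times> ?X. i \<noteq> j} \<subseteq> ?C"
    proof clarify
      fix i j assume "i \<in> ?X" "j \<in> ?X" "i \<noteq> j"
      then show "stratum n {} {(i, j)} \<in> ?C" by (intro image_eqI[of _ _ "({}, {(i, j)})"]) auto
    qed
    ultimately show "?F \<subseteq> ?C" by (rule Un_least)
  qed
  moreover have "\<Union>?F = {l. l \<noteq> [] \<and> last l \<in> degenerate n m}"
  proof (intro set_eqI)
    fix l
    have "l \<in> \<Union>?F \<longleftrightarrow> (\<exists>i\<in>?X. l \<in> stratum n {i} {}) \<or>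
        (\<exists>i\<in>?X. \<exists>j\<in>?X. i \<noteq> j \<and> l \<in> stratum n {} {(i, j)})"
    proof -
      have "l \<in> \<Union>((\<lambda>(i, j). stratum n {} {(i, j)}) ` {(i, j) \<in> ?X \<times> ?X. i \<noteq> j}) \<longleftrightarrow>
          (\<exists>i\<in>?X. \<exists>j\<in>?X. i \<noteq> j \<and> l \<in> stratum n {} {(i, j)})"
        unfolding UN_iff by (blast intro: rev_bexI)
      then show ?thesis unfolding Union_Un_distrib Un_iff by blast
    qed
    also have "\<dots> \<longleftrightarrow> l \<noteq> [] \<and> last l \<in> degenerate n m"
      unfolding stratum_def degenerate_def by simp blast
    finally show "l \<in> \<Union>?F \<longleftrightarrow> l \<in> {l. l \<noteq> [] \<and> last l \<in> degenerate n m}" by simp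
  qed
  ultimately show ?thesis by simp
qed

lemma augmented_Palg:
  fixes \<delta> :: "'a::comm_ring_1"
  assumes mn: "m \<le> n" and \<delta>: "(\<exists>u. \<delta> * u = 1) \<or> m < n"
  shows "augmented_algebra (Palg n m \<delta>) is_perm_diag (degenerate n m) (perm_diag n id)"
proof -
  interpret based_algebra "Palg n m \<delta>" by (rule based_Palg[OF mn])
  have subd: "e \<in> diagrams n" if "e \<in> diag_emb n m ` diagrams m" for e
    using that unfolding diag_emb_image[OF mn] by blast
  have perm: "\<exists>\<sigma>. \<sigma> permutes {1..n} \<and> e = perm_diag n \<sigma> \<and> (\<forall>i\<in>{1..n - m}. \<sigma> i = i)"
    if e: "e \<in> diag_emb n m ` diagrams m" "is_perm_diag e" for e
  proof -
    obtain \<sigma> where s: "\<sigma> permutes {1..n}" "e = perm_diag n \<sigma>" using perm_diag_exists[OF subd[OF e(1)] e(2)]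
        by blast
    then show ?thesis using e(1) subb_perm_diag[OF mn s(1)] by blast
  qed
  show ?thesis
  proof
    show "perm_diag n id \<in> subb (Palg n m \<delta>)" using subb_perm_diag[OF mn permutes_id] by simp
    show "is_perm_diag (perm_diag n id)" by (rule is_perm_diag_perm_diag[OF permutes_id])
    show "coef (Palg n m \<delta>) a b = 1" if "a \<in> bas (Palg n m \<delta>)" "b \<in> bas (Palg n m \<delta>)" "is_perm_diag b" for a b
    proof -
      have d: "a \<in> diagrams n" "b \<in> diagrams n" "is_perm_diag b" using that by simp_all
      obtain \<sigma> where "\<sigma> permutes {1..n}" "b = perm_diag n \<sigma>" using perm_diag_exists[OF d(2,3)] by blast
      then show ?thesis using diag_prod_perm(1)[OF d(1)] by simp
    qed
    show "mul (Palg n m \<delta>) g h \<in> subb (Palg n m \<delta>)"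
      if gh: "g \<in> subb (Palg n m \<delta>)" "h \<in> subb (Palg n m \<delta>)" "is_perm_diag g" "is_perm_diag h" for g h
    proof -
      obtain \<sigma> where s: "\<sigma> permutes {1..n}" "g = perm_diag n \<sigma>" "\<forall>i\<in>{1..n - m}. \<sigma> i = i" using perm[of g] gh
          by auto
      obtain \<tau> where t: "\<tau> permutes {1..n}" "h = perm_diag n \<tau>" "\<forall>i\<in>{1..n - m}. \<tau> i = i" using perm[of h] gh
          by auto
      have "perm_diag n (\<sigma> \<circ> \<tau>) \<in> diag_emb n m ` diagrams m"
        using subb_perm_diag[OF mn permutes_compose[OF t(1) s(1)]] s(3) t(3) by simp
      then show ?thesis using diag_prod_perm_perm[OF s(1) t(1)] s(2) t(2) by simp
    qed
    show "\<exists>h\<in>subb (Palg n m \<delta>). is_perm_diag h \<and> mul (Palg n m \<delta>) g h = perm_diag n id"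
      if g: "g \<in> subb (Palg n m \<delta>)" "is_perm_diag g" for g
    proof -
      obtain \<sigma> where s: "\<sigma> permutes {1..n}" "g = perm_diag n \<sigma>" "\<forall>i\<in>{1..n - m}. \<sigma> i = i" using perm[of g] g
          by auto
      note i = permutes_inv[OF s(1)]
      have "\<forall>i\<in>{1..n - m}. inv \<sigma> i = i" using s(3) permutes_inv_eq[OF s(1)] by blast
      then have "perm_diag n (inv \<sigma>) \<in> subb (Palg n m \<delta>)" using subb_perm_diag[OF mn i] by simp
      moreover have "mul (Palg n m \<delta>) g (perm_diag n (inv \<sigma>)) = perm_diag n id"
        using diag_prod_perm_perm[OF s(1) i] permutes_inv_o(1)[OF s(1)] s(2) by simp
      ultimately show ?thesis using is_perm_diag_perm_diag[OF i] by blast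
    qed
    show "mul (Palg n m \<delta>) x g \<in> degenerate n m" if "x \<in> degenerate n m" "g \<in> subb (Palg n m \<delta>)"
        "is_perm_diag g" for x g
      using degenerate_right[OF mn that(1)] that(2,3) by simp
    show "e \<in> degenerate n m" if "e \<in> subb (Palg n m \<delta>)" "\<not> is_perm_diag e" for e
      using subb_degenerate[OF mn] that by simp
    show "\<exists>y\<in>bas (Palg n m \<delta>). \<exists>e\<in>subb (Palg n m \<delta>). \<not> is_perm_diag e \<and> mul (Palg n m \<delta>) y e = x \<and>
        coef (Palg n m \<delta>) y e = 1"
      if x: "x \<in> degenerate n m" for x
    proof -
      obtain y e where "y \<in> diagrams n" "e \<in> diag_emb n m ` diagrams m" "\<not> is_perm_diag e"
        "diag_prod n y e = x" "loops n y e = 0" using degenerate_factor[OF mn x] by blast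
      then show ?thesis unfolding Palg_simps by (intro bexI[of _ y] bexI[of _ e]) auto
    qed
    show "g = h" if x: "x \<in> bas (Palg n m \<delta>)" "x \<notin> degenerate n m"
      and gh: "g \<in> subb (Palg n m \<delta>)" "h \<in> subb (Palg n m \<delta>)" "is_perm_diag g" "is_perm_diag h"
      and eq: "mul (Palg n m \<delta>) x g = mul (Palg n m \<delta>) x h" for x g h
    proof -
      obtain \<sigma> where s: "\<sigma> permutes {1..n}" "g = perm_diag n \<sigma>" "\<forall>i\<in>{1..n - m}. \<sigma> i = i" using perm[of g] gh
          by auto
      obtain \<tau> where t: "\<tau> permutes {1..n}" "h = perm_diag n \<tau>" "\<forall>i\<in>{1..n - m}. \<tau> i = i" using perm[of h] gh
          by auto
      have "\<sigma> = \<tau>"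
        by (rule perm_free[OF mn _ x(2) s(1) _ t(1)]) (use x(1) s t eq in auto)
      then show ?thesis using s(2) t(2) by simp
    qed
    show "acyclic {l. l \<noteq> [] \<and> last l \<in> degenerate n m}" by (rule acyclic_degenerate[OF mn \<delta>])
    show "degenerate n m \<subseteq> bas (Palg n m \<delta>)" by (auto simp: degenerate_def)
  qed (simp_all add: is_perm_diag_mult diag_prod_id degenerate_not_perm degenerate_left)
qed

lemma zero_boundaries: "(\<lambda>_. 0) \<in> boundaries A k"
proof -
  have w: "(\<lambda>_. 0) \<in> chains A (Suc k)" by (simp add: chains_def)
  have s: "(\<lambda>_. 0) \<in> relsub A k" by (simp add: relsub_def rspan_0)
  have eq: "(\<lambda>_. 0) = (\<lambda>l. bar_d A (Suc k) (\<lambda>_. 0) l + 0)" by (simp add: bar_d_def)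
  show ?thesis unfolding boundaries_def by (intro CollectI bexI[OF _ w] bexI[OF _ s] eq)
qed

theorem theorem5p1:
  fixes \<delta> :: "'a::comm_ring_1" and n m :: nat
  assumes "m \<le> n"
    and "(\<exists>u. \<delta> * u = 1) \<or> m < n"
  shows "\<forall>k.
    (\<forall>z \<in> cycles (Salg n m) k. iota_ch n m k z \<in> cycles (Palg n m \<delta>) k) \<and>
    (\<forall>z \<in> boundaries (Salg n m) k. iota_ch n m k z \<in> boundaries (Palg n m \<delta>) k) \<and>
    (\<forall>z \<in> cycles (Palg n m \<delta>) k. pi_ch n m \<delta> k z \<in> cycles (Salg n m) k) \<and>
    (\<forall>z \<in> boundaries (Palg n m \<delta>) k. pi_ch n m \<delta> k z \<in> boundaries (Salg n m) k) \<and>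
    (\<forall>z \<in> cycles (Salg n m) k.
       (\<lambda>l. pi_ch n m \<delta> k (iota_ch n m k z) l - z l) \<in> boundaries (Salg n m) k) \<and>
    (\<forall>z \<in> cycles (Palg n m \<delta>) k.
       (\<lambda>l. iota_ch n m k (pi_ch n m \<delta> k z) l - z l) \<in> boundaries (Palg n m \<delta>) k)"
proof -
  interpret iota: based_algebra_map "Salg n m" "Palg n m \<delta>" "\<lambda>_. True" "perm_diag n"
    by (rule iota_map[OF assms(1)])
  interpret pi: based_algebra_map "Palg n m \<delta>" "Salg n m" is_perm_diag "perm_of n"
    by (rule pi_map[OF assms(1)])
  interpret P: augmented_algebra "Palg n m \<delta>" is_perm_diag "degenerate n m" "perm_diag n id"
    by (rule augmented_Palg[OF assms])
  \<comment> \<open>An identity of chains and not merely of homology classes: each permutation is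
    recovered from its diagram, and cycles vanish off the basis tuples.\<close>
  have pi_iota: "pi_ch n m \<delta> k (iota_ch n m k z) = z" if z: "z \<in> cycles (Salg n m) k" for k z
  proof
    fix l'
    have "map (perm_of n) (map (perm_diag n) l) = l \<and> list_all is_perm_diag (map (perm_diag n) l)"
      if "l \<in> iota.S.tups (Suc k)" for l
      using that by (auto simp: tuples_def list_all_iff perm_of_perm_diag is_perm_diag_perm_diag intro!: map_idI)
    then have "pi_ch n m \<delta> k (iota_ch n m k z) l' = (\<Sum>l\<in>iota.S.tups (Suc k). z l * bvec l l')"
      unfolding pi_ch_def iota_ch_def pi.chm_kern iota.chm_pairing pi.kern_def
      by (intro sum.cong refl) (simp add: list_all_iff)
    also have "\<dots> = (\<Sum>l\<in>iota.S.tups (Suc k). if l = l' then z l' else 0)"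
      by (intro sum.cong) (auto simp: bvec_def)
    also have "\<dots> = (if l' \<in> iota.S.tups (Suc k) then z l' else 0)"
      by (rule sum.delta[OF iota.S.finite_tups])
    also have "\<dots> = z l'" using z by (simp add: cycles_def chains_def)
    finally show "pi_ch n m \<delta> k (iota_ch n m k z) l' = z l'" .
  qed
  \<comment> \<open>In this order the composite cuts a chain down to the tuples of permutation
    diagrams.\<close>
  have iota_pi: "iota_ch n m k (pi_ch n m \<delta> k z) l' =
      (if l' \<in> iota.T.tups (Suc k) \<and> list_all is_perm_diag l' then z l' else 0)" for k l' and z :: "int set
          set list \<Rightarrow> 'a"
  proof -
    have "map (perm_diag n) (map (perm_of n) l) = l" if "l \<in> iota.T.tups (Suc k)" "list_all is_perm_diag l"
        for l
      using that by (auto simp: tuples_def list_all_iff perm_of(2) intro!: map_idI)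
    then have "iota_ch n m k (pi_ch n m \<delta> k z) l' =
        (\<Sum>l\<in>iota.T.tups (Suc k). z l * (if list_all is_perm_diag l then bvec l l' else 0))"
      unfolding pi_ch_def iota_ch_def iota.chm_kern pi.chm_pairing iota.kern_def
      by (intro sum.cong refl) (simp add: list_all_iff)
    also have "\<dots> = (\<Sum>l\<in>iota.T.tups (Suc k). if l =
        l' then (if list_all is_perm_diag l' then z l' else 0) else 0)"
      by (intro sum.cong) (auto simp: bvec_def)
    also have "\<dots> = (if l' \<in> iota.T.tups (Suc k) then if list_all is_perm_diag l' then z l' else 0 else 0)"
      by (rule sum.delta[OF iota.T.finite_tups])
    also have "\<dots> = (if l' \<in> iota.T.tups (Suc k) \<and> list_all is_perm_diag l' then z l' else 0)"
      by simp
    finally show ?thesis .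
  qed
  \<comment> \<open>The difference is a cycle modulo relations carried by tuples with a
    non-permutation entry, which is the situation of \<open>nonP_cycle_boundary\<close>.\<close>
  have iota_pi_homologous: "(\<lambda>l. iota_ch n m k (pi_ch n m \<delta> k z) l - z l) \<in> boundaries (Palg n m \<delta>) k"
    if z: "z \<in> cycles (Palg n m \<delta>) k" for k z
  proof (rule P.nonP_cycle_boundary)
    show "(\<lambda>l. iota_ch n m k (pi_ch n m \<delta> k z) l - z l) \<in> iota.T.csupp {l. \<not> list_all is_perm_diag l} k"
      unfolding iota.T.csupp_def
    proof (intro CollectI allI impI)
      fix l assume l: "l \<notin> iota.T.tups (Suc k) \<inter> {l. \<not> list_all is_perm_diag l}"
      have "z l = 0" if "l \<notin> iota.T.tups (Suc k)" using z that by (simp add: cycles_def chains_def)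
      then show "iota_ch n m k (pi_ch n m \<delta> k z) l - z l = 0" unfolding iota_pi using l by auto
    qed
    have "iota_ch n m k (pi_ch n m \<delta> k z) \<in> cycles (Palg n m \<delta>) k"
      unfolding iota_ch_def pi_ch_def by (intro iota.chm_cycles pi.chm_cycles z)
    then show "bar_d (Palg n m \<delta>) k (\<lambda>l. iota_ch n m k (pi_ch n m \<delta> k z) l - z l) \<in> relsub (Palg n m \<delta>) (k - 1)"
      using z unfolding iota.T.bar_d_diff cycles_def relsub_def mem_Collect_eq
      by (elim conjE) (rule rspan_diff)
  qed
  show ?thesis
  proof (intro allI conjI ballI)
    fix k
    show "iota_ch n m k z \<in> cycles (Palg n m \<delta>) k" if "z \<in> cycles (Salg n m) k" for z
      unfolding iota_ch_def by (rule iota.chm_cycles[OF that])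
    show "iota_ch n m k z \<in> boundaries (Palg n m \<delta>) k" if "z \<in> boundaries (Salg n m) k" for z
      unfolding iota_ch_def by (rule iota.chm_boundaries[OF that])
    show "pi_ch n m \<delta> k z \<in> cycles (Salg n m) k" if "z \<in> cycles (Palg n m \<delta>) k" for z
      unfolding pi_ch_def by (rule pi.chm_cycles[OF that])
    show "pi_ch n m \<delta> k z \<in> boundaries (Salg n m) k" if "z \<in> boundaries (Palg n m \<delta>) k" for z
      unfolding pi_ch_def by (rule pi.chm_boundaries[OF that])
    show "(\<lambda>l. pi_ch n m \<delta> k (iota_ch n m k z) l - z l) \<in> boundaries (Salg n m) k"
      if "z \<in> cycles (Salg n m) k" for z
      unfolding pi_iota[OF that] diff_self by (rule zero_boundaries)
    show "(\<lambda>l. iota_ch n m k (pi_ch n m \<delta> k z) l - z l) \<in> boundaries (Palg n m \<delta>) k"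
      if "z \<in> cycles (Palg n m \<delta>) k" for z
      by (rule iota_pi_homologous[OF that])
  qed
qed

end
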